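(* Let $N\ge3$ be an integer and $0<c<1$. For $x_1^*,x_2^*>0$ put $\alpha_1:=\lim_{n_1\to\infty}P(X(n_1)>x_1^* )$, $\alpha_2:=\lim_{n_2\to\infty}P(X(n_2)>x_2^* )$ and $\alpha:=\lim_{n_1,n_2\to\infty,\ \frac{n_1}{n_2}\to c^2}P(X(n_1)>x_1^*,X(n_2)>x_2^* )$. Suppose that $x_1^*\to+\infty$ and $x_2^*\to+\infty$ so that $\alpha_2=\alpha_1$. Then $$\alpha\sim\frac{(1-c^2)^{\frac32}\left(\Gamma(\frac{N-1}2)\right)^{\frac{1-c}{1+c}}}{2c^{\frac N2-1}\sqrt\pi(1-c)^2}\cdot(-\ln\alpha_1)^{\frac N2-\frac{N-3}{1+c}-2}\,(\alpha_1)^{\frac2{1+c}},$$ where $\frac2{1+c}\in(1,2)$.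
   Context: Consider independent trials with $N$ outcomes, the $j$-th outcome having probability $p_j>0$ ($\sum_j p_j=1$). Let $\nu_j(n)$ be the number of occurrences of outcome $j$ in the first $n$ trials and $X(n)=\sum_{j=1}^N\frac{(\nu_j(n)-np_j)^2}{np_j}$ the Pearson statistic; $n_1<n_2$ are sample sizes. The paper uses as known that the limit law of $X(n)$ is $\chi^2(N-1)$ and that $$\alpha=\int_{x_1^*/2}^\infty\int_{x_2^*/2}^\infty p_{2,0}(u_1,u_2)\,du_2\,du_1,$$ $$p_{2,0}(u_1,u_2)=\frac{e^{-(\frac{u_1}\beta+\frac{u_2}\beta)}}{K_2^{1+\delta}c^\delta\Gamma(1+\delta)\beta^2}\left(\frac{u_1u_2}{\beta^2}\right)^{\frac\delta2}I_\delta\left(\frac{2c\sqrt{u_1u_2}}\beta\right),$$ where $\beta=1-c^2$, $K_2=\frac1{1-c^2}$, $\delta=\frac{N-3}2$, and $I_\delta(x)=\sum_{k=0}^\infty\frac{(x/2)^{\delta+2k}}{\Gamma(k+1)\Gamma(k+\delta+1)}$ is the Infeld (modified Bessel) function. The notation $f\sim g$ means $f/g\to1$; $N$ and $c$ are fixed. *)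

theory Defs
  imports "HOL-Probability.Probability"
begin

text \<open>\<open>Y i\<close> is the outcome of the \<open>i\<close>-th trial, \<open>i = 0, 1, \<dots>\<close>; the outcomes are \<open>1, \<dots>, N\<close>,
  with probabilities \<open>p 1, \<dots>, p N\<close>.\<close>

definition occurrences :: "(nat \<Rightarrow> 'a \<Rightarrow> nat) \<Rightarrow> nat \<Rightarrow> nat \<Rightarrow> 'a \<Rightarrow> nat" where
  "occurrences Y j n \<omega> = card {i. i < n \<and> Y i \<omega> = j}"

definition pearson :: "nat \<Rightarrow> (nat \<Rightarrow> real) \<Rightarrow> (nat \<Rightarrow> 'a \<Rightarrow> nat) \<Rightarrow> nat \<Rightarrow> 'a \<Rightarrow> real" where
  "pearson N p Y n \<omega> =
     (\<Sum>j=1..N. (real (occurrences Y j n \<omega>) - real n * p j)\<^sup>2 / (real n * p j))"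

definition limit_tail ::
  "'a measure \<Rightarrow> nat \<Rightarrow> (nat \<Rightarrow> real) \<Rightarrow> (nat \<Rightarrow> 'a \<Rightarrow> nat) \<Rightarrow> real \<Rightarrow> real" where
  "limit_tail M N p Y x = lim (\<lambda>n. \<P>(\<omega> in M. pearson N p Y n \<omega> > x))"

text \<open>Both sample sizes tend to infinity while \<open>n\<^sub>1 / n\<^sub>2\<close> tends to \<open>r\<close>.
  For \<open>r < 1\<close> this forces \<open>n\<^sub>1 < n\<^sub>2\<close> eventually.\<close>

definition sample_sizes :: "real \<Rightarrow> (nat \<times> nat) filter" where
  "sample_sizes r =
     inf (sequentially \<times>\<^sub>F sequentially)
         (filtercomap (\<lambda>(n\<^sub>1, n\<^sub>2). real n\<^sub>1 / real n\<^sub>2) (nhds r))"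

definition limit_joint_tail ::
  "'a measure \<Rightarrow> nat \<Rightarrow> (nat \<Rightarrow> real) \<Rightarrow> (nat \<Rightarrow> 'a \<Rightarrow> nat) \<Rightarrow> real \<Rightarrow> real \<Rightarrow> real \<Rightarrow> real" where
  "limit_joint_tail M N p Y c x\<^sub>1 x\<^sub>2 =
     Lim (sample_sizes (c\<^sup>2))
       (\<lambda>(n\<^sub>1, n\<^sub>2). \<P>(\<omega> in M. pearson N p Y n\<^sub>1 \<omega> > x\<^sub>1 \<and> pearson N p Y n\<^sub>2 \<omega> > x\<^sub>2))"

end

theory Submission
  imports Defs "HOL-Real_Asymp.Real_Asymp"
begin

text \<open>
  In suitable coordinates, \<open>X(n)\<close> is the squared length of a normalised sum of independent, centred,
  isotropic vectors in dimension \<open>N - 1\<close> (\<open>pearson_as_squared_length\<close>). Two such sums over nested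
  samples are jointly asymptotically Gaussian, and corresponding coordinates have correlation
  \<open>sqrt (n\<^sub>1 / n\<^sub>2)\<close>, which tends to \<open>c\<close>. So the pair \<open>(X(n\<^sub>1) / 2, X(n\<^sub>2) / 2)\<close> converges in law to
  Kibble's bivariate gamma distribution, whose density is the function \<open>p\<^sub>2\<^sub>,\<^sub>0\<close> of the introduction.

  The convergence is obtained from Laplace transforms. Writing \<open>exp (- a\<^sup>2 / 2)\<close> as the
  characteristic function of a standard normal variable linearises the two squared lengths in the
  exponent. This turns the joint Laplace transform into a Gaussian average of products of powers of the
  characteristic function of a single trial; these powers converge, and dominated convergence gives
  the limit \<open>((1 + 2 s) (1 + 2 t) - 4 c\<^sup>2 s t) powr (- (N - 1) / 2)\<close> (\<open>joint_laplace_tendsto\<close>). That is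
  the Laplace transform of the Kibble distribution, which is computed by integrating the Bessel
  series term by term (\<open>laplace_kibble\<close>). Laplace transforms at pairs of natural numbers are the
  moments of \<open>(exp (- X(n\<^sub>1)), exp (- X(n\<^sub>2)))\<close> in the unit square, so by the Weierstrass theorem they
  determine the limits of the tail probabilities (\<open>laplace_determines_joint_tail\<close>).

  What remains is analysis. Put \<open>\<delta> = (N - 3) / 2\<close> and \<open>\<beta> = 1 - c\<^sup>2\<close>. Since
  \<open>I\<^sub>\<delta>(z) \<sim> exp z / sqrt (2 \<pi> z)\<close> and
  \<open>(u + v - 2 c sqrt (u v)) / \<beta> = (u + v) / (1 + c) + (c / \<beta>) (sqrt u - sqrt v)\<^sup>2\<close>,
  the density near the corner \<open>(x, x)\<close> behaves like a constant multiple of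
  \<open>x powr (\<delta> - 1 / 2) * exp (- (u + v) / (1 + c))\<close>, and integration over the quadrant multiplies the value
  at the corner by \<open>(1 + c)\<^sup>2\<close> (\<open>joint_tail_asymptotics\<close>). The single tail is that of a gamma
  distribution, asymptotic to \<open>x powr \<delta> * exp (- x) / \<Gamma>(\<delta> + 1)\<close> (\<open>single_tail_asymptotics\<close>), and it is
  strictly decreasing, so \<open>\<alpha>\<^sub>2 = \<alpha>\<^sub>1\<close> forces equal thresholds. With \<open>x\<close> half of the common threshold,
  \<open>x \<sim> - ln \<alpha>\<^sub>1\<close>, and eliminating \<open>x\<close> between the two asymptotic formulas gives the claim
  (\<open>joint_tail_single_tail_ratio\<close>).
\<close>

section \<open>Moments, Laplace transforms and joint tails\<close>

text \<open>Products enter only through multiplication by a coordinate. A claim about \<open>A ^ j * B ^ l * f (A, B)\<close>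
  for all \<open>j\<close> and \<open>l\<close> can then be proved by induction, because such a multiplication only shifts an
  exponent; closure under arbitrary products is a consequence.\<close>

inductive bivariate_polynomial :: "(real \<times> real \<Rightarrow> real) \<Rightarrow> bool" where
  const: "bivariate_polynomial (\<lambda>_. a)"
| add: "bivariate_polynomial f \<Longrightarrow> bivariate_polynomial g \<Longrightarrow> bivariate_polynomial (\<lambda>z. f z + g z)"
| fst: "bivariate_polynomial f \<Longrightarrow> bivariate_polynomial (\<lambda>z. fst z * f z)"
| snd: "bivariate_polynomial f \<Longrightarrow> bivariate_polynomial (\<lambda>z. snd z * f z)"

lemma bivariate_polynomial_scale:
  assumes "bivariate_polynomial f" shows "bivariate_polynomial (\<lambda>z. a * f z)"
  using assms
proof induction
  case (add f g)
  then show ?case using bivariate_polynomial.add by (simp add: distrib_left)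
qed (auto intro: bivariate_polynomial.intros simp: mult.left_commute[of a])

lemma bivariate_polynomial_mult:
  assumes "bivariate_polynomial f" "bivariate_polynomial g"
  shows "bivariate_polynomial (\<lambda>z. f z * g z)"
  using assms
proof induction
  case (const a) then show ?case by (rule bivariate_polynomial_scale)
next
  case (add f h) then show ?case using bivariate_polynomial.add by (simp add: distrib_right)
qed (auto intro: bivariate_polynomial.intros simp: mult.assoc)

lemma bivariate_polynomial_continuous:
  "bivariate_polynomial f \<Longrightarrow> continuous_on S f"
  by (induction rule: bivariate_polynomial.induct) (auto intro!: continuous_intros)

lemma bivariate_polynomial_approx:
  assumes "continuous_on ({0..1} \<times> {0..1}) f" "e > 0"
  shows "\<exists>g. bivariate_polynomial g \<and> (\<forall>z\<in>{0..1} \<times> {0..1}. \<bar>f z - g z\<bar> < e)"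
proof (rule Stone_Weierstrass_HOL[where P = bivariate_polynomial])
  show "compact ({0..1::real} \<times> {0..1::real})" by (intro compact_Times) auto
next
  fix x y :: "real \<times> real" assume "x \<in> {0..1} \<times> {0..1} \<and> y \<in> {0..1} \<times> {0..1} \<and> x \<noteq> y"
  moreover have "bivariate_polynomial (\<lambda>z. fst z * 1)" "bivariate_polynomial (\<lambda>z. snd z * 1)"
    by (intro bivariate_polynomial.intros)+
  ultimately show "\<exists>f. bivariate_polynomial f \<and> f x \<noteq> f y"
    by (metis mult.right_neutral prod.expand)
qed (use assms in \<open>auto intro: bivariate_polynomial.intros bivariate_polynomial_mult
      bivariate_polynomial_continuous\<close>)

text \<open>Convergence of the moments gives convergence of the expectation of every polynomial, and polynomials
  are uniformly dense in the continuous functions on the square.\<close>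

lemma square_moments_determine_weak_limit:
  fixes A B :: "'i \<Rightarrow> 'a \<Rightarrow> real" and U V :: "'b \<Rightarrow> real"
    and f :: "real \<times> real \<Rightarrow> real"
  assumes "prob_space M" "prob_space L"
    and meas[measurable]: "\<And>i. A i \<in> borel_measurable M" "\<And>i. B i \<in> borel_measurable M"
      "U \<in> borel_measurable L" "V \<in> borel_measurable L"
    and range: "\<And>i \<omega>. A i \<omega> \<in> {0..1}" "\<And>i \<omega>. B i \<omega> \<in> {0..1}"
      "\<And>\<omega>. U \<omega> \<in> {0..1}" "\<And>\<omega>. V \<omega> \<in> {0..1}"
    and moments: "\<And>j l. ((\<lambda>i. \<integral>\<omega>. A i \<omega> ^ j * B i \<omega> ^ l \<partial>M) \<longlongrightarrow> (\<integral>\<omega>. U \<omega> ^ j * V \<omega> ^ l \<partial>L)) G"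
    and f: "continuous_on UNIV f"
  shows "((\<lambda>i. \<integral>\<omega>. f (A i \<omega>, B i \<omega>) \<partial>M) \<longlongrightarrow> (\<integral>\<omega>. f (U \<omega>, V \<omega>) \<partial>L)) G"
proof -
  interpret M: prob_space M by fact
  interpret L: prob_space L by fact
  have bdd: "\<exists>K. \<forall>z\<in>{0..1} \<times> {0..1}. \<bar>g z\<bar> \<le> K" if "continuous_on UNIV g" for g :: "real \<times> real \<Rightarrow> real"
  proof -
    have "compact (g ` ({0..1::real} \<times> {0..1::real}))"
      using that by (intro compact_continuous_image compact_Times) (auto intro: continuous_on_subset)
    then show ?thesis by (auto dest!: compact_imp_bounded simp: bounded_iff)
  qed
  have int: "integrable M (\<lambda>\<omega>. g (A i \<omega>, B i \<omega>))" "integrable L (\<lambda>\<omega>. g (U \<omega>, V \<omega>))"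
    if "continuous_on UNIV g" for g :: "real \<times> real \<Rightarrow> real" and i
  proof -
    have [measurable]: "g \<in> borel_measurable borel" using that by (rule borel_measurable_continuous_onI)
    have [measurable]: "g \<in> borel_measurable (borel \<Otimes>\<^sub>M borel)" by (simp add: borel_prod)
    obtain K where K: "\<forall>z\<in>{0..1} \<times> {0..1}. \<bar>g z\<bar> \<le> K" using bdd \<open>continuous_on UNIV g\<close> by blast
    show "integrable M (\<lambda>\<omega>. g (A i \<omega>, B i \<omega>))"
      by (rule M.integrable_const_bound[of _ K]) (use K range in auto)
    show "integrable L (\<lambda>\<omega>. g (U \<omega>, V \<omega>))"
      by (rule L.integrable_const_bound[of _ K]) (use K range in auto)
  qed
  have poly: "((\<lambda>i. \<integral>\<omega>. A i \<omega> ^ j * B i \<omega> ^ l * g (A i \<omega>, B i \<omega>) \<partial>M)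
      \<longlongrightarrow> (\<integral>\<omega>. U \<omega> ^ j * V \<omega> ^ l * g (U \<omega>, V \<omega>) \<partial>L)) G"
    if "bivariate_polynomial g" for g j l
    using that
  proof (induction arbitrary: j l)
    case (const a)
    then show ?case using tendsto_mult_right[OF moments[of j l], of a] by simp
  next
    case (add g h)
    have c: "continuous_on UNIV (\<lambda>z::real\<times>real. fst z ^ j * snd z ^ l * g z)"
         "continuous_on UNIV (\<lambda>z::real\<times>real. fst z ^ j * snd z ^ l * h z)"
      by (intro continuous_intros bivariate_polynomial_continuous add)+
    show ?case
      using tendsto_add[OF add.IH(1)[of j l] add.IH(2)[of j l]] int(1)[OF c(1)] int(1)[OF c(2)]
        int(2)[OF c(1)] int(2)[OF c(2)]
      by (simp add: distrib_left)
  next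
    case (fst g) then show ?case using fst.IH[of "Suc j" l] by (simp add: mult_ac)
  next
    case (snd g) then show ?case using snd.IH[of j "Suc l"] by (simp add: mult_ac)
  qed
  show ?thesis
  proof (rule tendstoI)
    fix e :: real assume "e > 0"
    then obtain g where g: "bivariate_polynomial g" and
        close: "\<And>z. z \<in> {0..1} \<times> {0..1} \<Longrightarrow> \<bar>f z - g z\<bar> < e / 3"
      using bivariate_polynomial_approx[of f "e / 3"] f continuous_on_subset
      by (meson subset_UNIV zero_less_divide_iff zero_less_numeral)
    have gc: "continuous_on UNIV g" using g by (rule bivariate_polynomial_continuous)
    have dM: "\<bar>(\<integral>\<omega>. f (A i \<omega>, B i \<omega>) \<partial>M) - (\<integral>\<omega>. g (A i \<omega>, B i \<omega>) \<partial>M)\<bar> \<le> e / 3" for i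
    proof -
      have "\<bar>\<integral>\<omega>. f (A i \<omega>, B i \<omega>) - g (A i \<omega>, B i \<omega>) \<partial>M\<bar> \<le> (\<integral>\<omega>. \<bar>f (A i \<omega>, B i \<omega>) - g (A i \<omega>, B i \<omega>)\<bar> \<partial>M)"
        by (rule integral_abs_bound)
      also have "\<dots> \<le> e / 3"
        by (rule M.integral_le_const)
          (use int(1)[OF f] int(1)[OF gc] close range in \<open>auto intro!: less_imp_le simp: mem_Times_iff\<close>)
      finally show ?thesis using int(1)[OF f] int(1)[OF gc] by simp
    qed
    have dL: "\<bar>(\<integral>\<omega>. f (U \<omega>, V \<omega>) \<partial>L) - (\<integral>\<omega>. g (U \<omega>, V \<omega>) \<partial>L)\<bar> \<le> e / 3"
    proof -
      have "\<bar>\<integral>\<omega>. f (U \<omega>, V \<omega>) - g (U \<omega>, V \<omega>) \<partial>L\<bar> \<le> (\<integral>\<omega>. \<bar>f (U \<omega>, V \<omega>) - g (U \<omega>, V \<omega>)\<bar> \<partial>L)"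
        by (rule integral_abs_bound)
      also have "\<dots> \<le> e / 3"
        by (rule L.integral_le_const)
          (use int(2)[OF f] int(2)[OF gc] close range in \<open>auto intro!: less_imp_le simp: mem_Times_iff\<close>)
      finally show ?thesis using int(2)[OF f] int(2)[OF gc] by simp
    qed
    have "\<forall>\<^sub>F i in G. dist (\<integral>\<omega>. g (A i \<omega>, B i \<omega>) \<partial>M) (\<integral>\<omega>. g (U \<omega>, V \<omega>) \<partial>L) < e / 3"
      using tendstoD[OF poly[OF g, of 0 0], of "e / 3"] \<open>e > 0\<close> by simp
    then show "\<forall>\<^sub>F i in G. dist (\<integral>\<omega>. f (A i \<omega>, B i \<omega>) \<partial>M) (\<integral>\<omega>. f (U \<omega>, V \<omega>) \<partial>L) < e"
    proof eventually_elim
      case (elim i)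
      then show ?case using dL dM[of i] unfolding dist_real_def by linarith
    qed
  qed
qed

text \<open>The indicator of \<open>z < a\<close>, made continuous on an interval of length \<open>e\<close> so that weak convergence
  applies to it.\<close>

definition ramp :: "real \<Rightarrow> real \<Rightarrow> real \<Rightarrow> real" where
  "ramp e a z = max 0 (min 1 ((a - z) / e))"

lemma ramp_bounds: "0 \<le> ramp e a z" "ramp e a z \<le> 1"
  by (auto simp: ramp_def)

lemma ramp_le_indicator: "e > 0 \<Longrightarrow> ramp e a z \<le> of_bool (z < a)"
  by (auto simp: ramp_def field_simps)

lemma indicator_le_ramp: "e > 0 \<Longrightarrow> of_bool (z \<le> a) \<le> ramp e (a + e) z"
  by (auto simp: ramp_def field_simps)

lemma ramp_tendsto_strict: "(\<lambda>n. ramp (1 / Suc n) a z) \<longlonglongrightarrow> of_bool (z < a)"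
proof (cases "z < a")
  case True
  obtain n0 where "1 / (a - z) < real n0" using reals_Archimedean2 by blast
  then have n0: "1 < real n0 * (a - z)" using True by (simp add: field_simps)
  have "ramp (1 / Suc n) a z = 1" if "n \<ge> n0" for n
  proof -
    have "real n0 * (a - z) \<le> real (Suc n) * (a - z)"
      using that True by (intro mult_right_mono) auto
    then show ?thesis using n0 by (simp add: ramp_def mult.commute)
  qed
  then show ?thesis using True by (intro tendsto_eventually) (auto simp: eventually_sequentially)
next
  case False
  then have "(a - z) / (1 / Suc n) \<le> 0" for n by (intro divide_nonpos_pos) auto
  then have "ramp (1 / Suc n) a z = 0" for n
    unfolding ramp_def by (metis max.absorb1 min.coboundedI2)
  then show ?thesis using False by simp
qed

lemma ramp_tendsto_weak: "(\<lambda>n. ramp (1 / Suc n) (a + 1 / Suc n) z) \<longlonglongrightarrow> of_bool (z \<le> a)"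
proof -
  have eq: "ramp (1 / Suc n) (a + 1 / Suc n) z = 1 - ramp (1 / Suc n) z a" for n
  proof -
    have "(a + 1 / Suc n - z) / (1 / Suc n) = 1 - (z - a) / (1 / Suc n)"
      by (simp add: field_simps)
    then show ?thesis unfolding ramp_def by (auto simp: max_def min_def)
  qed
  have "(\<lambda>n. 1 - ramp (1 / Suc n) z a) \<longlonglongrightarrow> 1 - of_bool (a < z)"
    by (intro tendsto_intros ramp_tendsto_strict)
  then show ?thesis unfolding eq by (auto simp: of_bool_def split: if_splits)
qed

lemma continuous_ramp [continuous_intros]:
  "continuous_on S f \<Longrightarrow> continuous_on S (\<lambda>x. ramp e a (f x))"
  unfolding ramp_def divide_inverse by (intro continuous_intros)

lemma measurable_ramp [measurable]: "ramp e a \<in> borel_measurable borel"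
  unfolding ramp_def by measurable

lemma (in prob_space) prob_eq_integral_of_bool:
  assumes "{\<omega> \<in> space M. P \<omega>} \<in> events"
  shows "\<P>(\<omega> in M. P \<omega>) = (\<integral>\<omega>. of_bool (P \<omega>) \<partial>M)"
proof -
  have "(\<integral>\<omega>. of_bool (P \<omega>) \<partial>M) = (\<integral>\<omega>. indicator {\<omega> \<in> space M. P \<omega>} \<omega> \<partial>M)"
    by (intro Bochner_Integration.integral_cong) (auto simp: indicator_def)
  then show ?thesis
    by (subst (asm) Bochner_Integration.integral_indicator) (simp add: Int_absorb2)
qed

text \<open>The variables \<open>exp (- X)\<close> and \<open>exp (- Y)\<close> take values in the unit interval, and their joint moments
  are the Laplace transform at natural numbers. The event \<open>X > x \<and> Y > y\<close> is a rectangle for them,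
  and its indicator lies between products of ramps whose limiting expectations differ arbitrarily
  little, because the limit law does not charge the boundary of the rectangle.\<close>

lemma laplace_determines_joint_tail:
  fixes X Y :: "'i \<Rightarrow> 'a \<Rightarrow> real" and U V :: "'b \<Rightarrow> real"
  assumes "prob_space M" "prob_space L"
    and meas[measurable]: "\<And>i. X i \<in> borel_measurable M" "\<And>i. Y i \<in> borel_measurable M"
      "U \<in> borel_measurable L" "V \<in> borel_measurable L"
    and nonneg: "\<And>i \<omega>. X i \<omega> \<ge> 0" "\<And>i \<omega>. Y i \<omega> \<ge> 0" "\<And>\<omega>. U \<omega> \<ge> 0" "\<And>\<omega>. V \<omega> \<ge> 0"
    and laplace: "\<And>j l. ((\<lambda>i. \<integral>\<omega>. exp (- real j * X i \<omega> - real l * Y i \<omega>) \<partial>M)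
        \<longlongrightarrow> (\<integral>\<omega>. exp (- real j * U \<omega> - real l * V \<omega>) \<partial>L)) G"
    and cont: "AE \<omega> in L. U \<omega> \<noteq> x" "AE \<omega> in L. V \<omega> \<noteq> y"
  shows "((\<lambda>i. \<P>(\<omega> in M. X i \<omega> > x \<and> Y i \<omega> > y)) \<longlongrightarrow> \<P>(\<omega> in L. U \<omega> > x \<and> V \<omega> > y)) G"
proof -
  interpret M: prob_space M by fact
  interpret L: prob_space L by fact
  define a where "a = exp (- x)"
  define b where "b = exp (- y)"
  define q where "q = \<P>(\<omega> in L. U \<omega> > x \<and> V \<omega> > y)"
  define lo where "lo n z = ramp (1 / Suc n) a (fst z) * ramp (1 / Suc n) b (snd z)" for n and z :: "real \<times> real"
  define up where "up n z = ramp (1 / Suc n) (a + 1 / Suc n) (fst z) * ramp (1 / Suc n) (b + 1 / Suc n) (snd z)"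
    for n and z :: "real \<times> real"
  have pos: "1 / real (Suc n) > 0" for n by simp
  have bnd: "norm (lo n z) \<le> 1" "norm (up n z) \<le> 1" for n z
    unfolding lo_def up_def using ramp_bounds by (auto simp: norm_mult intro!: mult_le_one)
  have lo_le: "lo n (exp (- u), exp (- v)) \<le> of_bool (u > x \<and> v > y)" for n u v
    using mult_mono[OF ramp_le_indicator[OF pos, of n a "exp (- u)"] ramp_le_indicator[OF pos, of n b "exp (- v)"]]
    by (simp add: lo_def a_def b_def ramp_bounds of_bool_conj)
  have up_ge: "of_bool (u > x \<and> v > y) \<le> up n (exp (- u), exp (- v))" for n u v
  proof -
    have "of_bool (exp (- u) \<le> a) * of_bool (exp (- v) \<le> b) \<le> up n (exp (- u), exp (- v))"
      unfolding up_def fst_conv snd_conv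
      by (intro mult_mono indicator_le_ramp pos ramp_bounds) auto
    then show ?thesis unfolding a_def b_def by (auto simp: of_bool_def split: if_splits)
  qed
  have [measurable]: "lo n \<in> borel_measurable (borel \<Otimes>\<^sub>M borel)" "up n \<in> borel_measurable (borel \<Otimes>\<^sub>M borel)" for n
    unfolding lo_def up_def by measurable
  have conv: "((\<lambda>i. \<integral>\<omega>. f (exp (- X i \<omega>), exp (- Y i \<omega>)) \<partial>M) \<longlongrightarrow> (\<integral>\<omega>. f (exp (- U \<omega>), exp (- V \<omega>)) \<partial>L)) G"
    if "continuous_on UNIV f" for f :: "real \<times> real \<Rightarrow> real"
  proof (rule square_moments_determine_weak_limit[OF assms(1,2) _ _ _ _ _ _ _ _ _ that])
    fix j l
    have e: "exp (- u) ^ j * exp (- v) ^ l = exp (- real j * u - real l * v)" for u v :: real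
      by (simp flip: exp_of_nat_mult exp_add add: algebra_simps)
    show "((\<lambda>i. \<integral>\<omega>. exp (- X i \<omega>) ^ j * exp (- Y i \<omega>) ^ l \<partial>M)
        \<longlongrightarrow> (\<integral>\<omega>. exp (- U \<omega>) ^ j * exp (- V \<omega>) ^ l \<partial>L)) G"
      unfolding e by (rule laplace)
  qed (use nonneg in auto)
  have cont_lo: "continuous_on UNIV (lo n)" and cont_up: "continuous_on UNIV (up n)" for n
    unfolding lo_def up_def by (intro continuous_intros)+
  have q_int: "q = (\<integral>\<omega>. of_bool (U \<omega> > x \<and> V \<omega> > y) \<partial>L)"
    unfolding q_def by (rule L.prob_eq_integral_of_bool) measurable
  have P_int: "\<P>(\<omega> in M. X i \<omega> > x \<and> Y i \<omega> > y) = (\<integral>\<omega>. of_bool (X i \<omega> > x \<and> Y i \<omega> > y) \<partial>M)" for i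
    by (rule M.prob_eq_integral_of_bool) measurable
  have lim_lo: "(\<lambda>n. \<integral>\<omega>. lo n (exp (- U \<omega>), exp (- V \<omega>)) \<partial>L) \<longlonglongrightarrow> q"
    unfolding q_int
  proof (rule integral_dominated_convergence[where w = "\<lambda>_. 1"])
    have "(\<lambda>n. lo n (exp (- u), exp (- v))) \<longlonglongrightarrow> of_bool (exp (- u) < a) * of_bool (exp (- v) < b)" for u v
      unfolding lo_def fst_conv snd_conv by (intro tendsto_mult ramp_tendsto_strict)
    then show "AE \<omega> in L. (\<lambda>n. lo n (exp (- U \<omega>), exp (- V \<omega>))) \<longlonglongrightarrow> of_bool (U \<omega> > x \<and> V \<omega> > y)"
      by (auto simp: a_def b_def of_bool_conj)
  qed (use bnd in auto)
  have lim_up: "(\<lambda>n. \<integral>\<omega>. up n (exp (- U \<omega>), exp (- V \<omega>)) \<partial>L) \<longlonglongrightarrow> q"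
    unfolding q_int
  proof (rule integral_dominated_convergence[where w = "\<lambda>_. 1"])
    have l: "(\<lambda>n. up n (exp (- u), exp (- v))) \<longlonglongrightarrow> of_bool (exp (- u) \<le> a) * of_bool (exp (- v) \<le> b)" for u v
      unfolding up_def fst_conv snd_conv by (intro tendsto_mult ramp_tendsto_weak)
    show "AE \<omega> in L. (\<lambda>n. up n (exp (- U \<omega>), exp (- V \<omega>))) \<longlonglongrightarrow> of_bool (U \<omega> > x \<and> V \<omega> > y)"
      using cont
    proof eventually_elim
      case (elim \<omega>)
      have "of_bool (exp (- U \<omega>) \<le> a) * of_bool (exp (- V \<omega>) \<le> b) = (of_bool (U \<omega> > x \<and> V \<omega> > y) :: real)"
        using elim by (auto simp: a_def b_def)
      then show ?case using l[of "U \<omega>" "V \<omega>"] by simp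
    qed
  qed (use bnd in auto)
  have "((\<lambda>i. \<integral>\<omega>. of_bool (X i \<omega> > x \<and> Y i \<omega> > y) \<partial>M) \<longlongrightarrow> q) G"
  proof (rule order_tendstoI)
    fix r assume "r < q"
    then have "\<forall>\<^sub>F n in sequentially. r < (\<integral>\<omega>. lo n (exp (- U \<omega>), exp (- V \<omega>)) \<partial>L)"
      using order_tendstoD(1)[OF lim_lo] by blast
    then obtain n where "r < (\<integral>\<omega>. lo n (exp (- U \<omega>), exp (- V \<omega>)) \<partial>L)"
      by (auto simp: eventually_sequentially)
    then have "\<forall>\<^sub>F i in G. r < (\<integral>\<omega>. lo n (exp (- X i \<omega>), exp (- Y i \<omega>)) \<partial>M)"
      using conv[OF cont_lo] order_tendstoD by blast
    then show "\<forall>\<^sub>F i in G. r < (\<integral>\<omega>. of_bool (X i \<omega> > x \<and> Y i \<omega> > y) \<partial>M)"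
    proof eventually_elim
      case (elim i)
      have "(\<integral>\<omega>. lo n (exp (- X i \<omega>), exp (- Y i \<omega>)) \<partial>M) \<le> (\<integral>\<omega>. of_bool (X i \<omega> > x \<and> Y i \<omega> > y) \<partial>M)"
        by (intro integral_mono M.integrable_const_bound[of _ 1] lo_le) (use bnd in auto)
      then show ?case using elim by linarith
    qed
  next
    fix r assume "r > q"
    then have "\<forall>\<^sub>F n in sequentially. r > (\<integral>\<omega>. up n (exp (- U \<omega>), exp (- V \<omega>)) \<partial>L)"
      using lim_up order_tendstoD(2) by blast
    then obtain n where "r > (\<integral>\<omega>. up n (exp (- U \<omega>), exp (- V \<omega>)) \<partial>L)"
      by (auto simp: eventually_sequentially)
    then have "\<forall>\<^sub>F i in G. r > (\<integral>\<omega>. up n (exp (- X i \<omega>), exp (- Y i \<omega>)) \<partial>M)"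
      using conv[OF cont_up] order_tendstoD by blast
    then show "\<forall>\<^sub>F i in G. r > (\<integral>\<omega>. of_bool (X i \<omega> > x \<and> Y i \<omega> > y) \<partial>M)"
    proof eventually_elim
      case (elim i)
      have "(\<integral>\<omega>. up n (exp (- X i \<omega>), exp (- Y i \<omega>)) \<partial>M) \<ge> (\<integral>\<omega>. of_bool (X i \<omega> > x \<and> Y i \<omega> > y) \<partial>M)"
        by (intro integral_mono M.integrable_const_bound[of _ 1] up_ge) (use bnd in auto)
      then show ?case using elim by linarith
    qed
  qed
  then show ?thesis unfolding P_int q_def .
qed

section \<open>The Pearson statistic as a squared length\<close>

text \<open>The Householder reflection that exchanges the unit vector \<open>q\<close> with the \<open>N\<close>-th coordinate vector is
  symmetric and orthogonal. Its last row is \<open>q\<close>, so its first \<open>N - 1\<close> rows form an orthonormal basis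
  of the orthogonal complement of \<open>q\<close>. The third property is Parseval's identity for the
  component of \<open>z\<close> orthogonal to \<open>q\<close>.\<close>

lemma orthonormal_basis_of_complement:
  fixes q :: "nat \<Rightarrow> real"
  assumes "N \<ge> 1" and unit: "(\<Sum>j=1..N. (q j)\<^sup>2) = 1" and "q N \<noteq> 1"
  obtains h :: "nat \<Rightarrow> nat \<Rightarrow> real" where
    "\<And>k. k \<in> {1..<N} \<Longrightarrow> (\<Sum>j=1..N. h k j * q j) = 0"
    "\<And>k l. k \<in> {1..<N} \<Longrightarrow> l \<in> {1..<N} \<Longrightarrow> (\<Sum>j=1..N. h k j * h l j) = of_bool (k = l)"
    "\<And>z. (\<Sum>k\<in>{1..<N}. (\<Sum>j=1..N. h k j * z j)\<^sup>2) = (\<Sum>j=1..N. (z j)\<^sup>2) - (\<Sum>j=1..N. q j * z j)\<^sup>2"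
proof
  define a where "a = 1 - q N"
  have a: "a \<noteq> 0" using assms by (simp add: a_def)
  define h where "h k j = of_bool (j = k) - q k * (q j - of_bool (j = N)) / a" for k j
  have split: "{1..N} = insert N {1..<N}" using \<open>N \<ge> 1\<close> by auto
  have delta: "(\<Sum>j=1..N. of_bool (j = k) * z j) = z k" if "k \<in> {1..N}" for k and z :: "nat \<Rightarrow> real"
    using that by (simp add: of_bool_def if_distrib[of "\<lambda>x. x * _"] sum.delta cong: if_cong)
  have apply_h: "(\<Sum>j=1..N. h k j * z j) = z k - q k * ((\<Sum>j=1..N. q j * z j) - z N) / a"
    if "k \<in> {1..<N}" for k z
  proof -
    have "(\<Sum>j=1..N. h k j * z j) = (\<Sum>j=1..N. of_bool (j = k) * z j
        - q k / a * (q j * z j) + q k / a * (of_bool (j = N) * z j))"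
      by (intro sum.cong) (auto simp: h_def algebra_simps diff_divide_distrib)
    also have "\<dots> = z k - q k / a * (\<Sum>j=1..N. q j * z j) + q k / a * z N"
      using that delta[of k z] delta[of N z] \<open>N \<ge> 1\<close>
      unfolding sum.distrib sum_subtractf sum_distrib_left[symmetric] by simp
    finally show ?thesis by (simp add: algebra_simps diff_divide_distrib)
  qed
  show orth: "(\<Sum>j=1..N. h k j * q j) = 0" if "k \<in> {1..<N}" for k
    using apply_h[OF that, of q] unit a by (simp add: power2_eq_square a_def)
  show "(\<Sum>j=1..N. h k j * h l j) = of_bool (k = l)" if kl: "k \<in> {1..<N}" "l \<in> {1..<N}" for k l
  proof -
    have "(\<Sum>j=1..N. q j * h l j) = 0" using orth[OF kl(2)] by (simp add: mult.commute)
    moreover have "h l N = q l" "h l k = of_bool (k = l) - q l * q k / a"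
      using kl a by (auto simp: h_def a_def field_simps)
    ultimately show ?thesis
      using apply_h[OF kl(1), of "h l"] a by simp
  qed
  show "(\<Sum>k\<in>{1..<N}. (\<Sum>j=1..N. h k j * z j)\<^sup>2) = (\<Sum>j=1..N. (z j)\<^sup>2) - (\<Sum>j=1..N. q j * z j)\<^sup>2" for z
  proof -
    define T where "T = (\<Sum>j=1..N. q j * z j)"
    \<comment> \<open>By construction, the \<open>k\<close>-th coordinate of \<open>z\<close> under the reflection is \<open>z k - q k * g\<close>.\<close>
    define g where "g = (T - z N) / a"
    have ga: "g * (1 - q N) = T - z N" using a by (simp add: g_def a_def)
    have "(\<Sum>k\<in>{1..<N}. (\<Sum>j=1..N. h k j * z j)\<^sup>2)
        = (\<Sum>k\<in>{1..<N}. (z k)\<^sup>2 - 2 * g * (q k * z k) + g\<^sup>2 * (q k)\<^sup>2)"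
    proof (intro sum.cong refl)
      fix k assume k: "k \<in> {1..<N}"
      have "(\<Sum>j=1..N. h k j * z j) = z k - q k * g"
        using apply_h[OF k, of z] by (simp add: g_def T_def)
      then show "(\<Sum>j=1..N. h k j * z j)\<^sup>2 = (z k)\<^sup>2 - 2 * g * (q k * z k) + g\<^sup>2 * (q k)\<^sup>2"
        by (simp only:) (simp add: power2_eq_square algebra_simps)
    qed
    also have "\<dots> = (\<Sum>k\<in>{1..<N}. (z k)\<^sup>2) - 2 * g * (\<Sum>k\<in>{1..<N}. q k * z k) + g\<^sup>2 * (\<Sum>k\<in>{1..<N}. (q k)\<^sup>2)"
      by (simp add: sum.distrib sum_subtractf sum_distrib_left)
    also have "(\<Sum>k\<in>{1..<N}. (z k)\<^sup>2) = (\<Sum>j=1..N. (z j)\<^sup>2) - (z N)\<^sup>2" unfolding split by simp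
    also have "(\<Sum>k\<in>{1..<N}. q k * z k) = T - q N * z N" unfolding split T_def by simp
    also have "(\<Sum>k\<in>{1..<N}. (q k)\<^sup>2) = 1 - (q N)\<^sup>2" using unit unfolding split by simp
    also have "(\<Sum>j=1..N. (z j)\<^sup>2) - (z N)\<^sup>2 - 2 * g * (T - q N * z N) + g\<^sup>2 * (1 - (q N)\<^sup>2)
        = (\<Sum>j=1..N. (z j)\<^sup>2) - T\<^sup>2"
    proof -
      have zN: "z N = T - g * (1 - q N)" using ga by simp
      show ?thesis unfolding zN by (simp add: power2_eq_square algebra_simps)
    qed
    finally show ?thesis by (simp add: T_def)
  qed
qed

locale pearson_trials = prob_space M for M :: "'a measure" +
  fixes N :: nat and p :: "nat \<Rightarrow> real" and Y :: "nat \<Rightarrow> 'a \<Rightarrow> nat"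
  assumes N_ge: "N \<ge> 2"
    and p_pos: "\<And>j. j \<in> {1..N} \<Longrightarrow> p j > 0" and p_sum: "(\<Sum>j=1..N. p j) = 1"
    and indep: "indep_vars (\<lambda>_. count_space UNIV) Y UNIV"
    and prob_Y: "\<And>i j. j \<in> {1..N} \<Longrightarrow> \<P>(\<omega> in M. Y i \<omega> = j) = p j"
begin

lemma measurable_Y [measurable]: "Y i \<in> M \<rightarrow>\<^sub>M count_space UNIV"
  using indep by (auto simp: indep_vars_def)

lemma outcome_event [measurable]: "{\<omega> \<in> space M. Y i \<omega> = j} \<in> events"
  using measurable_sets[OF measurable_Y, of "{j}" i] by (simp add: vimage_def Int_def conj_commute)

lemma measurable_outcome_function:
  "(\<lambda>\<omega>. (h (Y i \<omega>) :: 'c :: topological_space)) \<in> borel_measurable M"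
  by (rule measurable_compose[OF measurable_Y]) simp

lemma AE_outcome: "AE \<omega> in M. \<forall>i. Y i \<omega> \<in> {1..N}"
proof (subst AE_all_countable, rule allI)
  fix i
  have "\<P>(\<omega> in M. Y i \<omega> \<in> {1..N}) = (\<Sum>j\<in>{1..N}. \<P>(\<omega> in M. Y i \<omega> = j))"
  proof -
    have "{\<omega> \<in> space M. Y i \<omega> \<in> {1..N}} = (\<Union>j\<in>{1..N}. {\<omega> \<in> space M. Y i \<omega> = j})" by auto
    then show ?thesis
      by (simp only:) (subst finite_measure_finite_Union, auto simp: disjoint_family_on_def)
  qed
  also have "\<dots> = 1" using p_sum prob_Y by simp
  finally have "prob {\<omega> \<in> space M. Y i \<omega> \<in> {1..N}} = 1" .
  then have "AE \<omega> in M. \<omega> \<in> {\<omega> \<in> space M. Y i \<omega> \<in> {1..N}}" by (rule AE_prob_1)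
  then show "AE \<omega> in M. Y i \<omega> \<in> {1..N}" by eventually_elim simp
qed

lemma expectation_outcome:
  fixes h :: "nat \<Rightarrow> complex"
  shows "expectation (\<lambda>\<omega>. h (Y i \<omega>)) = (\<Sum>j=1..N. p j * h j)"
proof -
  have "expectation (\<lambda>\<omega>. h (Y i \<omega>)) = expectation (\<lambda>\<omega>. \<Sum>j=1..N. indicator {\<omega>\<in>space M. Y i \<omega> = j} \<omega> *\<^sub>R h j)"
  proof (rule integral_cong_AE)
    show "AE \<omega> in M. h (Y i \<omega>) = (\<Sum>j=1..N. indicator {\<omega>\<in>space M. Y i \<omega> = j} \<omega> *\<^sub>R h j)"
      using AE_outcome AE_space
    proof eventually_elim
      case (elim \<omega>)
      then have "(\<Sum>j=1..N. indicator {\<omega>\<in>space M. Y i \<omega> = j} \<omega> *\<^sub>R h j) = (\<Sum>j=1..N. if j = Y i \<omega> then h j else 0)"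
        by (intro sum.cong) auto
      also have "\<dots> = h (Y i \<omega>)" using elim by (subst sum.delta) auto
      finally show ?case ..
    qed
  qed (auto intro!: measurable_outcome_function borel_measurable_sum borel_measurable_scaleR)
  also have "\<dots> = (\<Sum>j=1..N. expectation (\<lambda>\<omega>. indicator {\<omega>\<in>space M. Y i \<omega> = j} \<omega> *\<^sub>R h j))"
    by (subst Bochner_Integration.integral_sum) (auto simp: emeasure_eq_measure)
  also have "\<dots> = (\<Sum>j=1..N. p j * h j)"
  proof (intro sum.cong refl)
    fix j assume j: "j \<in> {1..N}"
    have "expectation (\<lambda>\<omega>. indicator {\<omega>\<in>space M. Y i \<omega> = j} \<omega> *\<^sub>R h j) = prob {\<omega>\<in>space M. Y i \<omega> = j} *\<^sub>R h j"
      by (subst integral_scaleR_left) (auto simp: emeasure_eq_measure intro!: arg_cong[where f = "measure M"])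
    then show "expectation (\<lambda>\<omega>. indicator {\<omega>\<in>space M. Y i \<omega> = j} \<omega> *\<^sub>R h j) = p j * h j"
      using prob_Y[OF j] by (simp add: scaleR_conv_of_real)
  qed
  finally show ?thesis .
qed

lemma sum_over_trials:
  fixes g :: "nat \<Rightarrow> real"
  assumes "\<And>i. Y i \<omega> \<in> {1..N}"
  shows "(\<Sum>i<n. g (Y i \<omega>)) = (\<Sum>j=1..N. real (occurrences Y j n \<omega>) * g j)"
proof -
  have "(\<Sum>j=1..N. real (occurrences Y j n \<omega>) * g j) = (\<Sum>j=1..N. \<Sum>i<n. if Y i \<omega> = j then g j else 0)"
  proof (intro sum.cong refl)
    fix j
    have "(\<Sum>i<n. if Y i \<omega> = j then g j else 0) = (\<Sum>i\<in>{i\<in>{..<n}. Y i \<omega> = j}. g j)"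
      by (rule sum.inter_filter[symmetric]) simp
    then show "real (occurrences Y j n \<omega>) * g j = (\<Sum>i<n. if Y i \<omega> = j then g j else 0)"
      by (simp add: occurrences_def)
  qed
  also have "\<dots> = (\<Sum>i<n. \<Sum>j=1..N. if Y i \<omega> = j then g j else 0)"
    by (rule sum.swap)
  also have "\<dots> = (\<Sum>i<n. g (Y i \<omega>))" using assms by (intro sum.cong refl) (subst sum.delta', auto)
  finally show ?thesis ..
qed

lemma pearson_nonneg: "pearson N p Y n \<omega> \<ge> 0"
  unfolding pearson_def
proof (intro sum_nonneg)
  fix j assume "j \<in> {1..N}"
  then have "p j > 0" by (rule p_pos)
  then show "0 \<le> (real (occurrences Y j n \<omega>) - real n * p j)\<^sup>2 / (real n * p j)" by simp
qed

lemma measurable_occurrences [measurable]: "(\<lambda>\<omega>. real (occurrences Y j n \<omega>)) \<in> borel_measurable M"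
proof -
  have "real (occurrences Y j n \<omega>) = (\<Sum>i<n. if Y i \<omega> = j then 1 else 0)" for \<omega>
  proof -
    have "(\<Sum>i<n. if Y i \<omega> = j then 1 else 0 :: real) = (\<Sum>i\<in>{i\<in>{..<n}. Y i \<omega> = j}. 1)"
      by (rule sum.inter_filter[symmetric]) simp
    then show ?thesis by (simp add: occurrences_def)
  qed
  then show ?thesis
    using measurable_outcome_function[of "\<lambda>y. if y = j then 1 else 0 :: real"]
    by (simp only:) (intro borel_measurable_sum)
qed

lemma measurable_pearson [measurable]: "pearson N p Y n \<in> borel_measurable M"
  unfolding pearson_def[abs_def] by measurable

text \<open>The vector with entries \<open>(\<nu>\<^sub>j(n) - n p\<^sub>j) / sqrt (n p\<^sub>j)\<close> is orthogonal to \<open>q = (sqrt p\<^sub>j)\<^sub>j\<close>, because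
  the counts add up to \<open>n\<close>. So its squared length \<open>X(n)\<close> is not changed by passing to the \<open>N - 1\<close> coordinates
  with respect to an orthonormal basis of the complement of \<open>q\<close>. Each of these coordinates is a
  normalised sum, over the trials, of a function \<open>w k\<close> of the outcome; orthogonality to \<open>q\<close> makes
  \<open>w k\<close> centred, and orthonormality makes these functions uncorrelated with unit variance.\<close>

lemma pearson_as_squared_length:
  "\<exists>w :: nat \<Rightarrow> nat \<Rightarrow> real.
     (\<forall>k\<in>{1..<N}. (\<Sum>j=1..N. p j * w k j) = 0) \<and>
     (\<forall>k\<in>{1..<N}. \<forall>l\<in>{1..<N}. (\<Sum>j=1..N. p j * (w k j * w l j)) = of_bool (k = l)) \<and>
     (\<forall>n \<omega>. n > 0 \<longrightarrow> (\<forall>i. Y i \<omega> \<in> {1..N}) \<longrightarrow>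
       pearson N p Y n \<omega> = (\<Sum>k\<in>{1..<N}. ((\<Sum>i<n. w k (Y i \<omega>)) / sqrt n)\<^sup>2))"
proof -
  have sq: "(sqrt (p j))\<^sup>2 = p j" "sqrt (p j) \<noteq> 0" if "j \<in> {1..N}" for j
    using p_pos[OF that] by auto
  have "p 1 + p N \<le> (\<Sum>j=1..N. p j)"
  proof -
    have "(\<Sum>j\<in>{1,N}. p j) \<le> (\<Sum>j=1..N. p j)"
      using p_pos N_ge by (intro sum_mono2) (auto intro: less_imp_le)
    then show ?thesis using N_ge by auto
  qed
  then have "p N < 1" using p_pos[of 1] p_sum N_ge by auto
  then have "sqrt (p N) \<noteq> 1" by auto
  moreover have "(\<Sum>j=1..N. (sqrt (p j))\<^sup>2) = 1" using sq p_sum by simp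
  ultimately obtain h where h:
    "\<And>k. k \<in> {1..<N} \<Longrightarrow> (\<Sum>j=1..N. h k j * sqrt (p j)) = 0"
    "\<And>k l. k \<in> {1..<N} \<Longrightarrow> l \<in> {1..<N} \<Longrightarrow> (\<Sum>j=1..N. h k j * h l j) = of_bool (k = l)"
    "\<And>z. (\<Sum>k\<in>{1..<N}. (\<Sum>j=1..N. h k j * z j)\<^sup>2) = (\<Sum>j=1..N. (z j)\<^sup>2) - (\<Sum>j=1..N. sqrt (p j) * z j)\<^sup>2"
    using orthonormal_basis_of_complement[of N "\<lambda>j. sqrt (p j)"] N_ge by auto
  define w where "w k j = h k j / sqrt (p j)" for k j
  have pw: "p j * w k j = h k j * sqrt (p j)" "p j * (w k j * w l j) = h k j * h l j" if "j \<in> {1..N}" for j k l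
    using p_pos[OF that] by (simp_all add: w_def field_simps)
  have w1: "(\<Sum>j=1..N. p j * w k j) = 0" if "k \<in> {1..<N}" for k
    proof -
      have "(\<Sum>j=1..N. p j * w k j) = (\<Sum>j=1..N. h k j * sqrt (p j))"
        by (intro sum.cong refl pw)
      then show ?thesis using h(1)[OF that] by (rule trans)
    qed
  have w2: "(\<Sum>j=1..N. p j * (w k j * w l j)) = of_bool (k = l)" if "k \<in> {1..<N}" "l \<in> {1..<N}" for k l
    proof -
      have "(\<Sum>j=1..N. p j * (w k j * w l j)) = (\<Sum>j=1..N. h k j * h l j)"
        by (intro sum.cong refl pw)
      then show ?thesis using h(2)[OF that] by (rule trans)
    qed
  have w3: "pearson N p Y n \<omega> = (\<Sum>k\<in>{1..<N}. ((\<Sum>i<n. w k (Y i \<omega>)) / sqrt n)\<^sup>2)"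
      if "n > 0" and Y: "\<And>i. Y i \<omega> \<in> {1..N}" for n \<omega>
    proof -
      define \<nu> where "\<nu> j = real (occurrences Y j n \<omega>)" for j
      define z where "z j = (\<nu> j - n * p j) / (sqrt n * sqrt (p j))" for j
      have "(\<Sum>j=1..N. \<nu> j) = n"
        using sum_over_trials[where g = "\<lambda>_. 1" and n = n, OF Y] by (simp add: \<nu>_def)
      then have "(\<Sum>j=1..N. \<nu> j - n * p j) = 0" using p_sum by (simp add: sum_subtractf flip: sum_distrib_left)
      moreover have "(\<Sum>j=1..N. sqrt (p j) * z j) = (\<Sum>j=1..N. (\<nu> j - n * p j) / sqrt n)"
        by (intro sum.cong refl) (use sq in \<open>simp add: z_def\<close>)
      ultimately have orth: "(\<Sum>j=1..N. sqrt (p j) * z j) = 0"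
        by (simp only: sum_divide_distrib[symmetric])
      have "(\<Sum>i<n. w k (Y i \<omega>)) / sqrt n = (\<Sum>j=1..N. h k j * z j)" if k: "k \<in> {1..<N}" for k
      proof -
        have "(\<Sum>j=1..N. h k j * z j) = (\<Sum>j=1..N. (\<nu> j * w k j - n * (h k j * sqrt (p j))) / sqrt n)"
        proof (intro sum.cong refl)
          fix j assume "j \<in> {1..N}"
          then obtain r where "r > 0" "p j = r * r" "sqrt (p j) = r"
            using p_pos[of j] by (metis real_sqrt_gt_zero real_sqrt_mult_self abs_of_pos)
          then show "h k j * z j = (\<nu> j * w k j - n * (h k j * sqrt (p j))) / sqrt n"
            unfolding z_def w_def using \<open>n > 0\<close> by (simp add: field_simps)
        qed
        also have "\<dots> = ((\<Sum>j=1..N. \<nu> j * w k j) - n * (\<Sum>j=1..N. h k j * sqrt (p j))) / sqrt n"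
          by (simp only: sum_subtractf sum_distrib_left sum_divide_distrib[symmetric])
        also have "\<dots> = (\<Sum>i<n. w k (Y i \<omega>)) / sqrt n"
          using h(1)[OF k] sum_over_trials[where g = "w k" and n = n, OF Y] by (simp add: \<nu>_def)
        finally show ?thesis ..
      qed
      then have "(\<Sum>k\<in>{1..<N}. ((\<Sum>i<n. w k (Y i \<omega>)) / sqrt n)\<^sup>2) = (\<Sum>j=1..N. (z j)\<^sup>2)"
        using h(3)[of z] orth by simp
      also have "\<dots> = pearson N p Y n \<omega>"
        unfolding pearson_def
      proof (intro sum.cong refl)
        fix j assume "j \<in> {1..N}"
        then show "(z j)\<^sup>2 = (real (occurrences Y j n \<omega>) - n * p j)\<^sup>2 / (n * p j)"
          using sq[of j] by (simp add: z_def \<nu>_def power_divide power_mult_distrib)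
      qed
      finally show ?thesis ..
    qed
  show ?thesis by (intro exI[of _ w] conjI ballI allI impI w1 w2 w3) auto
qed

end

section \<open>Gaussian integrals and powers of characteristic functions\<close>

lemma exp_minus_linear_error:
  fixes x :: real assumes "x \<ge> 0"
  shows "\<bar>exp (- x) - (1 - x)\<bar> \<le> x\<^sup>2"
proof -
  have "exp (- x) = 1 / exp x" by (simp add: exp_minus inverse_eq_divide)
  also have "\<dots> \<le> 1 / (1 + x)"
    using assms exp_ge_add_one_self[of x] by (intro divide_left_mono) auto
  also have "\<dots> \<le> 1 - x + x\<^sup>2"
    using assms by (simp add: field_simps power2_eq_square)
  finally show ?thesis using exp_ge_add_one_self[of "- x"] by auto
qed

text \<open>The central limit theorem in terms of characteristic functions, in the triangular form that is needed
  when the frequency \<open>\<theta> n\<close> and the number of factors \<open>q n\<close> vary together. With \<open>e\<close> the squared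
  length of the frequency, one factor is \<open>1 - e / 2 + O(e powr (3 / 2))\<close>, so its \<open>q\<close>-th power differs
  from \<open>exp (- q e / 2)\<close> by at most \<open>q e\<close> times a null sequence.\<close>

lemma char_fun_power_tendsto_gaussian:
  fixes w :: "nat \<Rightarrow> 'j \<Rightarrow> real" and p :: "'j \<Rightarrow> real" and q :: "nat \<Rightarrow> nat"
  assumes fin: "finite J" "finite K"
    and p: "\<And>j. j \<in> J \<Longrightarrow> p j \<ge> 0" "(\<Sum>j\<in>J. p j) = 1"
    and centred: "\<And>k. k \<in> K \<Longrightarrow> (\<Sum>j\<in>J. p j * w k j) = 0"
    and isotropic: "\<And>k l. k \<in> K \<Longrightarrow> l \<in> K \<Longrightarrow> (\<Sum>j\<in>J. p j * (w k j * w l j)) = of_bool (k = l)"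
    and small: "(\<lambda>n. \<Sum>k\<in>K. (\<theta> n k)\<^sup>2) \<longlonglongrightarrow> 0"
    and lim: "(\<lambda>n. real (q n) * (\<Sum>k\<in>K. (\<theta> n k)\<^sup>2)) \<longlonglongrightarrow> L"
  shows "(\<lambda>n. (\<Sum>j\<in>J. p j * iexp (\<Sum>k\<in>K. \<theta> n k * w k j)) ^ q n) \<longlonglongrightarrow> of_real (exp (- L / 2))"
proof -
  define e where "e n = (\<Sum>k\<in>K. (\<theta> n k)\<^sup>2)" for n
  define x where "x n j = (\<Sum>k\<in>K. \<theta> n k * w k j)" for n j
  define r where "r j = sqrt (\<Sum>k\<in>K. (w k j)\<^sup>2)" for j
  define W where "W = (\<Sum>j\<in>J. p j * r j ^ 3)"
  define \<psi> where "\<psi> n = (\<Sum>j\<in>J. p j * iexp (x n j))" for n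
  have e_nonneg: "e n \<ge> 0" for n unfolding e_def by (intro sum_nonneg) auto
  have r_nonneg: "r j \<ge> 0" for j unfolding r_def by (intro real_sqrt_ge_zero sum_nonneg) auto
  have x_le: "\<bar>x n j\<bar> \<le> sqrt (e n) * r j" for n j
  proof -
    have "(x n j)\<^sup>2 \<le> e n * (\<Sum>k\<in>K. (w k j)\<^sup>2)"
      unfolding x_def e_def by (rule Cauchy_Schwarz_ineq_sum)
    then have "sqrt ((x n j)\<^sup>2) \<le> sqrt (e n * (\<Sum>k\<in>K. (w k j)\<^sup>2))" by (rule real_sqrt_le_mono)
    then show ?thesis by (simp add: r_def real_sqrt_mult)
  qed
  have mean: "(\<Sum>j\<in>J. p j * x n j) = 0" for n
  proof -
    have "(\<Sum>j\<in>J. p j * x n j) = (\<Sum>k\<in>K. \<theta> n k * (\<Sum>j\<in>J. p j * w k j))"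
      unfolding x_def sum_distrib_left by (subst sum.swap) (simp add: mult_ac)
    then show ?thesis using centred by simp
  qed
  have var: "(\<Sum>j\<in>J. p j * (x n j)\<^sup>2) = e n" for n
  proof -
    have "(\<Sum>j\<in>J. p j * (x n j)\<^sup>2) = (\<Sum>j\<in>J. \<Sum>k\<in>K. \<Sum>l\<in>K. \<theta> n k * \<theta> n l * (p j * (w k j * w l j)))"
      unfolding x_def power2_eq_square sum_product sum_distrib_left
      by (intro sum.cong refl) (simp add: sum_distrib_left mult_ac)
    also have "\<dots> = (\<Sum>k\<in>K. \<Sum>j\<in>J. \<Sum>l\<in>K. \<theta> n k * \<theta> n l * (p j * (w k j * w l j)))"
      by (rule sum.swap)
    also have "\<dots> = (\<Sum>k\<in>K. \<Sum>l\<in>K. \<theta> n k * \<theta> n l * (\<Sum>j\<in>J. p j * (w k j * w l j)))"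
      unfolding sum_distrib_left by (intro sum.cong refl sum.swap)
    also have "\<dots> = (\<Sum>k\<in>K. \<Sum>l\<in>K. if k = l then \<theta> n k * \<theta> n l else 0)"
      using isotropic by (intro sum.cong refl) auto
    also have "\<dots> = e n" unfolding e_def power2_eq_square
      using fin by (intro sum.cong refl) (simp add: sum.delta)
    finally show ?thesis .
  qed
  have taylor: "cmod (\<psi> n - (1 - e n / 2)) \<le> W * (sqrt (e n)) ^ 3" for n
  proof -
    have "(\<Sum>j\<in>J. p j * (\<Sum>i\<le>2::nat. (\<i> * x n j) ^ i / fact i))
        = of_real (\<Sum>j\<in>J. p j) + \<i> * of_real (\<Sum>j\<in>J. p j * x n j) - of_real (\<Sum>j\<in>J. p j * (x n j)\<^sup>2) / 2"
      by (simp add: numeral_2_eq_2 power_mult_distrib sum.distrib sum_distrib_left sum_subtractf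
          sum_divide_distrib algebra_simps sum_negf)
    also have "\<dots> = 1 - e n / 2" unfolding p mean var by simp
    finally have "\<psi> n - (1 - e n / 2) = (\<Sum>j\<in>J. p j * (iexp (x n j) - (\<Sum>i\<le>2::nat. (\<i> * x n j) ^ i / fact i)))"
      unfolding \<psi>_def right_diff_distrib sum_subtractf by simp
    also have "cmod \<dots> \<le> (\<Sum>j\<in>J. p j * (sqrt (e n) * r j) ^ 3)"
    proof (rule sum_norm_le)
      fix j assume j: "j \<in> J"
      have "cmod (iexp (x n j) - (\<Sum>i\<le>2::nat. (\<i> * x n j) ^ i / fact i)) \<le> \<bar>x n j\<bar> ^ 3 / 6"
        using iexp_approx1[of "x n j" 2] by (simp add: eval_nat_numeral)
      also have "\<dots> \<le> \<bar>x n j\<bar> ^ 3" by simp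
      also have "\<dots> \<le> (sqrt (e n) * r j) ^ 3" by (intro power_mono x_le) auto
      finally show "cmod (p j * (iexp (x n j) - (\<Sum>i\<le>2::nat. (\<i> * x n j) ^ i / fact i)))
          \<le> p j * (sqrt (e n) * r j) ^ 3"
        using p(1)[OF j] by (simp add: norm_mult mult_left_mono del: sum.atMost_Suc)
    qed
    also have "\<dots> = W * sqrt (e n) ^ 3"
      unfolding W_def sum_distrib_right by (simp add: power_mult_distrib mult_ac)
    finally show ?thesis .
  qed
  have "cmod (\<psi> n) \<le> 1" for n
  proof -
    have "cmod (\<psi> n) \<le> (\<Sum>j\<in>J. p j)"
      unfolding \<psi>_def by (rule sum_norm_le) (use p in \<open>auto simp: norm_mult\<close>)
    then show ?thesis using p by simp
  qed
  then have diff: "cmod (\<psi> n ^ q n - of_real (exp (- e n / 2)) ^ q n)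
      \<le> real (q n) * e n * (W * sqrt (e n) + e n)" for n
  proof -
    have "(1 - e n / 2) - of_real (exp (- e n / 2)) = complex_of_real ((1 - e n / 2) - exp (- (e n / 2)))" by simp
    then have "cmod ((1 - e n / 2) - of_real (exp (- e n / 2))) = \<bar>exp (- (e n / 2)) - (1 - e n / 2)\<bar>"
      by (simp only: norm_of_real abs_minus_commute)
    also have "\<dots> \<le> (e n / 2)\<^sup>2" using e_nonneg[of n] by (intro exp_minus_linear_error) simp
    also have "(e n / 2)\<^sup>2 \<le> (e n)\<^sup>2" by (simp add: power_divide)
    finally have "cmod ((1 - e n / 2) - of_real (exp (- e n / 2))) \<le> (e n)\<^sup>2" .
    moreover have "cmod (\<psi> n - of_real (exp (- e n / 2)))
        \<le> cmod (\<psi> n - (1 - e n / 2)) + cmod ((1 - e n / 2) - of_real (exp (- e n / 2)))"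
      using norm_triangle_ineq[of "\<psi> n - (1 - e n / 2)" "(1 - e n / 2) - of_real (exp (- e n / 2))"] by simp
    moreover have "W * sqrt (e n) ^ 3 = W * (e n * sqrt (e n))" using e_nonneg[of n] by (simp add: eval_nat_numeral)
    ultimately have le: "cmod (\<psi> n - of_real (exp (- e n / 2))) \<le> W * (e n * sqrt (e n)) + (e n)\<^sup>2"
      using taylor[of n] by linarith
    have "cmod (\<psi> n ^ q n - of_real (exp (- e n / 2)) ^ q n) \<le> q n * cmod (\<psi> n - of_real (exp (- e n / 2)))"
      using \<open>cmod (\<psi> n) \<le> 1\<close> e_nonneg[of n] by (intro norm_power_diff) auto
    also have "\<dots> \<le> q n * (W * (e n * sqrt (e n)) + (e n)\<^sup>2)"
      using le by (intro mult_left_mono) auto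
    finally show ?thesis by (simp add: algebra_simps power2_eq_square)
  qed
  have e0: "e \<longlonglongrightarrow> 0" using small by (simp add: e_def[abs_def])
  have "(\<lambda>n. real (q n) * e n * (W * sqrt (e n) + e n)) \<longlonglongrightarrow> L * (W * sqrt 0 + 0)"
    using lim unfolding e_def[symmetric] by (intro tendsto_intros e0)
  then have "(\<lambda>n. real (q n) * e n * (W * sqrt (e n) + e n)) \<longlonglongrightarrow> 0" by simp
  with always_eventually[OF allI[OF diff]]
  have "(\<lambda>n. \<psi> n ^ q n - of_real (exp (- e n / 2)) ^ q n) \<longlonglongrightarrow> 0"
    by (rule Lim_null_comparison)
  moreover have "(\<lambda>n. of_real (exp (- e n / 2)) ^ q n) \<longlonglongrightarrow> complex_of_real (exp (- L / 2))"
  proof -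
    have "(\<lambda>n. exp (- (real (q n) * e n) / 2)) \<longlonglongrightarrow> exp (- L / 2)"
      using lim unfolding e_def[symmetric] by (intro tendsto_intros) auto
    then have "(\<lambda>n. complex_of_real (exp (- (real (q n) * e n) / 2))) \<longlonglongrightarrow> of_real (exp (- L / 2))"
      by (rule tendsto_of_real)
    moreover have "exp (- e n / 2) ^ q n = exp (- (real (q n) * e n) / 2)" for n
      by (simp flip: exp_of_nat_mult)
    ultimately show ?thesis by (simp only: of_real_power[symmetric])
  qed
  ultimately have "(\<lambda>n. \<psi> n ^ q n) \<longlonglongrightarrow> complex_of_real (exp (- L / 2))"
    using tendsto_add by fastforce
  then show ?thesis unfolding \<psi>_def x_def .
qed

definition gauss2 :: "(real \<times> real) measure" where
  "gauss2 = std_normal_distribution \<Otimes>\<^sub>M std_normal_distribution"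

lemma prob_space_gauss2: "prob_space gauss2"
  unfolding gauss2_def by (intro prob_space_pair prob_space_normal_density) auto

lemma sets_gauss2 [measurable_cong]: "sets gauss2 = sets (borel \<Otimes>\<^sub>M borel)"
  unfolding gauss2_def by (intro sets_pair_measure_cong) auto

lemma char_gauss2:
  "(\<integral>z. iexp (a * fst z + b * snd z) \<partial>gauss2) = of_real (exp (- (a\<^sup>2 + b\<^sup>2) / 2))"
proof -
  interpret G: prob_space gauss2 by (rule prob_space_gauss2)
  interpret g: real_distribution std_normal_distribution by (rule real_dist_normal_dist)
  interpret P: pair_sigma_finite std_normal_distribution std_normal_distribution ..
  have char: "(\<integral>x. iexp (t * x) \<partial>std_normal_distribution) = of_real (exp (- t\<^sup>2 / 2))" for t
    using char_std_normal_distribution by (simp add: char_def fun_eq_iff)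
  have int: "integrable gauss2 (\<lambda>(x, y). iexp (a * x) * iexp (b * y))"
    by (rule G.integrable_const_bound[of _ 1]) (auto simp: norm_mult)
  have "(\<integral>z. iexp (a * fst z + b * snd z) \<partial>gauss2) = (\<integral>(x, y). iexp (a * x) * iexp (b * y) \<partial>gauss2)"
    by (intro Bochner_Integration.integral_cong) (auto simp: exp_add algebra_simps)
  also have "\<dots> = (\<integral>x. \<integral>y. iexp (a * x) * iexp (b * y) \<partial>std_normal_distribution \<partial>std_normal_distribution)"
    using int unfolding gauss2_def by (subst P.integral_fst) auto
  also have "\<dots> = of_real (exp (- a\<^sup>2 / 2)) * of_real (exp (- b\<^sup>2 / 2))"
    by (simp only: integral_mult_right_zero integral_mult_left_zero char)
  also have "\<dots> = of_real (exp (- (a\<^sup>2 + b\<^sup>2) / 2))"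
    by (simp flip: exp_add of_real_mult add: field_simps)
  finally show ?thesis .
qed

lemma gaussian_integral_quadratic:
  assumes "A > -1"
  shows "(\<integral>x. exp (- (A * x\<^sup>2 + 2 * B * x) / 2) \<partial>std_normal_distribution)
       = exp (B\<^sup>2 / (2 * (1 + A))) / sqrt (1 + A)"
proof -
  define a where "a = 1 + A"
  have a: "a > 0" "A = a - 1" using assms by (auto simp: a_def)
  have eq: "std_normal_density x * exp (- (A * x\<^sup>2 + 2 * B * x) / 2)
      = (exp (B\<^sup>2 / (2 * a)) / sqrt a) * normal_density (- B / a) (1 / sqrt a) x" for x
  proof -
    have "- x\<^sup>2 / 2 + - (A * x\<^sup>2 + 2 * B * x) / 2
        = B\<^sup>2 / (2 * a) + - (x - - B / a)\<^sup>2 / (2 * (1 / sqrt a)\<^sup>2)"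
      unfolding a(2) using a(1) by (simp add: field_simps power2_eq_square)
    then have e: "exp (- x\<^sup>2 / 2) * exp (- (A * x\<^sup>2 + 2 * B * x) / 2)
        = exp (B\<^sup>2 / (2 * a)) * exp (- (x - - B / a)\<^sup>2 / (2 * (1 / sqrt a)\<^sup>2))"
      by (simp only: exp_add[symmetric])
    have std: "std_normal_density x = 1 / sqrt (2 * pi) * exp (- x\<^sup>2 / 2)"
      by (simp add: std_normal_density_def)
    have "sqrt (2 * pi * (1 / sqrt a)\<^sup>2) = sqrt (2 * pi) / sqrt a"
      using a(1) by (simp add: power_divide real_sqrt_divide)
    then have nd: "normal_density (- B / a) (1 / sqrt a) x
        = sqrt a / sqrt (2 * pi) * exp (- (x - - B / a)\<^sup>2 / (2 * (1 / sqrt a)\<^sup>2))"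
      unfolding normal_density_def by simp
    show ?thesis
      unfolding std nd by (subst mult.assoc, subst e) (use a(1) in simp)
  qed
  have "(\<integral>x. exp (- (A * x\<^sup>2 + 2 * B * x) / 2) \<partial>std_normal_distribution)
      = (\<integral>x. std_normal_density x *\<^sub>R exp (- (A * x\<^sup>2 + 2 * B * x) / 2) \<partial>lborel)"
    by (rule integral_density) auto
  also have "\<dots> = (\<integral>x. (exp (B\<^sup>2 / (2 * a)) / sqrt a) * normal_density (- B / a) (1 / sqrt a) x \<partial>lborel)"
    by (simp only: real_scaleR_def eq)
  also have "\<dots> = exp (B\<^sup>2 / (2 * a)) / sqrt a" using a by simp
  finally show ?thesis by (simp add: a_def)
qed

text \<open>Integrating out one variable by completing the square leaves a Gaussian integral in the other one,
  with the Schur complement \<open>C - B\<^sup>2 / (1 + A)\<close> as its coefficient.\<close>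

lemma gauss2_integral_quadratic:
  assumes "A \<ge> 0" "C \<ge> 0" "B\<^sup>2 \<le> A * C"
  shows "(\<integral>z. exp (- (A * (fst z)\<^sup>2 + 2 * B * (fst z * snd z) + C * (snd z)\<^sup>2) / 2) \<partial>gauss2)
       = ((1 + A) * (1 + C) - B\<^sup>2) powr (- 1 / 2)"
proof -
  interpret G: prob_space gauss2 by (rule prob_space_gauss2)
  interpret g: real_distribution std_normal_distribution by (rule real_dist_normal_dist)
  interpret P: pair_sigma_finite std_normal_distribution std_normal_distribution ..
  have nonneg: "A * x\<^sup>2 + 2 * B * (x * y) + C * y\<^sup>2 \<ge> 0" for x y
  proof (cases "A = 0")
    case True then show ?thesis using assms by simp
  next
    case False
    then have "A > 0" using assms by simp
    have "A * (A * x\<^sup>2 + 2 * B * (x * y) + C * y\<^sup>2) = (A * x + B * y)\<^sup>2 + (A * C - B\<^sup>2) * y\<^sup>2"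
      by (simp add: power2_eq_square algebra_simps)
    also have "\<dots> \<ge> 0" using assms by simp
    finally show ?thesis using \<open>A > 0\<close> zero_le_mult_iff by (metis not_less)
  qed
  define D where "D = C - B\<^sup>2 / (1 + A)"
  have D: "1 + D = ((1 + A) * (1 + C) - B\<^sup>2) / (1 + A)" using assms by (simp add: D_def field_simps)
  have pos: "(1 + A) * (1 + C) - B\<^sup>2 \<ge> 1" using assms by (simp add: algebra_simps)
  have "1 + D > 0" unfolding D using assms pos by (intro divide_pos_pos) auto
  have "exp (- (A * x\<^sup>2 + 2 * B * (x * y) + C * y\<^sup>2) / 2) \<le> 1" for x y
    using nonneg[of x y] by simp
  then have int: "integrable gauss2 (\<lambda>(y, x). exp (- (A * x\<^sup>2 + 2 * B * (x * y) + C * y\<^sup>2) / 2))"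
    by (intro G.integrable_const_bound[of _ 1] AE_I2) (simp_all add: case_prod_beta del: exp_le_one_iff)
  have swap: "(\<integral>z. exp (- (A * (fst z)\<^sup>2 + 2 * B * (fst z * snd z) + C * (snd z)\<^sup>2) / 2) \<partial>gauss2)
      = (\<integral>(y, x). exp (- (A * x\<^sup>2 + 2 * B * (x * y) + C * y\<^sup>2) / 2) \<partial>gauss2)"
    unfolding gauss2_def by (subst P.integral_product_swap[symmetric]) (auto simp: case_prod_beta)
  also have "\<dots> = (\<integral>y. \<integral>x. exp (- (A * x\<^sup>2 + 2 * B * (x * y) + C * y\<^sup>2) / 2)
        \<partial>std_normal_distribution \<partial>std_normal_distribution)"
    using int unfolding gauss2_def by (subst P.integral_fst) auto
  also have "\<dots> = (\<integral>y. (1 / sqrt (1 + A)) * exp (- (D * y\<^sup>2 + 2 * 0 * y) / 2) \<partial>std_normal_distribution)"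
  proof (intro Bochner_Integration.integral_cong refl)
    fix y
    have "(\<integral>x. exp (- (A * x\<^sup>2 + 2 * B * (x * y) + C * y\<^sup>2) / 2) \<partial>std_normal_distribution)
        = (\<integral>x. exp (- C * y\<^sup>2 / 2) * exp (- (A * x\<^sup>2 + 2 * (B * y) * x) / 2) \<partial>std_normal_distribution)"
      by (intro Bochner_Integration.integral_cong refl)
        (simp flip: exp_add add: field_simps)
    also have "\<dots> = exp (- C * y\<^sup>2 / 2) * (exp ((B * y)\<^sup>2 / (2 * (1 + A))) / sqrt (1 + A))"
      using assms by (simp only: integral_mult_right_zero) (subst gaussian_integral_quadratic, auto)
    also have "\<dots> = (1 / sqrt (1 + A)) * exp (- C * y\<^sup>2 / 2 + (B * y)\<^sup>2 / (2 * (1 + A)))"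
      unfolding exp_add by simp
    also have "- C * y\<^sup>2 / 2 + (B * y)\<^sup>2 / (2 * (1 + A)) = - (D * y\<^sup>2 + 2 * 0 * y) / 2"
      using assms by (simp add: D_def field_simps power_mult_distrib)
    finally show "(\<integral>x. exp (- (A * x\<^sup>2 + 2 * B * (x * y) + C * y\<^sup>2) / 2) \<partial>std_normal_distribution)
        = (1 / sqrt (1 + A)) * exp (- (D * y\<^sup>2 + 2 * 0 * y) / 2)" .
  qed
  also have "\<dots> = (1 / sqrt (1 + A)) * (exp (0\<^sup>2 / (2 * (1 + D))) / sqrt (1 + D))"
    using \<open>1 + D > 0\<close> by (simp only: integral_mult_right_zero) (subst gaussian_integral_quadratic, auto)
  also have "\<dots> = 1 / sqrt ((1 + A) * (1 + D))" by (simp add: real_sqrt_mult)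
  also have "(1 + A) * (1 + D) = (1 + A) * (1 + C) - B\<^sup>2" using assms by (simp add: D)
  also have "1 / sqrt ((1 + A) * (1 + C) - B\<^sup>2) = ((1 + A) * (1 + C) - B\<^sup>2) powr (- 1 / 2)"
    using pos by (simp add: powr_minus powr_half_sqrt inverse_eq_divide flip: powr_half_sqrt)
  finally show ?thesis .
qed

section \<open>The limiting Laplace transform\<close>

abbreviation gauss2_power :: "nat set \<Rightarrow> (nat \<Rightarrow> real \<times> real) measure" where
  "gauss2_power K \<equiv> Pi\<^sub>M K (\<lambda>_. gauss2)"

context pearson_trials begin

text \<open>The linearisation of the squared lengths: \<open>exp (- a\<^sup>2 / 2)\<close> is the expectation of \<open>iexp (a \<xi>)\<close> for
  standard normal \<open>\<xi>\<close>, so with one independent normal variable for each coordinate and each sample the exponent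
  becomes linear in the sums over the trials. After exchanging the two expectations, independence
  of the trials factorises the inner one. The first \<open>m\<close> trials enter both sums, the remaining
  \<open>n - m\<close> only the second.\<close>

lemma joint_laplace_as_gaussian_mixture:
  fixes w :: "nat \<Rightarrow> nat \<Rightarrow> real" and s t :: real and m n :: nat
  defines "K \<equiv> {1..<N}"
  defines "\<psi> \<equiv> \<lambda>\<theta>. \<Sum>j=1..N. p j * iexp (\<Sum>k\<in>K. \<theta> k * w k j)"
  assumes w: "\<And>n \<omega>. n > 0 \<Longrightarrow> (\<And>i. Y i \<omega> \<in> {1..N}) \<Longrightarrow>
       pearson N p Y n \<omega> = (\<Sum>k\<in>K. ((\<Sum>i<n. w k (Y i \<omega>)) / sqrt n)\<^sup>2)"
    and mn: "0 < m" "m \<le> n" and st: "s \<ge> 0" "t \<ge> 0"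
  shows "complex_of_real (expectation (\<lambda>\<omega>. exp (- s * pearson N p Y m \<omega> - t * pearson N p Y n \<omega>)))
      = (\<integral>x. \<psi> (\<lambda>k. sqrt (2 * s) / sqrt m * fst (x k) + sqrt (2 * t) / sqrt n * snd (x k)) ^ m
            * \<psi> (\<lambda>k. sqrt (2 * t) / sqrt n * snd (x k)) ^ (n - m) \<partial>gauss2_power K)"
proof -
  interpret G: prob_space gauss2 by (rule prob_space_gauss2)
  interpret PG: product_prob_space "\<lambda>_. gauss2" K by standard
  interpret \<Pi>: prob_space "gauss2_power K" by (intro prob_space_PiM prob_space_gauss2)
  interpret Q: pair_prob_space M "gauss2_power K" ..
  have finK: "finite K" by (simp add: K_def)
  define a where "a x k = sqrt (2 * s) / sqrt m * fst (x k)" for x :: "nat \<Rightarrow> real \<times> real" and k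
  define b where "b x k = sqrt (2 * t) / sqrt n * snd (x k)" for x :: "nat \<Rightarrow> real \<times> real" and k
  define S where "S n k \<omega> = (\<Sum>i<n. w k (Y i \<omega>))" for n k \<omega>
  have S_meas [measurable]: "S n k \<in> borel_measurable M" for n k
    unfolding S_def[abs_def] by (intro borel_measurable_sum measurable_outcome_function)
  define f where "f \<omega> x = (\<Prod>k\<in>K. iexp (a x k * S m k \<omega> + b x k * S n k \<omega>))" for \<omega> x
  have norm_f: "cmod (f \<omega> x) = 1" for \<omega> x by (simp add: f_def prod_norm[symmetric])
  have f_meas: "(\<lambda>(\<omega>, x). f \<omega> x) \<in> borel_measurable (M \<Otimes>\<^sub>M gauss2_power K)"
    unfolding f_def a_def b_def case_prod_beta by measurable
  have int_f: "integrable (M \<Otimes>\<^sub>M gauss2_power K) (\<lambda>(\<omega>, x). f \<omega> x)"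
    using f_meas by (intro Q.integrable_const_bound[of _ 1] AE_I2) (auto simp: norm_f)
  have inner_x: "complex_of_real (exp (- s * pearson N p Y m \<omega> - t * pearson N p Y n \<omega>))
      = (\<integral>x. f \<omega> x \<partial>gauss2_power K)"
    if Y: "\<And>i. Y i \<omega> \<in> {1..N}" for \<omega>
  proof -
    define \<alpha> where "\<alpha> k = sqrt (2 * s) / sqrt m * S m k \<omega>" for k
    define \<beta> where "\<beta> k = sqrt (2 * t) / sqrt n * S n k \<omega>" for k
    have "(\<integral>x. f \<omega> x \<partial>gauss2_power K) = (\<integral>x. (\<Prod>k\<in>K. iexp (\<alpha> k * fst (x k) + \<beta> k * snd (x k))) \<partial>gauss2_power K)"
      unfolding f_def a_def b_def \<alpha>_def \<beta>_def by (simp add: mult_ac)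
    also have "\<dots> = (\<Prod>k\<in>K. \<integral>z. iexp (\<alpha> k * fst z + \<beta> k * snd z) \<partial>gauss2)"
      by (rule PG.product_integral_prod[OF finK])
        (intro G.integrable_const_bound[of _ 1] AE_I2, auto)
    also have "\<dots> = of_real (\<Prod>k\<in>K. exp (- ((\<alpha> k)\<^sup>2 + (\<beta> k)\<^sup>2) / 2))"
      by (simp only: char_gauss2 of_real_prod)
    also have "(\<Prod>k\<in>K. exp (- ((\<alpha> k)\<^sup>2 + (\<beta> k)\<^sup>2) / 2)) = exp (\<Sum>k\<in>K. - ((\<alpha> k)\<^sup>2 + (\<beta> k)\<^sup>2) / 2)"
      using finK by (rule exp_sum[symmetric])
    also have "(\<Sum>k\<in>K. - ((\<alpha> k)\<^sup>2 + (\<beta> k)\<^sup>2) / 2) = (\<Sum>k\<in>K. - s * (S m k \<omega> / sqrt m)\<^sup>2 - t * (S n k \<omega> / sqrt n)\<^sup>2)"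
    proof (intro sum.cong refl)
      fix k
      have "(\<alpha> k)\<^sup>2 = 2 * s * (S m k \<omega> / sqrt m)\<^sup>2" "(\<beta> k)\<^sup>2 = 2 * t * (S n k \<omega> / sqrt n)\<^sup>2"
        using st by (simp_all add: \<alpha>_def \<beta>_def power_mult_distrib power_divide)
      then show "- ((\<alpha> k)\<^sup>2 + (\<beta> k)\<^sup>2) / 2 = - s * (S m k \<omega> / sqrt m)\<^sup>2 - t * (S n k \<omega> / sqrt n)\<^sup>2" by simp
    qed
    also have "\<dots> = - s * pearson N p Y m \<omega> - t * pearson N p Y n \<omega>"
      using mn by (simp only: w[OF _ Y] sum_subtractf sum_distrib_left S_def)
    finally show ?thesis by (rule sym)
  qed
  have inner_\<omega>: "expectation (\<lambda>\<omega>. f \<omega> x) = \<psi> (\<lambda>k. a x k + b x k) ^ m * \<psi> (b x) ^ (n - m)" for x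
  proof -
    \<comment> \<open>The frequency that the \<open>i\<close>-th trial sees: the first sum stops at trial \<open>m\<close>.\<close>
    define \<theta> where "\<theta> i k = (if i < m then a x k + b x k else b x k)" for i k
    define g where "g i y = iexp (\<Sum>k\<in>K. \<theta> i k * w k y)" for i and y :: nat
    have "(\<Sum>k\<in>K. a x k * S m k \<omega> + b x k * S n k \<omega>) = (\<Sum>i<n. \<Sum>k\<in>K. \<theta> i k * w k (Y i \<omega>))" for \<omega>
    proof -
      have "(\<Sum>i<m. c i) = (\<Sum>i<n. if i < m then c i else 0)" for c :: "nat \<Rightarrow> real"
      proof -
        have "(\<Sum>i<n. if i < m then c i else 0) = (\<Sum>i\<in>{i\<in>{..<n}. i < m}. c i)"
          by (rule sum.inter_filter[symmetric]) simp
        also have "{i\<in>{..<n}. i < m} = {..<m}" using mn by auto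
        finally show ?thesis ..
      qed
      then have "a x k * S m k \<omega> + b x k * S n k \<omega> = (\<Sum>i<n. \<theta> i k * w k (Y i \<omega>))" for k
        unfolding S_def sum_distrib_left \<theta>_def
        by (simp only: sum.distrib[symmetric]) (intro sum.cong, auto simp: algebra_simps)
      then show ?thesis by (simp only:) (rule sum.swap)
    qed
    then have f_prod: "f \<omega> x = (\<Prod>i<n. g i (Y i \<omega>))" for \<omega>
      unfolding f_def g_def
      by (simp only: exp_sum[symmetric] finK finite_lessThan sum_distrib_left[symmetric] of_real_sum[symmetric])
    have "expectation (\<lambda>\<omega>. f \<omega> x) = (\<Prod>i<n. expectation (\<lambda>\<omega>. g i (Y i \<omega>)))"
      unfolding f_prod
    proof (rule indep_vars_lebesgue_integral)
      show "indep_vars (\<lambda>_. borel) (\<lambda>i \<omega>. g i (Y i \<omega>)) {..<n}"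
        by (rule indep_vars_compose2[OF indep_vars_subset[OF indep]]) auto
      show "integrable M (\<lambda>\<omega>. g i (Y i \<omega>))" for i
        by (intro integrable_const_bound[of _ 1] AE_I2 measurable_outcome_function) (simp add: g_def)
    qed simp
    also have "\<dots> = (\<Prod>i<n. \<psi> (\<theta> i))"
      unfolding \<psi>_def by (intro prod.cong refl, subst expectation_outcome) (simp only: g_def)
    also have "{..<n} = {..<m} \<union> {m..<n}" using mn by auto
    also have "(\<Prod>i\<in>\<dots>. \<psi> (\<theta> i)) = (\<Prod>i<m. \<psi> (\<theta> i)) * (\<Prod>i\<in>{m..<n}. \<psi> (\<theta> i))"
      by (rule prod.union_disjoint) auto
    also have "(\<Prod>i<m. \<psi> (\<theta> i)) = (\<Prod>i<m. \<psi> (\<lambda>k. a x k + b x k))"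
      by (intro prod.cong refl) (simp add: \<theta>_def[abs_def])
    also have "(\<Prod>i\<in>{m..<n}. \<psi> (\<theta> i)) = (\<Prod>i\<in>{m..<n}. \<psi> (b x))"
      by (intro prod.cong refl) (auto simp: \<theta>_def[abs_def])
    finally show ?thesis by simp
  qed
  have "complex_of_real (expectation (\<lambda>\<omega>. exp (- s * pearson N p Y m \<omega> - t * pearson N p Y n \<omega>)))
      = expectation (\<lambda>\<omega>. complex_of_real (exp (- s * pearson N p Y m \<omega> - t * pearson N p Y n \<omega>)))"
    by (rule integral_complex_of_real[symmetric])
  also have "\<dots> = expectation (\<lambda>\<omega>. \<integral>x. f \<omega> x \<partial>gauss2_power K)"
  proof (rule integral_cong_AE)
    show "AE \<omega> in M. complex_of_real (exp (- s * pearson N p Y m \<omega> - t * pearson N p Y n \<omega>))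
        = (\<integral>x. f \<omega> x \<partial>gauss2_power K)"
      using AE_outcome by eventually_elim (rule inner_x, blast)
    show "(\<lambda>\<omega>. \<integral>x. f \<omega> x \<partial>gauss2_power K) \<in> borel_measurable M"
      by (intro sigma_finite_measure.borel_measurable_lebesgue_integral prob_space_imp_sigma_finite
          prob_space_PiM prob_space_gauss2 f_meas)
  qed measurable
  also have "\<dots> = (\<integral>x. expectation (\<lambda>\<omega>. f \<omega> x) \<partial>gauss2_power K)"
    by (rule Q.Fubini_integral[symmetric]) (rule int_f)
  finally show ?thesis unfolding inner_\<omega> a_def b_def .
qed

text \<open>The integrand of the Gaussian mixture is bounded by \<open>1\<close> and converges pointwise. In the limit the
  quadratic form in the exponent splits into equal blocks, one for each of the \<open>N - 1\<close> coordinates,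
  so the integral is a power of a two-dimensional Gaussian integral.\<close>

lemma joint_laplace_tendsto:
  fixes m n :: "nat \<Rightarrow> nat"
  assumes m: "filterlim m at_top sequentially" and n: "filterlim n at_top sequentially"
    and ratio: "(\<lambda>i. real (m i) / real (n i)) \<longlonglongrightarrow> c\<^sup>2" and c: "0 < c" "c < 1"
    and st: "s \<ge> 0" "t \<ge> 0"
  shows "(\<lambda>i. expectation (\<lambda>\<omega>. exp (- s * pearson N p Y (m i) \<omega> - t * pearson N p Y (n i) \<omega>)))
    \<longlonglongrightarrow> ((1 + 2 * s) * (1 + 2 * t) - 4 * c\<^sup>2 * s * t) powr (- real (N - 1) / 2)"
proof -
  from pearson_as_squared_length obtain w :: "nat \<Rightarrow> nat \<Rightarrow> real" where
    w': "\<forall>k\<in>{1..<N}. (\<Sum>j=1..N. p j * w k j) = 0"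
    "\<forall>k\<in>{1..<N}. \<forall>l\<in>{1..<N}. (\<Sum>j=1..N. p j * (w k j * w l j)) = of_bool (k = l)"
    "\<forall>n \<omega>. n > 0 \<longrightarrow> (\<forall>i. Y i \<omega> \<in> {1..N}) \<longrightarrow>
       pearson N p Y n \<omega> = (\<Sum>k\<in>{1..<N}. ((\<Sum>i<n. w k (Y i \<omega>)) / sqrt n)\<^sup>2)"
    by (elim exE conjE)
  define K where "K = {1..<N}"
  note w = w'[folded K_def, rule_format]
  have finK: "finite K" by (simp add: K_def)
  interpret G: prob_space gauss2 by (rule prob_space_gauss2)
  interpret PG: product_prob_space "\<lambda>_. gauss2" K by standard
  interpret \<Pi>: prob_space "gauss2_power K" by (intro prob_space_PiM prob_space_gauss2)
  define \<psi> where "\<psi> \<theta> = (\<Sum>j=1..N. p j * iexp (\<Sum>k\<in>K. \<theta> k * w k j))" for \<theta> :: "nat \<Rightarrow> real"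
  define A where "A i x k = sqrt (2 * s) / sqrt (m i) * fst (x k) + sqrt (2 * t) / sqrt (n i) * snd (x k)"
    for i k and x :: "nat \<Rightarrow> real \<times> real"
  define B where "B i x k = sqrt (2 * t) / sqrt (n i) * snd (x k)"
    for i k and x :: "nat \<Rightarrow> real \<times> real"
  define h where "h z = exp (- (2 * s * (fst z)\<^sup>2 + 2 * (2 * c * sqrt (s * t)) * (fst z * snd z) + 2 * t
      * (snd z)\<^sup>2) / 2)"
    for z :: "real \<times> real"
  have \<psi>_le: "cmod (\<psi> \<theta>) \<le> 1" for \<theta>
  proof -
    have "cmod (\<psi> \<theta>) \<le> (\<Sum>j=1..N. p j)"
      unfolding \<psi>_def by (rule sum_norm_le) (use p_pos in \<open>force simp: norm_mult\<close>)
    then show ?thesis unfolding p_sum .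
  qed
  have ev_m: "\<forall>\<^sub>F i in sequentially. m i > 0" and ev_n: "\<forall>\<^sub>F i in sequentially. n i > 0"
    using m n eventually_gt_at_top[of "0 :: nat"] by (auto simp: filterlim_iff)
  have ev_le: "\<forall>\<^sub>F i in sequentially. m i \<le> n i"
  proof -
    have "c\<^sup>2 < 1" using c by (simp add: power_less_one_iff abs_square_less_1)
    then have "\<forall>\<^sub>F i in sequentially. real (m i) / real (n i) < 1" using ratio by (rule order_tendstoD(2)[rotated])
    then show ?thesis using ev_n by eventually_elim (simp add: divide_less_eq)
  qed
  have inv_m: "(\<lambda>i. 1 / real (m i)) \<longlonglongrightarrow> 0"
    using filterlim_compose[OF lim_1_over_n m] by simp
  have inv_n: "(\<lambda>i. 1 / real (n i)) \<longlonglongrightarrow> 0"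
    using filterlim_compose[OF lim_1_over_n n] by simp
  have sqrt_ratio: "(\<lambda>i. sqrt (m i) / sqrt (n i)) \<longlonglongrightarrow> c"
    using tendsto_real_sqrt[OF ratio] c by (simp add: real_sqrt_divide)
  have lim_\<psi>A: "(\<lambda>i. \<psi> (A i x) ^ m i) \<longlonglongrightarrow> of_real (exp (- (\<Sum>k\<in>K. (sqrt (2 * s) * fst (x k) + c * sqrt (2 * t)
      * snd (x k))\<^sup>2) / 2))" for x
  proof -
    define u where "u i = (\<Sum>k\<in>K. (sqrt (2 * s) * fst (x k) + sqrt (m i) / sqrt (n i) * sqrt (2 * t)
        * snd (x k))\<^sup>2)" for i
    have u: "u \<longlonglongrightarrow> (\<Sum>k\<in>K. (sqrt (2 * s) * fst (x k) + c * sqrt (2 * t) * snd (x k))\<^sup>2)"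
      unfolding u_def by (intro tendsto_intros sqrt_ratio)
    have eq: "(\<Sum>k\<in>K. (A i x k)\<^sup>2) = u i / m i" if "m i > 0" for i
      unfolding u_def sum_divide_distrib
    proof (intro sum.cong refl)
      fix k
      have "A i x k = (sqrt (2 * s) * fst (x k) + sqrt (m i) / sqrt (n i) * sqrt (2 * t) * snd (x k)) / sqrt (m i)"
        using that by (simp add: A_def field_simps)
      then show "(A i x k)\<^sup>2 = (sqrt (2 * s) * fst (x k) + sqrt (m i) / sqrt (n i) * sqrt (2 * t) * snd (x k))\<^sup>2
          / m i"
        by (simp add: power_divide)
    qed
    show ?thesis
      unfolding \<psi>_def
    proof (rule char_fun_power_tendsto_gaussian)
      have "(\<lambda>i. u i * (1 / m i)) \<longlonglongrightarrow> (\<Sum>k\<in>K. (sqrt (2 * s) * fst (x k) + c * sqrt (2 * t) * snd (x k))\<^sup>2) * 0"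
        by (intro tendsto_intros u inv_m)
      then have "(\<lambda>i. u i * (1 / m i)) \<longlonglongrightarrow> 0" by simp
      then show "(\<lambda>i. \<Sum>k\<in>K. (A i x k)\<^sup>2) \<longlonglongrightarrow> 0"
        by (rule Lim_transform_eventually) (use ev_m in \<open>eventually_elim, simp add: eq\<close>)
      show "(\<lambda>i. real (m i) * (\<Sum>k\<in>K. (A i x k)\<^sup>2)) \<longlonglongrightarrow> (\<Sum>k\<in>K. (sqrt (2 * s) * fst (x k) + c * sqrt (2 * t)
          * snd (x k))\<^sup>2)"
        by (rule Lim_transform_eventually[OF u]) (use ev_m in \<open>eventually_elim, simp add: eq\<close>)
    qed (use finK w p_sum p_pos in \<open>auto intro: less_imp_le\<close>)
  qed
  have lim_\<psi>B: "(\<lambda>i. \<psi> (B i x) ^ (n i - m i)) \<longlonglongrightarrow> of_real (exp (- ((1 - c\<^sup>2)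
      * (\<Sum>k\<in>K. (sqrt (2 * t) * snd (x k))\<^sup>2)) / 2))" for x
  proof -
    define v where "v = (\<Sum>k\<in>K. (sqrt (2 * t) * snd (x k))\<^sup>2)"
    have eq: "(\<Sum>k\<in>K. (B i x k)\<^sup>2) = v * (1 / n i)" for i
      unfolding v_def B_def sum_distrib_right by (simp add: power_mult_distrib power_divide)
    show ?thesis
      unfolding \<psi>_def v_def[symmetric]
    proof (rule char_fun_power_tendsto_gaussian)
      have "(\<lambda>i. v * (1 / n i)) \<longlonglongrightarrow> v * 0"
        by (intro tendsto_intros inv_n)
      then show "(\<lambda>i. \<Sum>k\<in>K. (B i x k)\<^sup>2) \<longlonglongrightarrow> 0" unfolding eq by simp
      have "(\<lambda>i. (1 - real (m i) / real (n i)) * v) \<longlonglongrightarrow> (1 - c\<^sup>2) * v"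
        by (intro tendsto_intros ratio)
      then show "(\<lambda>i. real (n i - m i) * (\<Sum>k\<in>K. (B i x k)\<^sup>2)) \<longlonglongrightarrow> (1 - c\<^sup>2) * v"
        by (rule Lim_transform_eventually)
          (use ev_n ev_le in \<open>eventually_elim, simp add: eq of_nat_diff field_simps\<close>)
    qed (use finK w p_sum p_pos in \<open>auto intro: less_imp_le\<close>)
  qed
  have \<psi>_meas: "(\<lambda>x. \<psi> (\<theta> x)) \<in> borel_measurable (gauss2_power K)"
    if "\<And>k. k \<in> K \<Longrightarrow> (\<lambda>x. \<theta> x k) \<in> borel_measurable (gauss2_power K)" for \<theta>
    unfolding \<psi>_def using that by measurable
  have A_meas: "(\<lambda>x. A i x k) \<in> borel_measurable (gauss2_power K)" if "k \<in> K" for i k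
    unfolding A_def using that by measurable
  have B_meas: "(\<lambda>x. B i x k) \<in> borel_measurable (gauss2_power K)" if "k \<in> K" for i k
    unfolding B_def using that by measurable
  \<comment> \<open>On the right are the contributions of the first \<open>m\<close> trials and of the others; their sum is the variance
    of \<open>sqrt (2 s) y \<xi> + sqrt (2 t) z \<eta>\<close> for standard normal \<open>\<xi>\<close>, \<open>\<eta>\<close> with correlation \<open>c\<close>.\<close>
  have quad: "2 * s * y\<^sup>2 + 2 * (2 * c * sqrt (s * t)) * (y * z) + 2 * t * z\<^sup>2
      = (sqrt (2 * s) * y + c * sqrt (2 * t) * z)\<^sup>2 + (1 - c\<^sup>2) * (sqrt (2 * t) * z)\<^sup>2" for y z
    using st by (simp add: power2_sum power_mult_distrib real_sqrt_mult algebra_simps)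
  have limit_prod: "of_real (exp (- (\<Sum>k\<in>K. (sqrt (2 * s) * fst (x k) + c * sqrt (2 * t) * snd (x k))\<^sup>2) / 2))
      * of_real (exp (- ((1 - c\<^sup>2) * (\<Sum>k\<in>K. (sqrt (2 * t) * snd (x k))\<^sup>2)) / 2))
      = complex_of_real (\<Prod>k\<in>K. h (x k))" for x
  proof -
    have "- ((sqrt (2 * s) * y + c * sqrt (2 * t) * z)\<^sup>2) / 2 + - ((1 - c\<^sup>2) * (sqrt (2 * t) * z)\<^sup>2) / 2
        = - (2 * s * y\<^sup>2 + 2 * (2 * c * sqrt (s * t)) * (y * z) + 2 * t * z\<^sup>2) / 2" for y z
      unfolding quad by (simp add: field_simps)
    then have "exp (- ((sqrt (2 * s) * y + c * sqrt (2 * t) * z)\<^sup>2) / 2)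
        * exp (- ((1 - c\<^sup>2) * (sqrt (2 * t) * z)\<^sup>2) / 2)
        = h (y, z)" for y z
      unfolding h_def fst_conv snd_conv by (simp only: exp_add[symmetric])
    then have "(\<Prod>k\<in>K. h (x k)) = (\<Prod>k\<in>K. exp (- ((sqrt (2 * s) * fst (x k) + c * sqrt (2 * t) * snd (x k))\<^sup>2) / 2))
        * (\<Prod>k\<in>K. exp (- ((1 - c\<^sup>2) * (sqrt (2 * t) * snd (x k))\<^sup>2) / 2))"
      by (simp flip: prod.distrib)
    also have "\<dots> = exp (\<Sum>k\<in>K. - ((sqrt (2 * s) * fst (x k) + c * sqrt (2 * t) * snd (x k))\<^sup>2) / 2)
        * exp (\<Sum>k\<in>K. - ((1 - c\<^sup>2) * (sqrt (2 * t) * snd (x k))\<^sup>2) / 2)"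
      by (simp only: exp_sum[OF finK])
    finally show ?thesis
      by (simp only: sum_divide_distrib[symmetric] sum_negf sum_distrib_left[symmetric] of_real_mult)
  qed
  have "(\<lambda>i. \<integral>x. \<psi> (A i x) ^ m i * \<psi> (B i x) ^ (n i - m i) \<partial>gauss2_power K)
      \<longlonglongrightarrow> (\<integral>x. complex_of_real (\<Prod>k\<in>K. h (x k)) \<partial>gauss2_power K)"
  proof (rule integral_dominated_convergence[where w = "\<lambda>_. 1"])
    show "AE x in gauss2_power K. (\<lambda>i. \<psi> (A i x) ^ m i * \<psi> (B i x) ^ (n i - m i)) \<longlonglongrightarrow> complex_of_real (\<Prod>k\<in>K. h (x k))"
      unfolding limit_prod[symmetric] by (intro AE_I2 tendsto_mult lim_\<psi>A lim_\<psi>B)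
    show "AE x in gauss2_power K. norm (\<psi> (A i x) ^ m i * \<psi> (B i x) ^ (n i - m i)) \<le> 1" for i
      by (intro AE_I2) (simp add: norm_mult norm_power \<psi>_le mult_le_one power_le_one)
    show "(\<lambda>x. \<psi> (A i x) ^ m i * \<psi> (B i x) ^ (n i - m i)) \<in> borel_measurable (gauss2_power K)" for i
      by (intro borel_measurable_times borel_measurable_power \<psi>_meas A_meas B_meas)
    show "(\<lambda>x. complex_of_real (\<Prod>k\<in>K. h (x k))) \<in> borel_measurable (gauss2_power K)"
      unfolding h_def by measurable
  qed simp
  also have "(\<integral>x. complex_of_real (\<Prod>k\<in>K. h (x k)) \<partial>gauss2_power K) = of_real (\<integral>x. (\<Prod>k\<in>K. h (x k)) \<partial>gauss2_power K)"
    by (rule integral_complex_of_real)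
  also have "(\<integral>x. (\<Prod>k\<in>K. h (x k)) \<partial>gauss2_power K) = (\<Prod>k\<in>K. \<integral>z. h z \<partial>gauss2)"
  proof (rule PG.product_integral_prod[OF finK])
    show "integrable gauss2 h"
    proof (rule G.integrable_const_bound[of _ 1])
      show "h \<in> borel_measurable gauss2" unfolding h_def by measurable
      have "2 * s * (fst z)\<^sup>2 + 2 * (2 * c * sqrt (s * t)) * (fst z * snd z) + 2 * t * (snd z)\<^sup>2 \<ge> 0"
        for z :: "real \<times> real"
        unfolding quad using c by (simp add: power_le_one)
      then have "- (2 * s * (fst z)\<^sup>2 + 2 * (2 * c * sqrt (s * t)) * (fst z * snd z) + 2 * t * (snd z)\<^sup>2) / 2 \<le> 0"
        for z :: "real \<times> real"
        by (metis neg_le_0_iff_le divide_nonpos_pos zero_less_numeral)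
      then have "norm (h z) \<le> 1" for z unfolding h_def by (simp only: real_norm_def abs_exp_cancel exp_le_one_iff)
      then show "AE z in gauss2. norm (h z) \<le> 1" by simp
    qed
  qed
  also have "(\<integral>z. h z \<partial>gauss2) = ((1 + 2 * s) * (1 + 2 * t) - (2 * c * sqrt (s * t))\<^sup>2) powr (- 1 / 2)"
    unfolding h_def
  proof (rule gauss2_integral_quadratic)
    have "c\<^sup>2 * (s * t) \<le> 1 * (s * t)" using c st by (intro mult_right_mono) (auto simp: power_le_one)
    then show "(2 * c * sqrt (s * t))\<^sup>2 \<le> 2 * s * (2 * t)" using st by (simp add: power_mult_distrib)
  qed (use st in auto)
  also have "(2 * c * sqrt (s * t))\<^sup>2 = 4 * c\<^sup>2 * s * t" using st by (simp add: power_mult_distrib)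
  also have "(\<Prod>k\<in>K. ((1 + 2 * s) * (1 + 2 * t) - 4 * c\<^sup>2 * s * t) powr (- 1 / 2))
      = ((1 + 2 * s) * (1 + 2 * t) - 4 * c\<^sup>2 * s * t) powr (- real (N - 1) / 2)"
  proof -
    have "c\<^sup>2 * (s * t) \<le> 1 * (s * t)" using c st by (intro mult_right_mono) (auto simp: power_le_one)
    then have "(1 + 2 * s) * (1 + 2 * t) - 4 * c\<^sup>2 * s * t > 0" using st by (simp add: algebra_simps)
    then show ?thesis by (simp add: K_def powr_realpow[symmetric] powr_powr)
  qed
  finally have lim: "(\<lambda>i. \<integral>x. \<psi> (A i x) ^ m i * \<psi> (B i x) ^ (n i - m i) \<partial>gauss2_power K)
      \<longlonglongrightarrow> of_real (((1 + 2 * s) * (1 + 2 * t) - 4 * c\<^sup>2 * s * t) powr (- real (N - 1) / 2))" .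
  have "(\<lambda>i. complex_of_real (expectation (\<lambda>\<omega>. exp (- s * pearson N p Y (m i) \<omega> - t * pearson N p Y (n i) \<omega>))))
      \<longlonglongrightarrow> of_real (((1 + 2 * s) * (1 + 2 * t) - 4 * c\<^sup>2 * s * t) powr (- real (N - 1) / 2))"
  proof (rule Lim_transform_eventually[OF lim])
    show "\<forall>\<^sub>F i in sequentially. (\<integral>x. \<psi> (A i x) ^ m i * \<psi> (B i x) ^ (n i - m i) \<partial>gauss2_power K)
        = complex_of_real (expectation (\<lambda>\<omega>. exp (- s * pearson N p Y (m i) \<omega> - t * pearson N p Y (n i) \<omega>)))"
      using ev_m ev_le
    proof eventually_elim
      case (elim i)
      show ?case
        using joint_laplace_as_gaussian_mixture[of w "m i" "n i" s t, folded K_def, OF w(3) elim st]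
        unfolding \<psi>_def A_def B_def by simp
    qed
  qed
  then show ?thesis by (simp only: tendsto_of_real_iff)
qed

end

section \<open>Pairs of sample sizes with a prescribed limiting ratio\<close>

lemma eventually_sample_sizes:
  assumes "eventually P (sample_sizes r)"
  shows "\<exists>k e. e > 0 \<and> (\<forall>m n. m \<ge> k \<longrightarrow> n \<ge> k \<longrightarrow> \<bar>real m / real n - r\<bar> < e \<longrightarrow> P (m, n))"
proof -
  obtain Q R where Q: "eventually Q (sequentially \<times>\<^sub>F sequentially)"
    and R: "eventually R (filtercomap (\<lambda>(m, n). real m / real n) (nhds r))"
    and QR: "\<And>z. Q z \<Longrightarrow> R z \<Longrightarrow> P z"
    using assms unfolding sample_sizes_def eventually_inf by blast
  obtain k where k: "\<And>m n. m \<ge> k \<Longrightarrow> n \<ge> k \<Longrightarrow> Q (m, n)"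
    using Q unfolding eventually_prod_sequentially by blast
  obtain R' where R': "eventually R' (nhds r)" "\<And>m n. R' (real m / real n) \<Longrightarrow> R (m, n)"
    using R unfolding eventually_filtercomap by (auto simp: case_prod_beta)
  then obtain e where "e > 0" "\<And>x. dist x r < e \<Longrightarrow> R' x"
    unfolding eventually_nhds_metric by blast
  then show ?thesis using k QR R'(2) unfolding dist_real_def by blast
qed

lemma sample_sizes_eventuallyI:
  assumes "e > 0" "\<And>m n. m \<ge> k \<Longrightarrow> n \<ge> k \<Longrightarrow> \<bar>real m / real n - r\<bar> < e \<Longrightarrow> P (m, n)"
  shows "eventually P (sample_sizes r)"
  unfolding sample_sizes_def eventually_inf
proof (intro exI conjI allI impI)
  show "eventually (\<lambda>(m, n). m \<ge> k \<and> n \<ge> k) (sequentially \<times>\<^sub>F sequentially)"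
    unfolding eventually_prod_sequentially by auto
  show "eventually (\<lambda>(m, n). dist (real m / real n) r < e) (filtercomap (\<lambda>(m, n). real m / real n) (nhds r))"
    unfolding eventually_filtercomap
    using assms(1) by (intro exI[of _ "\<lambda>x. dist x r < e"]) (auto simp: eventually_nhds_metric)
qed (use assms(2) in \<open>auto simp: dist_real_def\<close>)

lemma filterlim_sample_sizes:
  assumes "filterlim m at_top sequentially" "filterlim n at_top sequentially"
    and "(\<lambda>i. real (m i) / real (n i)) \<longlonglongrightarrow> r"
  shows "filterlim (\<lambda>i. (m i, n i)) (sample_sizes r) sequentially"
  unfolding filterlim_iff
proof (intro allI impI)
  fix P assume "eventually P (sample_sizes r)"
  from eventually_sample_sizes[OF this] obtain k e where ke: "e > 0"
    "\<And>m n. m \<ge> k \<Longrightarrow> n \<ge> k \<Longrightarrow> \<bar>real m / real n - r\<bar> < e \<Longrightarrow> P (m, n)" by blast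
  have "\<forall>\<^sub>F i in sequentially. m i \<ge> k" "\<forall>\<^sub>F i in sequentially. n i \<ge> k"
    using assms(1,2) by (simp_all add: filterlim_at_top)
  moreover have "\<forall>\<^sub>F i in sequentially. dist (real (m i) / real (n i)) r < e"
    using assms(3) ke(1) by (rule tendstoD)
  ultimately show "\<forall>\<^sub>F i in sequentially. P (m i, n i)"
    by eventually_elim (simp add: ke(2) dist_real_def)
qed

text \<open>The filter has a countable basis, so limits along it can be tested on sequences of pairs; this makes
  dominated convergence applicable.\<close>

lemma tendsto_sample_sizesI:
  fixes g :: "nat \<times> nat \<Rightarrow> 'b :: metric_space"
  assumes seq: "\<And>m n. filterlim m at_top sequentially \<Longrightarrow> filterlim n at_top sequentially \<Longrightarrow>
      (\<lambda>i. real (m i) / real (n i)) \<longlonglongrightarrow> r \<Longrightarrow> (\<lambda>i::nat. g (m i, n i)) \<longlonglongrightarrow> L"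
  shows "(g \<longlongrightarrow> L) (sample_sizes r)"
proof (rule tendstoI, rule ccontr)
  fix e :: real assume "e > 0" and not: "\<not> eventually (\<lambda>z. dist (g z) L < e) (sample_sizes r)"
  have "\<exists>m n. m \<ge> k \<and> n \<ge> k \<and> \<bar>real m / real n - r\<bar> < 1 / real (Suc k) \<and> \<not> dist (g (m, n)) L < e" for k :: nat
  proof (rule ccontr)
    assume "\<not> ?thesis"
    then have "eventually (\<lambda>z. dist (g z) L < e) (sample_sizes r)"
      by (intro sample_sizes_eventuallyI[of "1 / real (Suc k)" k]) auto
    with not show False by contradiction
  qed
  then obtain m n where mn: "\<And>k. m k \<ge> k" "\<And>k. n k \<ge> k"
    "\<And>k. \<bar>real (m k) / real (n k) - r\<bar> < 1 / real (Suc k)" "\<And>k. \<not> dist (g (m k, n k)) L < e"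
    by metis
  have "filterlim m at_top sequentially" "filterlim n at_top sequentially"
    using mn(1,2) filterlim_at_top_mono[OF filterlim_ident] by (auto intro: always_eventually)
  moreover have "(\<lambda>k. real (m k) / real (n k)) \<longlonglongrightarrow> r"
  proof -
    have "(\<lambda>k. real (m k) / real (n k) - r) \<longlonglongrightarrow> 0"
      using mn(3) by (intro Lim_null_comparison[OF always_eventually LIMSEQ_inverse_real_of_nat])
        (auto simp: inverse_eq_divide intro: less_imp_le)
    then show ?thesis by (simp add: LIM_zero_iff)
  qed
  ultimately have "(\<lambda>i. g (m i, n i)) \<longlonglongrightarrow> L" by (rule seq)
  then have "\<forall>\<^sub>F i in sequentially. dist (g (m i, n i)) L < e" using \<open>e > 0\<close> by (rule tendstoD)
  then show False using mn(4) by (auto simp: eventually_sequentially)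
qed

text \<open>An explicit sequence of admissible pairs \<open>(i, n i)\<close>. It shows that the filter is proper, and it
  allows the limit of a single tail to be read off from a joint limit.\<close>

lemma second_sample_size_for:
  assumes "0 < c"
  defines "n \<equiv> \<lambda>i::nat. nat \<lceil>real i / c\<^sup>2\<rceil>"
  shows "filterlim n at_top sequentially" "(\<lambda>i. real i / real (n i)) \<longlonglongrightarrow> c\<^sup>2"
proof -
  have n_eq: "real (n i) = of_int \<lceil>real i / c\<^sup>2\<rceil>" for i
    unfolding n_def by (simp add: of_nat_nat ceiling_mono[of 0, simplified])
  have lower: "real i / c\<^sup>2 \<le> real (n i)" for i unfolding n_eq by (rule le_of_int_ceiling)
  have upper: "real (n i) \<le> real i / c\<^sup>2 + 1" for i unfolding n_eq by linarith
  have "filterlim (\<lambda>i. real i / c\<^sup>2) at_top sequentially"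
    using assms by real_asymp
  then have "filterlim (\<lambda>i. real (n i)) at_top sequentially"
    by (rule filterlim_at_top_mono) (simp add: lower)
  then show "filterlim n at_top sequentially"
    by (simp add: filterlim_sequentially_iff_filterlim_real)
  have lower_lim: "(\<lambda>i. real i / (real i / c\<^sup>2 + 1)) \<longlonglongrightarrow> c\<^sup>2" using assms by real_asymp
  have bounds: "real i / (real i / c\<^sup>2 + 1) \<le> real i / real (n i)" "real i / real (n i) \<le> c\<^sup>2"
    if "i > 0" for i
  proof -
    have "real i / c\<^sup>2 > 0" using that assms by simp
    then have "real (n i) > 0" using lower[of i] by linarith
    then show "real i / (real i / c\<^sup>2 + 1) \<le> real i / real (n i)"
      using upper[of i] \<open>real i / c\<^sup>2 > 0\<close> by (intro divide_left_mono) auto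
    show "real i / real (n i) \<le> c\<^sup>2"
      using lower[of i] \<open>real (n i) > 0\<close> assms(1) by (simp add: field_simps)
  qed
  have "\<forall>\<^sub>F i in sequentially. real i / (real i / c\<^sup>2 + 1) \<le> real i / real (n i)"
    "\<forall>\<^sub>F i in sequentially. real i / real (n i) \<le> c\<^sup>2"
    by (rule eventually_mono[OF eventually_gt_at_top[of "0 :: nat"]], erule bounds)+
  then show "(\<lambda>i. real i / real (n i)) \<longlonglongrightarrow> c\<^sup>2"
    using lower_lim tendsto_const by (rule tendsto_sandwich)
qed

lemma sample_sizes_neq_bot:
  assumes "0 < c" shows "sample_sizes (c\<^sup>2) \<noteq> bot"
proof
  assume "sample_sizes (c\<^sup>2) = bot"
  then have "filterlim (\<lambda>i. (i, nat \<lceil>real i / c\<^sup>2\<rceil>)) bot sequentially"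
    using filterlim_sample_sizes[OF filterlim_ident second_sample_size_for[OF assms]] by simp
  from this[unfolded filterlim_iff, rule_format, of "\<lambda>_. False"] show False by simp
qed

section \<open>The bivariate gamma density and its Laplace transform\<close>

abbreviation gamma_kernel :: "real \<Rightarrow> real \<Rightarrow> real \<Rightarrow> real" where
  "gamma_kernel a b u \<equiv> indicator {0<..} u * (u powr (a - 1) * exp (- b * u))"

lemma nn_integral_powr_exp:
  fixes a b :: real
  assumes "a > 0" "b > 0"
  shows "(\<integral>\<^sup>+u. ennreal (gamma_kernel a b u) \<partial>lborel)
       = ennreal (Gamma a * b powr (- a))"
proof -
  have "ennreal (Gamma a) = (\<integral>\<^sup>+t. ennreal (indicator {0..} t * t powr (a - 1) / exp t) \<partial>lborel)"
    using assms(1) by (rule Gamma_conv_nn_integral_real)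
  also have "\<dots> = (\<integral>\<^sup>+t. ennreal (indicator {0<..} t * (t powr (a - 1) * exp (- t))) \<partial>lborel)"
    by (rule nn_integral_cong_AE, use AE_lborel_singleton[of 0] in eventually_elim)
      (auto simp: indicator_def exp_minus field_simps)
  also have "\<dots> = ennreal \<bar>b\<bar> * (\<integral>\<^sup>+u. ennreal (indicator {0<..} (0 + b * u)
      * ((0 + b * u) powr (a - 1) * exp (- (0 + b * u)))) \<partial>lborel)"
    using assms by (intro nn_integral_real_affine) auto
  also have "\<dots> = (\<integral>\<^sup>+u. ennreal \<bar>b\<bar>
      * ennreal (indicator {0<..} (0 + b * u) * ((0 + b * u) powr (a - 1) * exp (- (0 + b * u)))) \<partial>lborel)"
    by (rule nn_integral_cmult[symmetric]) measurable
  also have "\<dots> = (\<integral>\<^sup>+u. ennreal (b powr a) * ennreal (gamma_kernel a b u) \<partial>lborel)"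
  proof (intro nn_integral_cong)
    fix u :: real
    have "b * b powr (a - 1) = b powr a" using assms by (simp add: powr_diff)
    then have "\<bar>b\<bar> * (indicator {0<..} (0 + b * u) * ((0 + b * u) powr (a - 1) * exp (- (0 + b * u))))
        = b powr a * (gamma_kernel a b u)"
      using assms by (cases "u > 0") (simp_all add: zero_less_mult_iff powr_mult mult_ac)
    then show "ennreal \<bar>b\<bar> * ennreal (indicator {0<..} (0 + b * u) * ((0 + b * u) powr (a - 1) * exp (- (0 + b * u))))
        = ennreal (b powr a) * ennreal (gamma_kernel a b u)"
      by (simp only: ennreal_mult'[OF abs_ge_zero, symmetric] ennreal_mult'[OF powr_ge_zero, symmetric])
  qed
  also have "\<dots> = ennreal (b powr a) * (\<integral>\<^sup>+u. ennreal (gamma_kernel a b u) \<partial>lborel)"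
    by (rule nn_integral_cmult) simp
  finally have "ennreal (b powr (- a)) * ennreal (Gamma a)
      = ennreal (b powr (- a)) * (ennreal (b powr a) * (\<integral>\<^sup>+u. ennreal (gamma_kernel a b u) \<partial>lborel))"
    by (simp only:)
  moreover have "ennreal (b powr (- a)) * ennreal (b powr a) = 1"
    using assms by (simp flip: ennreal_mult' powr_add)
  ultimately have "ennreal (b powr (- a)) * ennreal (Gamma a)
      = (\<integral>\<^sup>+u. ennreal (gamma_kernel a b u) \<partial>lborel)"
    by (simp only: mult.assoc[symmetric] mult_1_left)
  then show ?thesis
    by (simp only: ennreal_mult'[OF powr_ge_zero, symmetric] mult.commute[of "Gamma a"])
qed

text \<open>The Infeld function is \<open>I\<^sub>\<delta>(z) = (z / 2) powr \<delta> * bessel_series \<delta> (z\<^sup>2 / 4)\<close>. Without the power of \<open>z\<close>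
  the series is entire in \<open>y\<close> and can be integrated termwise against gamma densities.\<close>

definition bessel_series :: "real \<Rightarrow> real \<Rightarrow> real" where
  "bessel_series \<delta> y = (\<Sum>k. y ^ k / (fact k * Gamma (real k + \<delta> + 1)))"

lemma Gamma_shift_ge:
  assumes "\<delta> \<ge> 0" shows "Gamma (real k + \<delta> + 1) \<ge> Gamma (\<delta> + 1)"
proof (induction k)
  case (Suc k)
  have "real k + \<delta> + 1 \<notin> \<int>\<^sub>\<le>\<^sub>0" using assms nonpos_Ints_nonpos[of "real k + \<delta> + 1"] by auto
  then have "Gamma (real (Suc k) + \<delta> + 1) = (real k + \<delta> + 1) * Gamma (real k + \<delta> + 1)"
    using Gamma_plus1[of "real k + \<delta> + 1"] by (simp add: add_ac)
  also have "\<dots> \<ge> 1 * Gamma (real k + \<delta> + 1)"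
    using assms by (intro mult_right_mono) (auto intro: less_imp_le Gamma_real_pos)
  finally show ?case using Suc by simp
qed simp

lemma summable_bessel_series:
  assumes "\<delta> \<ge> 0"
  shows "summable (\<lambda>k. y ^ k / (fact k * Gamma (real k + \<delta> + 1)))"
proof (rule summable_comparison_test'[where N = 0])
  have pos: "Gamma (\<delta> + 1) > 0" using assms by (intro Gamma_real_pos) simp
  show "summable (\<lambda>k. (\<bar>y\<bar> ^ k /\<^sub>R fact k) / Gamma (\<delta> + 1))"
    by (intro summable_divide summable_exp_generic)
  fix k
  have "\<bar>y\<bar> ^ k / (fact k * Gamma (real k + \<delta> + 1)) \<le> \<bar>y\<bar> ^ k / (fact k * Gamma (\<delta> + 1))"
    using Gamma_shift_ge[OF assms, of k] pos
    by (intro divide_left_mono mult_left_mono mult_pos_pos) auto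
  then show "norm (y ^ k / (fact k * Gamma (real k + \<delta> + 1))) \<le> (\<bar>y\<bar> ^ k /\<^sub>R fact k) / Gamma (\<delta> + 1)"
    using Gamma_shift_ge[OF assms, of k] pos
    by (simp add: norm_divide norm_mult power_abs field_simps)
qed

lemma bessel_series_nonneg:
  assumes "\<delta> \<ge> 0" "y \<ge> 0" shows "bessel_series \<delta> y \<ge> 0"
  unfolding bessel_series_def
  using assms by (intro suminf_nonneg summable_bessel_series divide_nonneg_nonneg mult_nonneg_nonneg)
    (auto intro!: less_imp_le[OF Gamma_real_pos])

lemma measurable_bessel_series [measurable]: "bessel_series \<delta> \<in> borel_measurable borel"
  unfolding bessel_series_def[abs_def] by measurable

text \<open>Each term is a gamma integral whose value cancels the gamma function in the denominator of the
  coefficient, so the series that remains is an exponential series.\<close>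

lemma nn_integral_bessel_series:
  assumes "\<delta> \<ge> 0" "b > 0" "q \<ge> 0"
  shows "(\<integral>\<^sup>+u. ennreal (indicator {0<..} u * (u powr \<delta> * exp (- b * u) * bessel_series \<delta> (q * u))) \<partial>lborel)
       = ennreal (b powr (- (\<delta> + 1)) * exp (q / b))"
proof -
  define f where "f k u = indicator {0<..} u * (u powr (real k + \<delta> + 1 - 1) * exp (- b * u))" for k u
  define C where "C k = q ^ k / (fact k * Gamma (real k + \<delta> + 1))" for k
  have G: "Gamma (real k + \<delta> + 1) > 0" for k using assms by (intro Gamma_real_pos) simp
  have C: "C k \<ge> 0" for k unfolding C_def using assms G[of k] by simp
  have f: "f k u \<ge> 0" for k u by (simp add: f_def)
  have [measurable]: "f k \<in> borel_measurable borel" for k unfolding f_def by measurable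
  \<comment> \<open>On the positive axis, \<open>u powr \<delta> * (q * u) ^ k\<close> is again a power, so every term is a gamma integrand.\<close>
  have expand: "ennreal (indicator {0<..} u * (u powr \<delta> * exp (- b * u) * bessel_series \<delta> (q * u)))
      = (\<Sum>k. ennreal (C k * f k u))" for u
  proof (cases "u > 0")
    case False then show ?thesis by (simp add: f_def)
  next
    case True
    have "(\<lambda>k. u powr \<delta> * exp (- b * u) * ((q * u) ^ k / (fact k * Gamma (real k + \<delta> + 1))))
        sums (u powr \<delta> * exp (- b * u) * bessel_series \<delta> (q * u))"
      unfolding bessel_series_def by (intro sums_mult summable_sums summable_bessel_series assms)
    moreover have "u powr \<delta> * exp (- b * u) * ((q * u) ^ k / (fact k * Gamma (real k + \<delta> + 1))) = C k * f k u" for k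
      using True by (simp add: C_def f_def powr_add powr_realpow power_mult_distrib mult_ac)
    ultimately have "(\<lambda>k. C k * f k u) sums (u powr \<delta> * exp (- b * u) * bessel_series \<delta> (q * u))" by simp
    then show ?thesis
      using True C f by (subst suminf_ennreal2) (auto simp: sums_iff)
  qed
  have integral_term: "(\<integral>\<^sup>+u. ennreal (C k * f k u) \<partial>lborel)
      = ennreal (b powr (- (\<delta> + 1)) * ((q / b) ^ k /\<^sub>R fact k))" for k
  proof -
    have "(\<integral>\<^sup>+u. ennreal (C k * f k u) \<partial>lborel) = ennreal (C k) * (\<integral>\<^sup>+u. ennreal (f k u) \<partial>lborel)"
      using C by (simp add: ennreal_mult' nn_integral_cmult)
    also have "(\<integral>\<^sup>+u. ennreal (f k u) \<partial>lborel) = ennreal (Gamma (real k + \<delta> + 1) * b powr - (real k + \<delta> + 1))"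
      unfolding f_def using assms by (intro nn_integral_powr_exp) auto
    also have "ennreal (C k) * \<dots> = ennreal (C k * (Gamma (real k + \<delta> + 1) * b powr - (real k + \<delta> + 1)))"
      using C by (simp add: ennreal_mult')
    also have "b powr - (real k + \<delta> + 1) = b powr (- (\<delta> + 1)) / b ^ k"
    proof -
      have "- (real k + \<delta> + 1) = - (\<delta> + 1) - real k" by simp
      then show ?thesis using assms by (simp only: powr_diff powr_realpow)
    qed
    also have "C k * (Gamma (real k + \<delta> + 1) * (b powr (- (\<delta> + 1)) / b ^ k))
        = b powr (- (\<delta> + 1)) * ((q / b) ^ k /\<^sub>R fact k)"
    proof -
      define g where "g = Gamma (real k + \<delta> + 1)"
      have "g > 0" using G[of k] by (simp add: g_def)
      then show ?thesis
        unfolding C_def g_def[symmetric] using assms(2) by (simp add: power_divide field_simps)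
    qed
    finally show ?thesis .
  qed
  have "(\<integral>\<^sup>+u. ennreal (indicator {0<..} u * (u powr \<delta> * exp (- b * u) * bessel_series \<delta> (q * u))) \<partial>lborel)
      = (\<Sum>k. \<integral>\<^sup>+u. ennreal (C k * f k u) \<partial>lborel)"
    unfolding expand by (rule nn_integral_suminf) measurable
  also have "\<dots> = ennreal (b powr (- (\<delta> + 1)) * exp (q / b))"
  proof -
    have "(\<lambda>k. b powr (- (\<delta> + 1)) * ((q / b) ^ k /\<^sub>R fact k)) sums (b powr (- (\<delta> + 1)) * exp (q / b))"
      by (intro sums_mult exp_converges)
    then show ?thesis unfolding integral_term using assms
      by (subst suminf_ennreal2) (auto simp: sums_iff)
  qed
  finally show ?thesis .
qed

abbreviation lborel2 :: "(real \<times> real) measure" where "lborel2 \<equiv> lborel \<Otimes>\<^sub>M lborel"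

text \<open>The density \<open>p\<^sub>2\<^sub>,\<^sub>0\<close> on the open quadrant, with \<open>I\<^sub>\<delta>\<close> expressed through the entire series, and
  extended by \<open>0\<close> to the plane.\<close>

definition kibble_density :: "real \<Rightarrow> real \<Rightarrow> real \<times> real \<Rightarrow> real" where
  "kibble_density \<delta> c = (\<lambda>(u, v). indicator {0<..} u * indicator {0<..} v *
     ((u * v) powr \<delta> * exp (- (u + v) / (1 - c\<^sup>2)) * bessel_series \<delta> (c\<^sup>2 * u * v / (1 - c\<^sup>2)\<^sup>2)
      / ((1 - c\<^sup>2) powr (\<delta> + 1) * Gamma (\<delta> + 1))))"

definition kibble_measure :: "real \<Rightarrow> real \<Rightarrow> (real \<times> real) measure" where
  "kibble_measure \<delta> c = density lborel2 (\<lambda>z. ennreal (kibble_density \<delta> c z))"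

lemma sets_kibble_measure [measurable_cong]: "sets (kibble_measure \<delta> c) = sets (borel \<Otimes>\<^sub>M borel)"
  unfolding kibble_measure_def sets_density by (intro sets_pair_measure_cong) auto

lemma measurable_kibble_density [measurable]:
  "kibble_density \<delta> c \<in> borel_measurable (borel \<Otimes>\<^sub>M borel)"
  unfolding kibble_density_def by measurable

locale kibble =
  fixes \<delta> c :: real
  assumes \<delta>: "\<delta> \<ge> 0" and c: "0 < c" "c < 1"
begin

definition "\<beta> = 1 - c\<^sup>2"

lemma \<beta>: "0 < \<beta>" "\<beta> < 1"
  using c by (auto simp: \<beta>_def power_less_one_iff abs_square_less_1)

lemma Gamma_pos: "Gamma (\<delta> + 1) > 0" using \<delta> by (intro Gamma_real_pos) simp

lemma kibble_density_nonneg: "kibble_density \<delta> c z \<ge> 0"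
  unfolding kibble_density_def using \<delta> Gamma_pos \<beta>
  by (auto simp: case_prod_beta indicator_def \<beta>_def intro!: mult_nonneg_nonneg divide_nonneg_nonneg bessel_series_nonneg)

text \<open>The exponential factor replaces the decay rate \<open>1 / \<beta>\<close> in the second variable by \<open>b\<close>. The marginal law
  is the case \<open>b = 1 / \<beta>\<close>, the Laplace transform at \<open>t\<close> in the second variable the case \<open>b = 1 / \<beta> + t\<close>.\<close>

lemma nn_integral_kibble_density_snd:
  assumes "b > 0"
  shows "(\<integral>\<^sup>+v. ennreal (kibble_density \<delta> c (u, v) * exp (- (b - 1 / \<beta>) * v)) \<partial>lborel)
    = ennreal (indicator {0<..} u * (u powr \<delta> * exp (- (1 / \<beta> - c\<^sup>2 / (\<beta>\<^sup>2 * b)) * u)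
        / ((\<beta> * b) powr (\<delta> + 1) * Gamma (\<delta> + 1))))"
proof (cases "u > 0")
  case False then show ?thesis by (simp add: kibble_density_def)
next
  case u: True
  define K where "K = u powr \<delta> * exp (- u / \<beta>) / (\<beta> powr (\<delta> + 1) * Gamma (\<delta> + 1))"
  define q where "q = c\<^sup>2 * u / \<beta>\<^sup>2"
  have K: "K \<ge> 0" unfolding K_def using Gamma_pos by simp
  have q: "q \<ge> 0" unfolding q_def using u by simp
  have "kibble_density \<delta> c (u, v) * exp (- (b - 1 / \<beta>) * v)
      = K * (indicator {0<..} v * (v powr \<delta> * exp (- b * v) * bessel_series \<delta> (q * v)))" for v
  proof (cases "v > 0")
    case v: True
    have "exp (- (u + v) / \<beta>) * exp (- (b - 1 / \<beta>) * v) = exp (- u / \<beta>) * exp (- b * v)"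
      using \<beta> by (simp flip: exp_add add: field_simps)
    then show ?thesis using u v
      unfolding kibble_density_def K_def q_def \<beta>_def[symmetric] by (simp add: powr_mult mult_ac)
  qed (simp add: kibble_density_def)
  then have "(\<integral>\<^sup>+v. ennreal (kibble_density \<delta> c (u, v) * exp (- (b - 1 / \<beta>) * v)) \<partial>lborel)
      = (\<integral>\<^sup>+v. ennreal K * ennreal (indicator {0<..} v * (v powr \<delta> * exp (- b * v) * bessel_series \<delta> (q * v)))
          \<partial>lborel)"
    using K by (simp add: ennreal_mult')
  also have "\<dots> = ennreal K * ennreal (b powr (- (\<delta> + 1)) * exp (q / b))"
    by (subst nn_integral_cmult) (simp_all only: nn_integral_bessel_series[OF \<delta> assms q], measurable)
  also have "\<dots> = ennreal (K * (b powr (- (\<delta> + 1)) * exp (q / b)))"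
    using K by (simp add: ennreal_mult')
  also have "K * (b powr (- (\<delta> + 1)) * exp (q / b))
      = indicator {0<..} u * (u powr \<delta> * exp (- (1 / \<beta> - c\<^sup>2 / (\<beta>\<^sup>2 * b)) * u)
        / ((\<beta> * b) powr (\<delta> + 1) * Gamma (\<delta> + 1)))"
  proof -
    have "exp (- u / \<beta>) * exp (q / b) = exp (- (1 / \<beta> - c\<^sup>2 / (\<beta>\<^sup>2 * b)) * u)"
      using \<beta> assms by (simp flip: exp_add add: q_def field_simps)
    moreover have "b powr (- (\<delta> + 1)) = inverse (b powr (\<delta> + 1))" by (rule powr_minus)
    moreover have "(\<beta> * b) powr (\<delta> + 1) = \<beta> powr (\<delta> + 1) * b powr (\<delta> + 1)"
      using \<beta> assms by (simp add: powr_mult)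
    moreover have "K * (inverse (b powr (\<delta> + 1)) * exp (q / b))
        = u powr \<delta> * (exp (- u / \<beta>) * exp (q / b)) / ((\<beta> powr (\<delta> + 1) * b powr (\<delta> + 1)) * Gamma (\<delta> + 1))"
      unfolding K_def by (simp only: divide_inverse inverse_mult_distrib mult_ac)
    ultimately show ?thesis using u by (simp only: indicator_simps greaterThan_iff mult_1)
  qed
  finally show ?thesis .
qed

text \<open>Integrating out the second variable leaves a multiple of a gamma density in the first one.\<close>

lemma nn_integral_kibble:
  assumes "s \<ge> 0" "t \<ge> 0"
  shows "(\<integral>\<^sup>+z. ennreal (exp (- s * fst z - t * snd z)) \<partial>kibble_measure \<delta> c)
    = ennreal ((1 + s + t + \<beta> * s * t) powr (- (\<delta> + 1)))"
proof -
  define b where "b = 1 / \<beta> + t"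
  define a where "a = 1 / \<beta> - c\<^sup>2 / (\<beta>\<^sup>2 * b) + s"
  define C where "C = inverse ((\<beta> * b) powr (\<delta> + 1) * Gamma (\<delta> + 1))"
  have bpos: "b > 0" using \<beta> assms by (simp add: b_def add_pos_nonneg)
  have bb: "\<beta> * b = 1 + \<beta> * t" using \<beta> by (simp add: b_def distrib_left)
  have cc: "c\<^sup>2 = 1 - \<beta>" by (simp add: \<beta>_def)
  \<comment> \<open>The rate \<open>a\<close> that is left for the first variable combines with \<open>b\<close> to the value of the transform.\<close>
  have ab: "\<beta> * b * a = 1 + s + t + \<beta> * s * t"
  proof -
    have "\<beta> * b * a = b - c\<^sup>2 / \<beta> + \<beta> * b * s" using \<beta> bpos by (simp add: a_def field_simps power2_eq_square)
    also have "\<dots> = 1 + s + t + \<beta> * s * t" unfolding bb using \<beta> by (simp add: b_def cc field_simps)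
    finally show ?thesis .
  qed
  have apos: "a > 0"
  proof -
    have "\<beta> * b * a > 0" unfolding ab using \<beta> assms by (simp add: add_pos_nonneg)
    then show ?thesis using zero_less_mult_pos[of "\<beta> * b" a] \<beta> bpos by simp
  qed
  have Cpos: "C \<ge> 0" unfolding C_def using Gamma_pos by simp
  have "(\<integral>\<^sup>+z. ennreal (exp (- s * fst z - t * snd z)) \<partial>kibble_measure \<delta> c)
      = (\<integral>\<^sup>+z. ennreal (kibble_density \<delta> c z) * ennreal (exp (- s * fst z - t * snd z)) \<partial>lborel2)"
    unfolding kibble_measure_def by (subst nn_integral_density) auto
  also have "\<dots> = (\<integral>\<^sup>+u. \<integral>\<^sup>+v. ennreal (kibble_density \<delta> c (u, v)) * ennreal (exp (- s * u - t * v)) \<partial>lborel \<partial>lborel)"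
    by (subst lborel.nn_integral_fst[symmetric]) auto
  also have "\<dots> = (\<integral>\<^sup>+u. ennreal C * ennreal (indicator {0<..} u * (u powr (\<delta> + 1 - 1) * exp (- a * u))) \<partial>lborel)"
  proof (intro nn_integral_cong)
    fix u
    have "(\<integral>\<^sup>+v. ennreal (kibble_density \<delta> c (u, v)) * ennreal (exp (- s * u - t * v)) \<partial>lborel)
        = (\<integral>\<^sup>+v. ennreal (exp (- s * u)) * ennreal (kibble_density \<delta> c (u, v) * exp (- (b - 1 / \<beta>) * v)) \<partial>lborel)"
    proof (intro nn_integral_cong)
      fix v
      have "exp (- s * u) * exp (- (b - 1 / \<beta>) * v) = exp (- s * u - t * v)"
        by (simp flip: exp_add add: b_def)
      then have "kibble_density \<delta> c (u, v) * exp (- s * u - t * v)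
          = exp (- s * u) * (kibble_density \<delta> c (u, v) * exp (- (b - 1 / \<beta>) * v))"
        by (metis mult.left_commute)
      then show "ennreal (kibble_density \<delta> c (u, v)) * ennreal (exp (- s * u - t * v))
          = ennreal (exp (- s * u)) * ennreal (kibble_density \<delta> c (u, v) * exp (- (b - 1 / \<beta>) * v))"
        by (simp only: ennreal_mult'[OF kibble_density_nonneg, symmetric] ennreal_mult'[OF exp_ge_zero, symmetric])
    qed
    also have "\<dots> = ennreal (exp (- s * u))
        * ennreal (indicator {0<..} u * (u powr \<delta> * exp (- (1 / \<beta> - c\<^sup>2 / (\<beta>\<^sup>2 * b)) * u)
        / ((\<beta> * b) powr (\<delta> + 1) * Gamma (\<delta> + 1))))"
      by (subst nn_integral_cmult) (simp_all only: nn_integral_kibble_density_snd[OF bpos], measurable)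
    also have "\<dots> = ennreal C * ennreal (indicator {0<..} u * (u powr (\<delta> + 1 - 1) * exp (- a * u)))"
    proof -
      have "exp (- s * u) * exp (- (1 / \<beta> - c\<^sup>2 / (\<beta>\<^sup>2 * b)) * u) = exp (- a * u)"
        by (simp flip: exp_add add: a_def algebra_simps)
      then have "exp (- s * u) * (indicator {0<..} u * (u powr \<delta> * exp (- (1 / \<beta> - c\<^sup>2 / (\<beta>\<^sup>2 * b)) * u)
        / ((\<beta> * b) powr (\<delta> + 1) * Gamma (\<delta> + 1)))) = C * (indicator {0<..} u * (u powr (\<delta> + 1 - 1) * exp (- a * u)))"
        unfolding C_def by (simp add: divide_inverse mult_ac)
      then show ?thesis using Cpos by (simp flip: ennreal_mult')
    qed
    finally show "(\<integral>\<^sup>+v. ennreal (kibble_density \<delta> c (u, v)) * ennreal (exp (- s * u - t * v)) \<partial>lborel)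
        = ennreal C * ennreal (indicator {0<..} u * (u powr (\<delta> + 1 - 1) * exp (- a * u)))" .
  qed
  also have "\<dots> = ennreal C * ennreal (Gamma (\<delta> + 1) * a powr (- (\<delta> + 1)))"
  proof -
    have "\<delta> + 1 > 0" using \<delta> by simp
    note gamma_integral = nn_integral_powr_exp[OF this apos]
    show ?thesis by (subst nn_integral_cmult) (simp_all only: gamma_integral, measurable)
  qed
  also have "\<dots> = ennreal (C * (Gamma (\<delta> + 1) * a powr (- (\<delta> + 1))))"
    using Cpos by (simp add: ennreal_mult')
  also have "C * (Gamma (\<delta> + 1) * a powr (- (\<delta> + 1))) = (\<beta> * b * a) powr (- (\<delta> + 1))"
  proof -
    have "(\<beta> * b * a) powr (- (\<delta> + 1)) = (\<beta> * b) powr (- (\<delta> + 1)) * a powr (- (\<delta> + 1))"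
      by (rule powr_mult)
    also have "(\<beta> * b) powr (- (\<delta> + 1)) = inverse ((\<beta> * b) powr (\<delta> + 1))"
      by (rule powr_minus)
    finally show ?thesis using Gamma_pos by (simp add: C_def del: minus_add_distrib)
  qed
  finally show ?thesis unfolding ab .
qed

lemma prob_space_kibble: "prob_space (kibble_measure \<delta> c)"
  by (rule prob_spaceI) (use nn_integral_kibble[of 0 0] in simp)

lemma AE_kibble_pos: "AE z in kibble_measure \<delta> c. fst z > 0 \<and> snd z > 0"
  unfolding kibble_measure_def
  by (subst AE_density) (auto intro!: AE_I2 simp: kibble_density_def indicator_def split: prod.splits if_splits)

lemma AE_kibble_neq: "AE z in kibble_measure \<delta> c. fst z \<noteq> x \<and> snd z \<noteq> y"
proof -
  have "{x} \<times> UNIV \<in> null_sets lborel2" "UNIV \<times> {y} \<in> null_sets lborel2"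
    for x y :: real
    by (auto simp: null_sets_def lborel.emeasure_pair_measure_Times)
  then have "AE z in lborel2. z \<notin> {x} \<times> UNIV \<and> z \<notin> UNIV \<times> {y}"
    by (intro AE_conjI AE_not_in)
  then have "AE z in lborel2. fst z \<noteq> x \<and> snd z \<noteq> y"
    by eventually_elim auto
  then show ?thesis unfolding kibble_measure_def by (subst AE_density) auto
qed

text \<open>The absolute values do not change anything almost surely; with them the two variables are nonnegative
  at every point of the plane, as the comparison of Laplace transforms with tails requires.\<close>

lemma laplace_kibble:
  assumes "s \<ge> 0" "t \<ge> 0"
  shows "(\<integral>z. exp (- s * (2 * \<bar>fst z\<bar>) - t * (2 * \<bar>snd z\<bar>)) \<partial>kibble_measure \<delta> c)
    = ((1 + 2 * s) * (1 + 2 * t) - 4 * c\<^sup>2 * s * t) powr (- (\<delta> + 1))"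
proof -
  have "(\<integral>\<^sup>+z. ennreal (exp (- s * (2 * \<bar>fst z\<bar>) - t * (2 * \<bar>snd z\<bar>))) \<partial>kibble_measure \<delta> c)
      = (\<integral>\<^sup>+z. ennreal (exp (- (2 * s) * fst z - (2 * t) * snd z)) \<partial>kibble_measure \<delta> c)"
    by (rule nn_integral_cong_AE) (use AE_kibble_pos in \<open>eventually_elim, simp\<close>)
  also have "\<dots> = ennreal ((1 + 2 * s + 2 * t + \<beta> * (2 * s) * (2 * t)) powr (- (\<delta> + 1)))"
    using assms by (intro nn_integral_kibble) auto
  also have "1 + 2 * s + 2 * t + \<beta> * (2 * s) * (2 * t) = (1 + 2 * s) * (1 + 2 * t) - 4 * c\<^sup>2 * s * t"
    by (simp add: \<beta>_def algebra_simps)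
  finally show ?thesis by (subst integral_eq_nn_integral) auto
qed

end

section \<open>Asymptotics of the modified Bessel function\<close>

lemma Gamma_plus_half: "Gamma (real k + 1 / 2) = fact (2 * k) * sqrt pi / (4 ^ k * fact k)"
proof (induction k)
  case 0 then show ?case by (simp add: Gamma_one_half_real)
next
  case (Suc k)
  have "real k + 1 / 2 \<notin> \<int>\<^sub>\<le>\<^sub>0" using nonpos_Ints_nonpos[of "real k + 1 / 2"] by auto
  then have "Gamma (real (Suc k) + 1 / 2) = (real k + 1 / 2) * Gamma (real k + 1 / 2)"
    using Gamma_plus1[of "real k + 1 / 2"] by (simp add: add_ac)
  also have "\<dots> = (real k + 1 / 2) * (fact (2 * k) * sqrt pi / (4 ^ k * fact k))" by (simp only: Suc)
  also have "\<dots> = fact (2 * Suc k) * sqrt pi / (4 ^ Suc k * fact (Suc k))"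
  proof -
    have "fact (2 * Suc k) = (2 * real k + 2) * ((2 * real k + 1) * fact (2 * k))"
      by (simp add: algebra_simps)
    then show ?thesis by (simp add: divide_simps) (simp add: algebra_simps)
  qed
  finally show ?case .
qed

text \<open>The substitution \<open>s = t\<^sup>2\<close> in Euler's Beta integral.\<close>

lemma nn_integral_even_power_beta:
  fixes \<delta> :: real
  assumes "\<delta> \<ge> 0"
  shows "(\<integral>\<^sup>+t. ennreal (indicator {0<..<1} t * (t ^ (2 * k) * (1 - t\<^sup>2) powr (\<delta> - 1 / 2))) \<partial>lborel)
       = ennreal (Gamma (real k + 1 / 2) * Gamma (\<delta> + 1 / 2) / (2 * Gamma (real k + \<delta> + 1)))"
proof -
  define f where "f s = s powr (real k + 1 / 2 - 1) * (1 - s) powr (\<delta> + 1 / 2 - 1)" for s :: real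
  let ?I = "\<integral>\<^sup>+t. ennreal (indicator {0<..<1} t * (t ^ (2 * k) * (1 - t\<^sup>2) powr (\<delta> - 1 / 2))) \<partial>lborel"
  have "(f has_integral Beta (real k + 1 / 2) (\<delta> + 1 / 2)) {0..1}"
    unfolding f_def using assms by (intro has_integral_Beta_real) auto
  from nn_integral_has_integral_lebesgue[OF _ this]
  have "ennreal (Beta (real k + 1 / 2) (\<delta> + 1 / 2)) = (\<integral>\<^sup>+s. ennreal (f s * indicator {0\<^sup>2..1\<^sup>2} s) \<partial>lborel)"
    by (simp add: f_def mult_ac ennreal_mult' ennreal_indicator)
  also have "\<dots> = (\<integral>\<^sup>+t. ennreal (f (t\<^sup>2) * (2 * t) * indicator {0..1} t) \<partial>lborel)"
    by (subst nn_integral_substitution[where g = "\<lambda>x. x ^ 2" and g' = "\<lambda>x. 2 * x"])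
      (auto intro!: derivative_eq_intros continuous_intros simp: set_borel_measurable_def f_def)
  also have "\<dots> = (\<integral>\<^sup>+t. 2 * ennreal (indicator {0<..<1} t * (t ^ (2 * k) * (1 - t\<^sup>2) powr (\<delta> - 1 / 2))) \<partial>lborel)"
  proof (rule nn_integral_cong_AE, use AE_lborel_singleton[of 0] AE_lborel_singleton[of 1] in eventually_elim)
    case (elim t)
    show ?case
    proof (cases "0 < t \<and> t < 1")
      case True
      have "(t\<^sup>2) powr (real k + 1 / 2 - 1) * (2 * t) = 2 * t ^ (2 * k)"
      proof -
        have "(t\<^sup>2) powr (real k + 1 / 2 - 1) = t powr (real (2 * k) - 1)"
          using True by (simp add: powr_powr flip: powr_numeral)
        also have "\<dots> * t = t powr (real (2 * k))" using True by (simp add: powr_diff)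
        also have "\<dots> = t ^ (2 * k)" using True by (rule powr_realpow[OF conjunct1])
        finally show ?thesis by simp
      qed
      then have "f (t\<^sup>2) * (2 * t) = 2 * (t ^ (2 * k) * (1 - t\<^sup>2) powr (\<delta> - 1 / 2))"
        unfolding f_def by (simp add: mult_ac)
      moreover have "indicator {0..1} t = (1 :: real)" "indicator {0<..<1} t = (1 :: real)"
        using True by auto
      ultimately show ?thesis
        by (simp only: mult_1_left mult_1_right) (simp add: ennreal_mult')
    next
      case False then show ?thesis using elim by (auto simp: indicator_def)
    qed
  qed
  also have "\<dots> = 2 * ?I" by (rule nn_integral_cmult) measurable
  finally have "ennreal (1 / 2) * ennreal (Beta (real k + 1 / 2) (\<delta> + 1 / 2)) = ennreal (1 / 2) * 2 * ?I"
    by (simp add: mult.assoc)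
  also have "ennreal (1 / 2) * 2 = 1" using ennreal_mult'[of "1 / 2" 2] by simp
  finally have "?I = ennreal (1 / 2) * ennreal (Beta (real k + 1 / 2) (\<delta> + 1 / 2))"
    by (simp only: mult_1_left)
  also have "\<dots> = ennreal (1 / 2 * Beta (real k + 1 / 2) (\<delta> + 1 / 2))"
    by (rule ennreal_mult'[symmetric]) simp
  also have "1 / 2 * Beta (real k + 1 / 2) (\<delta> + 1 / 2)
      = Gamma (real k + 1 / 2) * Gamma (\<delta> + 1 / 2) / (2 * Gamma (real k + \<delta> + 1))"
    by (simp add: Beta_def add_ac)
  finally show ?thesis .
qed

lemma measurable_cosh [measurable]: "(cosh :: real \<Rightarrow> real) \<in> borel_measurable borel"
  unfolding cosh_def by measurable

abbreviation poisson_kernel :: "real \<Rightarrow> real \<Rightarrow> real \<Rightarrow> real" where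
  "poisson_kernel \<delta> z t \<equiv>
     indicator {0<..<1} t * (cosh (z * t) * (1 - t\<^sup>2) powr (\<delta> - 1 / 2))"

text \<open>Poisson's integral for the modified Bessel function. Expand the hyperbolic cosine and integrate
  termwise; the resulting Beta integrals match the coefficients by the formula for the gamma function at
  half-integers.\<close>

lemma bessel_series_poisson_integral:
  assumes "\<delta> \<ge> 0"
  shows "(\<integral>t. poisson_kernel \<delta> z t \<partial>lborel)
       = sqrt pi * Gamma (\<delta> + 1 / 2) / 2 * bessel_series \<delta> (z\<^sup>2 / 4)"
proof -
  define f where "f k t = indicator {0<..<1} t * (t ^ (2 * k) * (1 - t\<^sup>2) powr (\<delta> - 1 / 2))" for k and t :: real
  define C where "C k = z ^ (2 * k) / fact (2 * k)" for k
  have C: "C k \<ge> 0" for k by (simp add: C_def power_mult)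
  have f: "f k t \<ge> 0" for k t by (simp add: f_def power_mult)
  have [measurable]: "f k \<in> borel_measurable borel" for k unfolding f_def by measurable
  have Gh: "Gamma (\<delta> + 1 / 2) > 0" using assms by (intro Gamma_real_pos) simp
  have expand: "ennreal (poisson_kernel \<delta> z t) = (\<Sum>k. ennreal (C k * f k t))" for t
  proof -
    define F where "F n = (if even n then (z * t) ^ n /\<^sub>R fact n else 0)" for n
    have "F sums cosh (z * t)" unfolding F_def by (rule cosh_converges)
    moreover have "(\<lambda>k. F (2 * k)) sums cosh (z * t) \<longleftrightarrow> F sums cosh (z * t)"
      by (rule sums_mono_reindex) (auto simp: strict_mono_def F_def dvd_def)
    ultimately have "(\<lambda>k. (z * t) ^ (2 * k) /\<^sub>R fact (2 * k)) sums cosh (z * t)" by (simp add: F_def)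
    then have "(\<lambda>k. indicator {0<..<1} t * (((z * t) ^ (2 * k) /\<^sub>R fact (2 * k)) * (1 - t\<^sup>2) powr (\<delta> - 1 / 2)))
        sums (poisson_kernel \<delta> z t)"
      by (rule sums_mult[OF sums_mult2])
    also have "(\<lambda>k. indicator {0<..<1} t * (((z * t) ^ (2 * k) /\<^sub>R fact (2 * k)) * (1 - t\<^sup>2) powr (\<delta> - 1 / 2)))
        = (\<lambda>k. C k * f k t)"
      by (intro ext) (simp only: C_def f_def power_mult_distrib divide_inverse real_scaleR_def mult_ac)
    finally have sums: "(\<lambda>k. C k * f k t) sums (poisson_kernel \<delta> z t)" .
    have "(\<Sum>k. ennreal (C k * f k t)) = ennreal (\<Sum>k. C k * f k t)"
      using C f sums_summable[OF sums] by (intro suminf_ennreal2 mult_nonneg_nonneg)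
    then show ?thesis using sums_unique[OF sums] by simp
  qed
  have coeff: "C k * (Gamma (real k + 1 / 2) * Gamma (\<delta> + 1 / 2) / (2 * Gamma (real k + \<delta> + 1)))
      = sqrt pi * Gamma (\<delta> + 1 / 2) / 2 * ((z\<^sup>2 / 4) ^ k / (fact k * Gamma (real k + \<delta> + 1)))" for k
    unfolding C_def Gamma_plus_half power_mult by (simp add: power_divide mult_ac)
  have "(\<integral>\<^sup>+t. ennreal (poisson_kernel \<delta> z t) \<partial>lborel)
      = (\<Sum>k. \<integral>\<^sup>+t. ennreal (C k * f k t) \<partial>lborel)"
    unfolding expand by (rule nn_integral_suminf) measurable
  also have "\<dots> = (\<Sum>k. ennreal (sqrt pi * Gamma (\<delta> + 1 / 2) / 2
      * ((z\<^sup>2 / 4) ^ k / (fact k * Gamma (real k + \<delta> + 1)))))"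
  proof (intro suminf_cong)
    fix k
    have "(\<integral>\<^sup>+t. ennreal (C k * f k t) \<partial>lborel) = ennreal (C k) * (\<integral>\<^sup>+t. ennreal (f k t) \<partial>lborel)"
      using C by (simp add: ennreal_mult' nn_integral_cmult)
    also have "\<dots> = ennreal (C k) * ennreal (Gamma (real k + 1 / 2)
        * Gamma (\<delta> + 1 / 2) / (2 * Gamma (real k + \<delta> + 1)))"
      unfolding f_def using nn_integral_even_power_beta[OF assms, of k] by (simp only:)
    also have "\<dots> = ennreal (sqrt pi * Gamma (\<delta> + 1 / 2) / 2 * ((z\<^sup>2 / 4) ^ k / (fact k * Gamma (real k + \<delta> + 1))))"
      using C by (simp only: coeff[symmetric] ennreal_mult')
    finally show "(\<integral>\<^sup>+t. ennreal (C k * f k t) \<partial>lborel)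
        = ennreal (sqrt pi * Gamma (\<delta> + 1 / 2) / 2 * ((z\<^sup>2 / 4) ^ k / (fact k * Gamma (real k + \<delta> + 1))))" .
  qed
  also have "\<dots> = ennreal (sqrt pi * Gamma (\<delta> + 1 / 2) / 2 * bessel_series \<delta> (z\<^sup>2 / 4))"
  proof -
    define b where "b k = sqrt pi * Gamma (\<delta> + 1 / 2) / 2 * ((z\<^sup>2 / 4) ^ k / (fact k * Gamma (real k + \<delta> + 1)))" for k
    have sums: "b sums (sqrt pi * Gamma (\<delta> + 1 / 2) / 2 * bessel_series \<delta> (z\<^sup>2 / 4))"
      unfolding bessel_series_def b_def by (intro sums_mult summable_sums summable_bessel_series assms)
    have "b k \<ge> 0" for k
      unfolding b_def using Gh assms by (intro mult_nonneg_nonneg divide_nonneg_nonneg) (auto intro!: less_imp_le[OF Gamma_real_pos])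
    then have "(\<Sum>k. ennreal (b k)) = ennreal (\<Sum>k. b k)"
      using sums_summable[OF sums] by (rule suminf_ennreal2)
    then show ?thesis unfolding sums_unique[OF sums] b_def .
  qed
  finally have nn: "(\<integral>\<^sup>+t. ennreal (poisson_kernel \<delta> z t) \<partial>lborel)
      = ennreal (sqrt pi * Gamma (\<delta> + 1 / 2) / 2 * bessel_series \<delta> (z\<^sup>2 / 4))" .
  have "sqrt pi * Gamma (\<delta> + 1 / 2) / 2 * bessel_series \<delta> (z\<^sup>2 / 4) \<ge> 0"
    using Gh assms bessel_series_nonneg by simp
  then show ?thesis
    by (subst integral_eq_nn_integral) (auto simp: nn cosh_real_nonneg intro!: mult_nonneg_nonneg)
qed

lemma integrable_powr_exp:
  fixes a b :: real
  assumes "a > 0" "b > 0"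
  shows "integrable lborel (\<lambda>u. gamma_kernel a b u)"
  using nn_integral_powr_exp[OF assms] by (intro integrableI_nonneg) (auto simp: less_top[symmetric])

lemma integral_powr_exp:
  fixes a b :: real
  assumes "a > 0" "b > 0"
  shows "(\<integral>u. gamma_kernel a b u \<partial>lborel) = Gamma a * b powr (- a)"
  using nn_integral_powr_exp[OF assms] Gamma_real_pos[OF assms(1)]
  by (subst integral_eq_nn_integral) auto

text \<open>Laplace's method for Poisson's integral. With \<open>t = 1 - v / z\<close> the mass concentrates at \<open>t = 1\<close>, where
  \<open>1 - t\<^sup>2 = (v / z) (2 - v / z)\<close>, and after rescaling the integrand is dominated by a gamma density.\<close>

lemma bessel_series_asymptotics:
  assumes "\<delta> \<ge> 0"
  shows "((\<lambda>z. exp (- z) * z powr (\<delta> + 1 / 2) * bessel_series \<delta> (z\<^sup>2 / 4)) \<longlongrightarrow> 2 powr (\<delta> - 1 / 2) / sqrt pi) at_top"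
proof -
  define \<epsilon> where "\<epsilon> = \<delta> - 1 / 2"
  define G where "G = Gamma (\<delta> + 1 / 2)"
  have G: "G > 0" unfolding G_def using assms by (intro Gamma_real_pos) simp
  define f where "f z v = indicator {0<..<z} v * (exp (- z) * cosh (z - v) * (v powr \<epsilon> * (2 - v / z) powr \<epsilon>))"
    for z v :: real
  define g where "g v = indicator {0<..} v * (1 / 2 * exp (- v) * (v powr \<epsilon> * 2 powr \<epsilon>))" for v :: real
  have eq: "sqrt pi * G / 2 * (exp (- z) * z powr (\<delta> + 1 / 2) * bessel_series \<delta> (z\<^sup>2 / 4)) = (\<integral>v. f z v \<partial>lborel)"
    if z: "z > 0" for z
  proof -
    have "sqrt pi * G / 2 * bessel_series \<delta> (z\<^sup>2 / 4)
        = (\<integral>t. indicator {0<..<1} t * (cosh (z * t) * (1 - t\<^sup>2) powr \<epsilon>) \<partial>lborel)"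
      unfolding G_def \<epsilon>_def by (rule bessel_series_poisson_integral[OF assms, symmetric])
    also have "\<dots> = \<bar>- (1 / z)\<bar> *\<^sub>R (\<integral>v. indicator {0<..<1} (1 + - (1 / z) * v) * (cosh (z * (1 + - (1 / z) * v))
        * (1 - (1 + - (1 / z) * v)\<^sup>2) powr \<epsilon>) \<partial>lborel)"
      using z by (intro lborel_integral_real_affine) auto
    finally have poisson: "sqrt pi * G / 2 * bessel_series \<delta> (z\<^sup>2 / 4)
        = \<bar>- (1 / z)\<bar> *\<^sub>R (\<integral>v. indicator {0<..<1} (1 + - (1 / z) * v) * (cosh (z * (1 + - (1 / z) * v))
        * (1 - (1 + - (1 / z) * v)\<^sup>2) powr \<epsilon>) \<partial>lborel)" .
    have "exp (- z) * z powr (\<delta> + 1 / 2) * (sqrt pi * G / 2 * bessel_series \<delta> (z\<^sup>2 / 4))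
       = (\<integral>v. exp (- z) * z powr \<epsilon> * (indicator {0<..<1} (1 + - (1 / z) * v) * (cosh (z * (1 + - (1 / z) * v))
        * (1 - (1 + - (1 / z) * v)\<^sup>2) powr \<epsilon>)) \<partial>lborel)"
    proof -
      have "z powr (\<delta> + 1 / 2) = z powr \<epsilon> * z"
      proof -
        have "\<delta> + 1 / 2 = \<epsilon> + 1" by (simp add: \<epsilon>_def)
        then show ?thesis using z by (simp only: powr_add) simp
      qed
      then show ?thesis using z
        by (simp only: integral_mult_right_zero poisson) simp
    qed
    also have "\<dots> = (\<integral>v. f z v \<partial>lborel)"
    proof (intro Bochner_Integration.integral_cong refl)
      fix v
      show "exp (- z) * z powr \<epsilon> * (indicator {0<..<1} (1 + - (1 / z) * v) * (cosh (z * (1 + - (1 / z) * v))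
        * (1 - (1 + - (1 / z) * v)\<^sup>2) powr \<epsilon>)) = f z v"
      proof (cases "0 < v \<and> v < z")
        case True
        have a: "z * (1 + - (1 / z) * v) = z - v" using z by (simp add: field_simps)
        have "1 - (1 + - (1 / z) * v)\<^sup>2 = (v / z) * (2 - v / z)" using z by (simp add: field_simps power2_eq_square)
        also have "\<dots> powr \<epsilon> = v powr \<epsilon> / z powr \<epsilon> * (2 - v / z) powr \<epsilon>"
          using True z by (simp only: powr_mult powr_divide)
        finally have b: "(1 - (1 + - (1 / z) * v)\<^sup>2) powr \<epsilon> = v powr \<epsilon> / z powr \<epsilon> * (2 - v / z) powr \<epsilon>" .
        have "1 + - (1 / z) * v \<in> {0<..<1}" using True z by (simp add: field_simps)
        moreover have "v \<in> {0<..<z}" using True by simp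
        moreover have "z powr \<epsilon> \<noteq> 0" using z by simp
        ultimately show ?thesis unfolding a b f_def by (simp only: indicator_simps) simp
      next
        case False
        then have "1 + - (1 / z) * v \<notin> {0<..<1}" using z by (auto simp: field_simps)
        then show ?thesis using False by (auto simp: f_def indicator_def)
      qed
    qed
    finally show ?thesis by (simp add: mult_ac)
  qed
  have cosh_scaled: "exp (- z) * cosh (z - v) = (exp (- v) + exp (v - 2 * z)) / 2" for z v :: real
  proof -
    have "exp (- z) * exp (z - v) = exp (- v)" "exp (- z) * exp (- (z - v)) = exp (v - 2 * z)"
      by (simp_all flip: exp_add)
    then show ?thesis by (simp add: cosh_def distrib_left)
  qed
  have "((\<lambda>z. \<integral>v. f z v \<partial>lborel) \<longlongrightarrow> (\<integral>v. g v \<partial>lborel)) at_top"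
  proof (rule integral_dominated_convergence_at_top[where
        w = "\<lambda>v. 2 powr (\<delta> + 1 / 2) * (indicator {0<..} v * (v powr (\<delta> + 1 / 2 - 1) * exp (- 1 * v)))"])
    show "g \<in> borel_measurable lborel" unfolding g_def by measurable
    show "f z \<in> borel_measurable lborel" for z unfolding f_def by measurable
    have "\<delta> + 1 / 2 > 0" using assms by simp
    from integrable_powr_exp[OF this, of 1]
    show "integrable lborel (\<lambda>v. 2 powr (\<delta> + 1 / 2)
        * (indicator {0<..} v * (v powr (\<delta> + 1 / 2 - 1) * exp (- 1 * v))))"
      by (intro integrable_mult_right) simp
    show "AE v in lborel. ((\<lambda>z. f z v) \<longlongrightarrow> g v) at_top"
    proof (intro AE_I2)
      fix v :: real
      show "((\<lambda>z. f z v) \<longlongrightarrow> g v) at_top"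
      proof (cases "v > 0")
        case False
        then have "f z v = 0" "g v = 0" for z by (auto simp: f_def g_def)
        then show ?thesis by simp
      next
        case True
        have l1: "((\<lambda>z. exp (- z) * cosh (z - v)) \<longlongrightarrow> 1 / 2 * exp (- v)) at_top"
        proof -
          have "((\<lambda>z. (exp (- v) + exp (v - 2 * z)) / 2) \<longlongrightarrow> (exp (- v) + 0) / 2) at_top"
            by real_asymp
          then show ?thesis unfolding cosh_scaled by simp
        qed
        have l2: "((\<lambda>z. (2 - v / z) powr \<epsilon>) \<longlongrightarrow> 2 powr \<epsilon>) at_top"
        proof -
          have "((\<lambda>z. 2 - v / z) \<longlongrightarrow> 2) at_top" by real_asymp
          then show ?thesis by (intro tendsto_powr tendsto_const) auto
        qed
        have "((\<lambda>z. exp (- z) * cosh (z - v) * (v powr \<epsilon> * (2 - v / z) powr \<epsilon>))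
            \<longlongrightarrow> 1 / 2 * exp (- v) * (v powr \<epsilon> * 2 powr \<epsilon>)) at_top"
          by (rule tendsto_mult[OF l1 tendsto_mult[OF tendsto_const l2]])
        then have "((\<lambda>z. exp (- z) * cosh (z - v) * (v powr \<epsilon> * (2 - v / z) powr \<epsilon>)) \<longlongrightarrow> g v) at_top"
          using True by (simp add: g_def)
        then show ?thesis
          by (rule Lim_transform_eventually)
            (use eventually_gt_at_top[of v] in eventually_elim, use True in \<open>simp add: f_def\<close>)
      qed
    qed
    show "\<forall>\<^sub>F z in at_top. AE v in lborel. norm (f z v)
        \<le> 2 powr (\<delta> + 1 / 2) * (indicator {0<..} v * (v powr (\<delta> + 1 / 2 - 1) * exp (- 1 * v)))"
    proof (intro always_eventually allI AE_I2)
      fix z v :: real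
      show "norm (f z v) \<le> 2 powr (\<delta> + 1 / 2) * (indicator {0<..} v * (v powr (\<delta> + 1 / 2 - 1) * exp (- 1 * v)))"
      proof (cases "0 < v \<and> v < z")
        case False then show ?thesis by (auto simp: f_def indicator_def)
      next
        case True
        have "exp (- z) * cosh (z - v) = (exp (- v) + exp (v - 2 * z)) / 2"
          by (rule cosh_scaled)
        also have "\<dots> \<le> exp (- v)" using True by simp
        finally have 1: "exp (- z) * cosh (z - v) \<le> exp (- v)" .
        \<comment> \<open>The exponent \<open>\<epsilon>\<close> is negative for \<open>\<delta> = 0\<close>, so it is first raised to the positive value \<open>\<delta> + 1 / 2\<close>.\<close>
        have r: "1 \<le> 2 - v / z" "2 - v / z \<le> 2" using True by simp_all
        have "(2 - v / z) powr \<epsilon> \<le> (2 - v / z) powr (\<delta> + 1 / 2)"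
          using r by (intro powr_mono) (auto simp: \<epsilon>_def)
        also have "\<dots> \<le> 2 powr (\<delta> + 1 / 2)" using r assms by (intro powr_mono2) auto
        finally have 2: "(2 - v / z) powr \<epsilon> \<le> 2 powr (\<delta> + 1 / 2)" .
        have "norm (f z v) = exp (- z) * cosh (z - v) * (v powr \<epsilon> * (2 - v / z) powr \<epsilon>)"
          using True by (simp add: f_def abs_mult cosh_real_nonneg)
        also have "\<dots> \<le> exp (- v) * (v powr \<epsilon> * 2 powr (\<delta> + 1 / 2))"
          by (rule mult_mono[OF 1 mult_left_mono[OF 2]]) simp_all
        finally show ?thesis using True by (simp add: \<epsilon>_def mult_ac)
      qed
    qed
  qed
  also have "(\<integral>v. g v \<partial>lborel) = 2 powr \<epsilon> / 2 * G"
  proof -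
    have "\<delta> + 1 / 2 > 0" using assms by simp
    from integral_powr_exp[OF this, of 1]
    have "(\<integral>u. indicator {0<..} u * (u powr \<epsilon> * exp (- 1 * u)) \<partial>lborel) = G"
      by (simp add: \<epsilon>_def G_def)
    moreover have "g v = 2 powr \<epsilon> / 2 * (indicator {0<..} v * (v powr \<epsilon> * exp (- 1 * v)))" for v
      by (simp add: g_def)
    ultimately show ?thesis by (simp only: integral_mult_right_zero)
  qed
  finally have "((\<lambda>z. \<integral>v. f z v \<partial>lborel) \<longlongrightarrow> 2 powr \<epsilon> / 2 * G) at_top" .
  then have "((\<lambda>z. sqrt pi * G / 2 * (exp (- z) * z powr (\<delta> + 1 / 2) * bessel_series \<delta> (z\<^sup>2 / 4)))
      \<longlongrightarrow> 2 powr \<epsilon> / 2 * G) at_top"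
    by (rule Lim_transform_eventually) (use eventually_gt_at_top[of 0] in eventually_elim, rule eq[symmetric])
  from tendsto_mult_left[OF this, of "2 / (sqrt pi * G)"]
  have "((\<lambda>z. 2 / (sqrt pi * G) * (sqrt pi * G / 2 * (exp (- z) * z powr (\<delta> + 1 / 2) * bessel_series \<delta> (z\<^sup>2 / 4))))
      \<longlongrightarrow> 2 / (sqrt pi * G) * (2 powr \<epsilon> / 2 * G)) at_top" .
  moreover have "2 / (sqrt pi * G) * (sqrt pi * G / 2 * x) = x" for x using G by simp
  moreover have "2 / (sqrt pi * G) * (2 powr \<epsilon> / 2 * G) = 2 powr (\<delta> - 1 / 2) / sqrt pi"
    using G by (simp add: \<epsilon>_def)
  ultimately show ?thesis by (simp only:)
qed

section \<open>Asymptotics of the joint tail and of the single tail\<close>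

context kibble begin

text \<open>The last factor tends to a constant by the asymptotics of the Bessel function. The exponent is written
  as a linear term minus a square: the linear term governs the decay, and the square vanishes in the limit at
  \<open>(x + a, x + b)\<close> when \<open>x\<close> tends to infinity.\<close>

lemma kibble_density_split:
  assumes "u > 0" "v > 0"
  shows "kibble_density \<delta> c (u, v)
    = (2 * c / \<beta>) powr (- (\<delta> + 1 / 2)) / (\<beta> powr (\<delta> + 1) * Gamma (\<delta> + 1))
      * (u * v) powr (\<delta> / 2 - 1 / 4)
      * exp (- (u + v) / (1 + c) - c / \<beta> * (sqrt u - sqrt v)\<^sup>2)
      * (exp (- (2 * c * sqrt (u * v) / \<beta>)) * (2 * c * sqrt (u * v) / \<beta>) powr (\<delta> + 1 / 2)
          * bessel_series \<delta> ((2 * c * sqrt (u * v) / \<beta>)\<^sup>2 / 4))"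
proof -
  define r where "r = sqrt (u * v)"
  define z where "z = 2 * c * r / \<beta>"
  have r: "r > 0" "r\<^sup>2 = u * v" using assms by (simp_all add: r_def)
  have z: "z > 0" using r c \<beta> by (simp add: z_def)
  have z4: "z\<^sup>2 / 4 = c\<^sup>2 * u * v / \<beta>\<^sup>2"
    using r by (simp add: z_def power_divide power_mult_distrib)
  have \<beta>_factor: "\<beta> = (1 - c) * (1 + c)" by (simp add: \<beta>_def power2_eq_square algebra_simps)
  have expo: "- (u + v) / (1 + c) - c / \<beta> * (sqrt u - sqrt v)\<^sup>2 = - (u + v) / \<beta> + z"
  proof -
    have "(sqrt u - sqrt v)\<^sup>2 = u + v - 2 * r"
      using assms by (simp add: power2_diff r_def real_sqrt_mult)
    moreover have "inverse (1 + c) = (1 - c) * inverse \<beta>"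
      by (subst \<beta>_factor) (use c in simp)
    ultimately show ?thesis unfolding z_def divide_inverse by (simp only:) (simp add: algebra_simps)
  qed
  have uv: "(u * v) powr \<delta> = (u * v) powr (\<delta> / 2 - 1 / 4) * r powr (\<delta> + 1 / 2)"
  proof -
    have "r powr (\<delta> + 1 / 2) = (u * v) powr (1 / 2 * (\<delta> + 1 / 2))"
      using assms by (simp only: r_def powr_half_sqrt[symmetric] mult_pos_pos less_imp_le powr_powr)
    also have "(u * v) powr (\<delta> / 2 - 1 / 4) * \<dots> = (u * v) powr \<delta>"
      by (simp only: powr_add[symmetric]) (simp add: field_simps)
    finally show ?thesis ..
  qed
  have zr: "(2 * c / \<beta>) powr (- (\<delta> + 1 / 2)) * z powr (\<delta> + 1 / 2) = r powr (\<delta> + 1 / 2)"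
  proof -
    have "z = 2 * c / \<beta> * r" by (simp add: z_def)
    then have "z powr (\<delta> + 1 / 2) = (2 * c / \<beta>) powr (\<delta> + 1 / 2) * r powr (\<delta> + 1 / 2)"
      by (simp only: powr_mult)
    moreover have "(2 * c / \<beta>) powr (- (\<delta> + 1 / 2)) = inverse ((2 * c / \<beta>) powr (\<delta> + 1 / 2))"
      by (rule powr_minus)
    moreover have "(2 * c / \<beta>) powr (\<delta> + 1 / 2) \<noteq> 0" using c \<beta> by simp
    ultimately show ?thesis by (simp only:) simp
  qed
  have "kibble_density \<delta> c (u, v) = (u * v) powr \<delta> * exp (- (u + v) / \<beta>) * bessel_series \<delta> (z\<^sup>2 / 4)
      / (\<beta> powr (\<delta> + 1) * Gamma (\<delta> + 1))"
    using assms unfolding kibble_density_def \<beta>_def[symmetric] z4 by simp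
  also have "exp (- (u + v) / \<beta>) = exp (- (u + v) / \<beta> + z) * exp (- z)" by (simp flip: exp_add)
  also have "(u * v) powr \<delta> = (u * v) powr (\<delta> / 2 - 1 / 4) * ((2 * c / \<beta>) powr (- (\<delta> + 1 / 2)) * z powr (\<delta> + 1 / 2))"
    unfolding uv zr ..
  finally show ?thesis
    unfolding expo[symmetric] r_def[symmetric] z_def[symmetric] by (simp only: divide_inverse mult_ac)
qed

end

lemma integrable_shifted_powr_exp:
  fixes a b :: real
  assumes "a > 0" "b > 0"
  shows "integrable lborel (\<lambda>u. indicator {0<..} u * ((1 + u) powr (a - 1) * exp (- b * u)))"
proof -
  have "integrable lborel (\<lambda>u. indicator {0<..} (1 + 1 * u) * ((1 + 1 * u) powr (a - 1) * exp (- b * (1 + 1 * u))))"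
    by (rule lborel_integrable_real_affine[OF integrable_powr_exp[OF assms]]) simp
  from integrable_mult_right[OF this, of "exp b"]
  have "integrable lborel (\<lambda>u. exp b
      * (indicator {0<..} (1 + 1 * u) * ((1 + 1 * u) powr (a - 1) * exp (- b * (1 + 1 * u)))))"
    by simp
  then show ?thesis
  proof (rule Bochner_Integration.integrable_bound)
    have "norm (indicator {0<..} u * ((1 + u) powr (a - 1) * exp (- b * u)))
      \<le> norm (exp b * (indicator {0<..} (1 + 1 * u) * ((1 + 1 * u) powr (a - 1) * exp (- b * (1 + 1 * u)))))" for u
    proof -
      have "exp b * exp (- b * (1 + 1 * u)) = exp (- b * u)" by (simp flip: exp_add add: algebra_simps)
      then have "exp b * (indicator {0<..} (1 + 1 * u) * ((1 + 1 * u) powr (a - 1) * exp (- b * (1 + 1 * u))))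
          = indicator {0<..} (1 + u) * ((1 + u) powr (a - 1) * exp (- b * u))"
        by (simp add: mult.left_commute mult.assoc[symmetric])
      then show ?thesis by (simp only:) (auto simp: indicator_def abs_mult)
    qed
    then show "AE u in lborel. norm (indicator {0<..} u * ((1 + u) powr (a - 1) * exp (- b * u)))
      \<le> norm (exp b * (indicator {0<..} (1 + 1 * u) * ((1 + 1 * u) powr (a - 1) * exp (- b * (1 + 1 * u)))))"
      by (rule AE_I2)
  qed measurable
qed

lemma integrable_product_lborel:
  fixes f g :: "real \<Rightarrow> real"
  assumes "integrable lborel f" "integrable lborel g"
  shows "integrable lborel2 (\<lambda>z. f (fst z) * g (snd z))"
    and "(\<integral>z. f (fst z) * g (snd z) \<partial>lborel2) = (\<integral>u. f u \<partial>lborel) * (\<integral>v. g v \<partial>lborel)"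
proof -
  have [measurable]: "f \<in> borel_measurable borel" "g \<in> borel_measurable borel" using assms by auto
  have "integrable lborel2 (\<lambda>(u, v). f u * g v)"
  proof (rule lborel_pair.Fubini_integrable)
    show "integrable lborel (\<lambda>u. \<integral>v. norm (case (u, v) of (u, v) \<Rightarrow> f u * g v) \<partial>lborel)"
      using assms by (simp add: abs_mult)
    show "AE u in lborel. integrable lborel (\<lambda>v. case (u, v) of (u, v) \<Rightarrow> f u * g v)"
      using assms by simp
  qed measurable
  then show int: "integrable lborel2 (\<lambda>z. f (fst z) * g (snd z))"
    by (simp only: case_prod_unfold)
  have "(\<integral>z. f (fst z) * g (snd z) \<partial>lborel2) = (\<integral>u. \<integral>v. f u * g v \<partial>lborel \<partial>lborel)"
    using lborel_pair.integral_fst'[OF int] by simp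
  then show "(\<integral>z. f (fst z) * g (snd z) \<partial>lborel2) = (\<integral>u. f u \<partial>lborel) * (\<integral>v. g v \<partial>lborel)"
    by simp
qed

context kibble begin

definition "joint_tail x = measure (kibble_measure \<delta> c) {z. fst z > x \<and> snd z > x}"

definition "single_tail x = measure (kibble_measure \<delta> c) {z. fst z > x}"

lemma joint_tail_eq:
  "joint_tail x = (\<integral>z. indicator {0<..} (fst z) * indicator {0<..} (snd z)
      * kibble_density \<delta> c (x + fst z, x + snd z) \<partial>lborel2)"
proof -
  let ?h = "\<lambda>z. indicator {z. fst z > x \<and> snd z > x} z * kibble_density \<delta> c z"
  have "{z \<in> space (borel \<Otimes>\<^sub>M borel). (fst z :: real) > x \<and> (snd z :: real) > x} \<in> sets (borel \<Otimes>\<^sub>M borel)"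
      by measurable
  then have S: "{z :: real \<times> real. fst z > x \<and> snd z > x} \<in> sets (borel \<Otimes>\<^sub>M borel)"
    by (simp add: space_pair_measure)
  have [measurable]: "?h \<in> borel_measurable (borel \<Otimes>\<^sub>M borel)"
    by (intro borel_measurable_times borel_measurable_indicator S measurable_kibble_density)
  have "emeasure (kibble_measure \<delta> c) {z. fst z > x \<and> snd z > x} = (\<integral>\<^sup>+z. ennreal (?h z) \<partial>lborel2)"
    unfolding kibble_measure_def using S
    by (subst emeasure_density) (auto intro!: nn_integral_cong simp: indicator_def)
  then have "joint_tail x = (\<integral>z. ?h z \<partial>lborel2)"
    unfolding joint_tail_def measure_def
    by (subst integral_eq_nn_integral) (auto simp: kibble_density_nonneg)
  also have "\<dots> = (\<integral>z. ?h z \<partial>(distr lborel borel ((+) (x, x))))"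
    by (simp only: lborel_distr_plus lborel_prod)
  also have "\<dots> = (\<integral>z. ?h ((x, x) + z) \<partial>lborel)"
  proof (rule integral_distr)
    show "?h \<in> borel_measurable borel"
      using \<open>?h \<in> borel_measurable (borel \<Otimes>\<^sub>M borel)\<close> by (simp only: borel_prod)
  qed simp
  also have "\<dots> = (\<integral>z. ?h ((x, x) + z) \<partial>lborel2)" by (simp only: lborel_prod)
  also have "\<dots> = (\<integral>z. indicator {0<..} (fst z) * indicator {0<..} (snd z)
      * kibble_density \<delta> c (x + fst z, x + snd z) \<partial>lborel2)"
    by (intro Bochner_Integration.integral_cong refl) (auto simp: indicator_def plus_prod_def)
  finally show ?thesis .
qed

text \<open>After moving the corner \<open>(x, x)\<close> of the quadrant to the origin and dividing by the claimed order of
  magnitude, the integrand converges to a multiple of \<open>exp (- (a + b) / (1 + c))\<close>. The splitting of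
  the density provides a dominating function with the same exponential factor.\<close>

lemma joint_tail_asymptotics:
  "((\<lambda>x. joint_tail x / (x powr (\<delta> - 1 / 2) * exp (- 2 * x / (1 + c))))
     \<longlongrightarrow> (1 + c)\<^sup>2 / (2 * c powr (\<delta> + 1 / 2) * sqrt \<beta> * Gamma (\<delta> + 1) * sqrt pi)) at_top"
proof -
  define D where "D = (2 * c / \<beta>) powr (- (\<delta> + 1 / 2)) / (\<beta> powr (\<delta> + 1) * Gamma (\<delta> + 1))"
  define E where "E = 2 powr (\<delta> - 1 / 2) / sqrt pi"
  define F where "F z = exp (- z) * z powr (\<delta> + 1 / 2) * bessel_series \<delta> (z\<^sup>2 / 4)" for z
  define \<eta> where "\<eta> = \<delta> / 2 - 1 / 4"
  have F: "(F \<longlongrightarrow> E) at_top" unfolding F_def E_def by (rule bessel_series_asymptotics[OF \<delta>])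
  have D: "D > 0" unfolding D_def using c \<beta> Gamma_pos by (intro divide_pos_pos mult_pos_pos) auto
  have E: "E > 0" by (simp add: E_def)
  have F_nonneg: "F z \<ge> 0" for z unfolding F_def by (intro mult_nonneg_nonneg bessel_series_nonneg \<delta>) auto
  \<comment> \<open>A bound for the Bessel factor that holds for large arguments only. It suffices because the argument is
    at least \<open>2 * c * x / \<beta>\<close> on the whole quadrant.\<close>
  obtain z0 where z0: "\<And>z. z \<ge> z0 \<Longrightarrow> F z \<le> E + 1"
    using order_tendstoD(2)[OF F, of "E + 1"] by (auto simp: eventually_at_top_linorder intro: less_imp_le)
  have [measurable]: "F \<in> borel_measurable borel" unfolding F_def by measurable
  define f where "f x z = indicator {0<..} (fst z) * indicator {0<..} (snd z)
      * (D * ((1 + fst z / x) * (1 + snd z / x)) powr \<eta>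
        * (exp (- fst z / (1 + c)) * exp (- snd z / (1 + c)) * exp (- (c / \<beta> * (sqrt (x + fst z) - sqrt (x
            + snd z))\<^sup>2)))
        * F (2 * c * sqrt ((x + fst z) * (x + snd z)) / \<beta>))" for x :: real and z :: "real \<times> real"
  define e where "e u = indicator {0<..} u * (u powr (1 - 1) * exp (- (1 / (1 + c)) * u))" for u :: real
  define w1 where "w1 u = indicator {0<..} u * ((1 + u) powr (\<delta> + 2 - 1) * exp (- (1 / (1 + c)) * u))" for u :: real
  have c1: "1 / (1 + c) > 0" using c by simp
  have scaled: "joint_tail x / (x powr (\<delta> - 1 / 2) * exp (- 2 * x / (1 + c))) = (\<integral>z. f x z \<partial>lborel2)"
    if x: "x > 0" for x
  proof -
    have "f x z = indicator {0<..} (fst z) * indicator {0<..} (snd z) * kibble_density \<delta> c (x + fst z, x + snd z)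
        / (x powr (\<delta> - 1 / 2) * exp (- 2 * x / (1 + c)))" for z
    proof (cases "fst z > 0 \<and> snd z > 0")
      case False then show ?thesis by (auto simp: f_def)
    next
      case True
      define u where "u = x + fst z"
      define v where "v = x + snd z"
      have uv: "u > 0" "v > 0" using True x by (auto simp: u_def v_def)
      have p: "(u * v) powr (\<delta> / 2 - 1 / 4) = x powr (\<delta> - 1 / 2) * ((1 + fst z / x) * (1 + snd z / x)) powr \<eta>"
      proof -
        have "u * v = x powr 2 * ((1 + fst z / x) * (1 + snd z / x))"
          using x by (simp add: u_def v_def field_simps power2_eq_square)
        then have "(u * v) powr \<eta> = (x powr 2) powr \<eta> * ((1 + fst z / x) * (1 + snd z / x)) powr \<eta>"
          by (simp only: powr_mult)
        also have "(x powr 2) powr \<eta> = x powr (\<delta> - 1 / 2)" by (simp add: powr_powr \<eta>_def)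
        finally show ?thesis by (simp add: \<eta>_def)
      qed
      have q: "exp (- (u + v) / (1 + c) - c / \<beta> * (sqrt u - sqrt v)\<^sup>2)
          = exp (- 2 * x / (1 + c)) * (exp (- fst z / (1 + c)) * exp (- snd z / (1 + c)) * exp (- (c / \<beta>
              * (sqrt u - sqrt v)\<^sup>2)))"
        unfolding exp_add[symmetric] u_def v_def divide_inverse
        by (intro arg_cong[where f = exp]) (simp add: algebra_simps)
      have "kibble_density \<delta> c (u, v) = D * (u * v) powr (\<delta> / 2 - 1 / 4)
          * exp (- (u + v) / (1 + c) - c / \<beta> * (sqrt u - sqrt v)\<^sup>2) * F (2 * c * sqrt (u * v) / \<beta>)"
        unfolding D_def F_def by (rule kibble_density_split[OF uv])
      also have "\<dots> = (x powr (\<delta> - 1 / 2) * exp (- 2 * x / (1 + c))) * (D * ((1 + fst z / x) * (1 + snd z / x)) powr \<eta>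
        * (exp (- fst z / (1 + c)) * exp (- snd z / (1 + c)) * exp (- (c / \<beta> * (sqrt u - sqrt v)\<^sup>2)))
        * F (2 * c * sqrt (u * v) / \<beta>))"
        unfolding p q by (simp only: mult_ac)
      finally show ?thesis using True x unfolding f_def u_def[symmetric] v_def[symmetric] by simp
    qed
    then have "(\<integral>z. f x z \<partial>lborel2)
        = (\<integral>z. indicator {0<..} (fst z) * indicator {0<..} (snd z) * kibble_density \<delta> c (x + fst z, x + snd z)
        / (x powr (\<delta> - 1 / 2) * exp (- 2 * x / (1 + c))) \<partial>lborel2)" by (simp only:)
    then show ?thesis unfolding joint_tail_eq by (simp only: integral_divide_zero)
  qed
  have "((\<lambda>x. \<integral>z. f x z \<partial>lborel2) \<longlongrightarrow> (\<integral>z. D * E * (e (fst z) * e (snd z)) \<partial>lborel2)) at_top"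
  proof (rule integral_dominated_convergence_at_top[where w = "\<lambda>z. D * (E + 1) * (w1 (fst z) * w1 (snd z))"])
    show "(\<lambda>z. D * E * (e (fst z) * e (snd z))) \<in> borel_measurable lborel2"
      unfolding e_def by measurable
    show "f x \<in> borel_measurable lborel2" for x unfolding f_def by measurable
    have "integrable lborel w1" unfolding w1_def
      by (rule integrable_shifted_powr_exp) (use \<delta> c1 in auto)
    then show "integrable lborel2 (\<lambda>z. D * (E + 1) * (w1 (fst z) * w1 (snd z)))"
      by (intro integrable_mult_right integrable_product_lborel)
    show "AE z in lborel2. ((\<lambda>x. f x z) \<longlongrightarrow> D * E * (e (fst z) * e (snd z))) at_top"
    proof (rule AE_I2)
      fix z :: "real \<times> real"
      define a where "a = fst z"
      define b where "b = snd z"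
      show "((\<lambda>x. f x z) \<longlongrightarrow> D * E * (e (fst z) * e (snd z))) at_top"
      proof (cases "a > 0 \<and> b > 0")
        case False
        then have zero: "f x z = 0" "e (fst z) * e (snd z) = 0" for x by (auto simp: f_def e_def a_def b_def)
        show ?thesis unfolding zero by simp
      next
        case True
        have t1: "((\<lambda>x. ((1 + a / x) * (1 + b / x)) powr \<eta>) \<longlongrightarrow> 1) at_top"
        proof -
          have "((\<lambda>x. (1 + a / x) * (1 + b / x)) \<longlongrightarrow> 1) at_top" by real_asymp
          then have "((\<lambda>x. ((1 + a / x) * (1 + b / x)) powr \<eta>) \<longlongrightarrow> 1 powr \<eta>) at_top"
            by (intro tendsto_powr tendsto_const) auto
          then show ?thesis by simp
        qed
        have t2: "((\<lambda>x. exp (- (c / \<beta> * (sqrt (x + a) - sqrt (x + b))\<^sup>2))) \<longlongrightarrow> 1) at_top"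
        proof -
          have "((\<lambda>x. sqrt (x + a) - sqrt (x + b)) \<longlongrightarrow> 0) at_top" by real_asymp
          then have "((\<lambda>x. exp (- (c / \<beta> * (sqrt (x + a) - sqrt (x + b))\<^sup>2))) \<longlongrightarrow> exp (- (c / \<beta> * 0\<^sup>2))) at_top"
            by (intro tendsto_intros)
          then show ?thesis by simp
        qed
        have t3: "((\<lambda>x. F (2 * c * sqrt ((x + a) * (x + b)) / \<beta>)) \<longlongrightarrow> E) at_top"
        proof (rule filterlim_compose[OF F])
          have "filterlim (\<lambda>x. sqrt ((x + a) * (x + b))) at_top at_top" by real_asymp
          then have "filterlim (\<lambda>x. (2 * c / \<beta>) * sqrt ((x + a) * (x + b))) at_top at_top"
            using c \<beta> by (intro filterlim_tendsto_pos_mult_at_top[OF tendsto_const]) auto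
          then show "filterlim (\<lambda>x. 2 * c * sqrt ((x + a) * (x + b)) / \<beta>) at_top at_top" by simp
        qed
        have lim: "((\<lambda>x. D * ((1 + a / x) * (1 + b / x)) powr \<eta>
            * (exp (- a / (1 + c)) * exp (- b / (1 + c)) * exp (- (c / \<beta> * (sqrt (x + a) - sqrt (x + b))\<^sup>2)))
            * F (2 * c * sqrt ((x + a) * (x + b)) / \<beta>)) \<longlongrightarrow> D * 1 * (exp (- a / (1 + c)) * exp (- b / (1 + c))
                * 1) * E) at_top"
          by (rule tendsto_mult[OF tendsto_mult[OF tendsto_mult_left[OF t1] tendsto_mult_left[OF t2]] t3])
        have limit_eq: "D * 1 * (exp (- a / (1 + c)) * exp (- b / (1 + c)) * 1) * E = D * E * (e (fst z) * e (snd z))"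
          using True by (simp add: e_def a_def b_def)
        have "f x z = D * ((1 + a / x) * (1 + b / x)) powr \<eta>
            * (exp (- a / (1 + c)) * exp (- b / (1 + c)) * exp (- (c / \<beta> * (sqrt (x + a) - sqrt (x + b))\<^sup>2)))
            * F (2 * c * sqrt ((x + a) * (x + b)) / \<beta>)" for x
          using True unfolding f_def a_def[symmetric] b_def[symmetric] by simp
        then show ?thesis using lim unfolding limit_eq by (simp only:)
      qed
    qed
    show "\<forall>\<^sub>F x in at_top. AE z in lborel2. norm (f x z) \<le> D * (E + 1) * (w1 (fst z) * w1 (snd z))"
      using eventually_ge_at_top[of "max 1 (z0 * \<beta> / (2 * c))"]
    proof eventually_elim
      case (elim x)
      then have x: "x \<ge> 1" "x \<ge> z0 * \<beta> / (2 * c)" by auto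
      show ?case
      proof (rule AE_I2)
        fix z :: "real \<times> real"
        define a where "a = fst z"
        define b where "b = snd z"
        show "norm (f x z) \<le> D * (E + 1) * (w1 (fst z) * w1 (snd z))"
        proof (cases "a > 0 \<and> b > 0")
          case False
          then have zero: "f x z = 0" "w1 (fst z) * w1 (snd z) = 0" by (auto simp: f_def w1_def a_def b_def)
          show ?thesis unfolding zero by simp
        next
          case True
          have base: "1 \<le> (1 + a / x) * (1 + b / x)" "(1 + a / x) * (1 + b / x) \<le> (1 + a) * (1 + b)"
          proof -
            have "1 * 1 \<le> (1 + a / x) * (1 + b / x)" using True x by (intro mult_mono) auto
            then show "1 \<le> (1 + a / x) * (1 + b / x)" by simp
            have "a / x \<le> a / 1" "b / x \<le> b / 1" using True x by (intro divide_left_mono; simp)+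
            then show "(1 + a / x) * (1 + b / x) \<le> (1 + a) * (1 + b)"
              using True x by (intro mult_mono) auto
          qed
          \<comment> \<open>The exponent \<open>\<eta>\<close> is negative for small \<open>\<delta>\<close>; since the base is at least \<open>1\<close> it may be raised to \<open>\<delta> + 1\<close>.\<close>
          have "((1 + a / x) * (1 + b / x)) powr \<eta> \<le> ((1 + a / x) * (1 + b / x)) powr (\<delta> + 1)"
            using base(1) \<delta> by (intro powr_mono) (auto simp: \<eta>_def)
          also have "\<dots> \<le> ((1 + a) * (1 + b)) powr (\<delta> + 1)"
            using base \<delta> by (intro powr_mono2) auto
          finally have b1: "((1 + a / x) * (1 + b / x)) powr \<eta> \<le> (1 + a) powr (\<delta> + 1) * (1 + b) powr (\<delta> + 1)"
            by (simp only: powr_mult)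
          have b2: "exp (- (c / \<beta> * (sqrt (x + a) - sqrt (x + b))\<^sup>2)) \<le> 1" using c \<beta> by simp
          have "z0 \<le> 2 * c * x / \<beta>" using x(2) c \<beta> by (simp add: field_simps)
          also have "\<dots> \<le> 2 * c * sqrt ((x + a) * (x + b)) / \<beta>"
          proof -
            have "x * x \<le> (x + a) * (x + b)" using True x by (intro mult_mono) auto
            then have "sqrt (x * x) \<le> sqrt ((x + a) * (x + b))" by (rule real_sqrt_le_mono)
            then have "x \<le> sqrt ((x + a) * (x + b))" using x by simp
            then show ?thesis using c \<beta> by (intro divide_right_mono mult_left_mono) auto
          qed
          finally have b3: "F (2 * c * sqrt ((x + a) * (x + b)) / \<beta>) \<le> E + 1" by (rule z0)
          have "norm (f x z) = D * ((1 + a / x) * (1 + b / x)) powr \<eta>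
            * (exp (- a / (1 + c)) * exp (- b / (1 + c)) * exp (- (c / \<beta> * (sqrt (x + a) - sqrt (x + b))\<^sup>2)))
            * F (2 * c * sqrt ((x + a) * (x + b)) / \<beta>)"
            using True D F_nonneg unfolding f_def a_def[symmetric] b_def[symmetric] by (simp add: abs_mult)
          also have "\<dots> \<le> D * ((1 + a) powr (\<delta> + 1) * (1 + b) powr (\<delta> + 1))
            * (exp (- a / (1 + c)) * exp (- b / (1 + c)) * 1) * (E + 1)"
            using D E F_nonneg
            by (intro mult_mono[OF mult_mono[OF mult_left_mono[OF b1] mult_left_mono[OF b2]] b3]) auto
          also have "\<dots> = D * (E + 1) * (w1 (fst z) * w1 (snd z))"
            using True unfolding w1_def a_def[symmetric] b_def[symmetric] by (simp add: add_ac mult_ac)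
          finally show ?thesis .
        qed
      qed
    qed
  qed
  also have "(\<integral>z. D * E * (e (fst z) * e (snd z)) \<partial>lborel2) = D * E * (1 + c)\<^sup>2"
  proof -
    have "integrable lborel e" unfolding e_def by (rule integrable_powr_exp) (use c1 in auto)
    moreover have "(\<integral>u. e u \<partial>lborel) = 1 + c"
    proof -
      have "(\<integral>u. e u \<partial>lborel) = Gamma 1 * (1 / (1 + c)) powr (- 1)"
        unfolding e_def by (rule integral_powr_exp) (use c1 in auto)
      then show ?thesis using c by (simp add: powr_minus powr_one)
    qed
    ultimately show ?thesis
      by (simp only: integral_mult_right_zero integrable_product_lborel(2)) (simp add: power2_eq_square)
  qed
  finally have lim: "((\<lambda>x. \<integral>z. f x z \<partial>lborel2) \<longlongrightarrow> D * E * (1 + c)\<^sup>2) at_top" .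
  have const: "D * E * (1 + c)\<^sup>2 = (1 + c)\<^sup>2 / (2 * c powr (\<delta> + 1 / 2) * sqrt \<beta> * Gamma (\<delta> + 1) * sqrt pi)"
  proof -
    have "(2 * c / \<beta>) powr (- (\<delta> + 1 / 2)) = inverse (2 powr (\<delta> + 1 / 2) * c powr (\<delta> + 1 / 2) / \<beta> powr (\<delta> + 1 / 2))"
      by (simp only: powr_minus powr_mult powr_divide)
    moreover have "2 powr (\<delta> + 1 / 2) = 2 * 2 powr (\<delta> - 1 / 2)"
    proof -
      have "\<delta> + 1 / 2 = 1 + (\<delta> - 1 / 2)" by simp
      then show ?thesis by (simp only: powr_add) simp
    qed
    moreover have "\<beta> powr (\<delta> + 1) = \<beta> powr (\<delta> + 1 / 2) * sqrt \<beta>"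
    proof -
      have "\<delta> + 1 = (\<delta> + 1 / 2) + 1 / 2" by simp
      then show ?thesis using \<beta> by (simp only: powr_add powr_half_sqrt less_imp_le)
    qed
    moreover have "\<beta> powr (\<delta> + 1 / 2) \<noteq> 0" "(2::real) powr (\<delta> - 1 / 2) \<noteq> 0" using \<beta> by auto
    ultimately show ?thesis unfolding D_def E_def by (simp only:) (simp add: divide_simps)
  qed
  show ?thesis
    unfolding const[symmetric]
    by (rule Lim_transform_eventually[OF lim])
      (use eventually_gt_at_top[of 0] in eventually_elim, rule scaled[symmetric])
qed

abbreviation "marginal_density u \<equiv> indicator {0<..} u * (u powr \<delta> * exp (- u) / Gamma (\<delta> + 1))"

text \<open>Both marginals of the Kibble distribution are gamma distributions with shape \<open>\<delta> + 1\<close>, which is the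
  limit law of \<open>X(n) / 2\<close>.\<close>

lemma emeasure_single_tail:
  assumes "S \<in> sets borel"
  shows "emeasure (kibble_measure \<delta> c) {z. fst z \<in> S}
    = (\<integral>\<^sup>+u. ennreal (indicator S u * (marginal_density u)) \<partial>lborel)"
proof -
  have S[measurable]: "{z :: real \<times> real. fst z \<in> S} \<in> sets (borel \<Otimes>\<^sub>M borel)"
    using assms measurable_sets[of fst "borel \<Otimes>\<^sub>M borel" borel S]
    by (simp add: vimage_def space_pair_measure)
  note assms[measurable]
  have "emeasure (kibble_measure \<delta> c) {z. fst z \<in> S}
      = (\<integral>\<^sup>+z. ennreal (indicator S (fst z)) * ennreal (kibble_density \<delta> c z) \<partial>lborel2)"
    unfolding kibble_measure_def using S
    by (subst emeasure_density) (auto intro!: nn_integral_cong simp: indicator_def)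
  also have "\<dots> = (\<integral>\<^sup>+u. \<integral>\<^sup>+v. ennreal (indicator S u) * ennreal (kibble_density \<delta> c (u, v)) \<partial>lborel \<partial>lborel)"
    by (subst lborel.nn_integral_fst[symmetric]) auto
  also have "\<dots> = (\<integral>\<^sup>+u. ennreal (indicator S u * (marginal_density u)) \<partial>lborel)"
  proof (intro nn_integral_cong)
    fix u
    have "(\<integral>\<^sup>+v. ennreal (kibble_density \<delta> c (u, v)) \<partial>lborel) = ennreal (marginal_density u)"
    proof -
      have "1 / \<beta> > 0" using \<beta> by simp
      note inner = nn_integral_kibble_density_snd[OF this, of u]
      have "\<beta>\<^sup>2 * (1 / \<beta>) = \<beta>" using \<beta> by (simp add: power2_eq_square)
      moreover have "1 / \<beta> - c\<^sup>2 / \<beta> = 1"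
        using \<beta> by (simp only: diff_divide_distrib[symmetric] \<beta>_def[symmetric]) simp
      moreover have "\<beta> * (1 / \<beta>) = 1" using \<beta> by simp
      ultimately show ?thesis using inner by (simp only:) simp
    qed
    then show "(\<integral>\<^sup>+v. ennreal (indicator S u) * ennreal (kibble_density \<delta> c (u, v)) \<partial>lborel)
        = ennreal (indicator S u * (marginal_density u))"
      by (subst nn_integral_cmult) (simp_all only: ennreal_mult'[OF indicator_pos_le], measurable)
  qed
  finally show ?thesis .
qed

lemma single_tail_strict_antimono:
  assumes "0 \<le> x" "x < y" shows "single_tail y < single_tail x"
proof -
  interpret K: prob_space "kibble_measure \<delta> c" by (rule prob_space_kibble)
  have "{z \<in> space (borel \<Otimes>\<^sub>M borel :: (real \<times> real) measure). fst z > r} \<in> sets (borel \<Otimes>\<^sub>M borel)"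
    "{z \<in> space (borel \<Otimes>\<^sub>M borel :: (real \<times> real) measure). x < fst z \<and> fst z \<le> y} \<in> sets (borel \<Otimes>\<^sub>M borel)" for r
    by measurable
  then have S: "{z :: real \<times> real. fst z > r} \<in> K.events" "{z :: real \<times> real. fst z \<in> {x<..y}} \<in> K.events" for r
    by (simp_all add: space_pair_measure sets_kibble_measure)
  have "single_tail x = measure (kibble_measure \<delta> c) ({z. fst z \<in> {x<..y}} \<union> {z. fst z > y})"
    unfolding single_tail_def using assms by (intro arg_cong[where f = "measure _"]) auto
  also have "\<dots> = measure (kibble_measure \<delta> c) {z. fst z \<in> {x<..y}} + single_tail y"
    unfolding single_tail_def using S by (intro K.finite_measure_Union) auto
  finally have eq: "single_tail x = measure (kibble_measure \<delta> c) {z. fst z \<in> {x<..y}} + single_tail y" .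
  have "measure (kibble_measure \<delta> c) {z. fst z \<in> {x<..y}} \<noteq> 0"
  proof
    assume "measure (kibble_measure \<delta> c) {z. fst z \<in> {x<..y}} = 0"
    then have "(\<integral>\<^sup>+u. ennreal (indicator {x<..y} u * (marginal_density u)) \<partial>lborel) = 0"
      by (subst emeasure_single_tail[symmetric]) (auto simp: K.emeasure_eq_measure)
    then have "AE u in lborel. ennreal (indicator {x<..y} u * (marginal_density u)) = 0"
      by (subst (asm) nn_integral_0_iff_AE) auto
    then have "AE u in lborel. u \<notin> {x<..y}"
    proof eventually_elim
      case (elim u)
      show ?case
      proof
        assume u: "u \<in> {x<..y}"
        then have "u > 0" using assms by simp
        then have "u powr \<delta> * exp (- u) / Gamma (\<delta> + 1) > 0" using Gamma_pos by simp
        moreover have "ennreal (u powr \<delta> * exp (- u) / Gamma (\<delta> + 1)) = 0"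
          using elim u \<open>u > 0\<close> by simp
        ultimately show False by (simp only: ennreal_eq_0_iff)
      qed
    qed
    then have "{x<..y} \<in> null_sets lborel" by (subst (asm) AE_iff_null_sets[symmetric]) auto
    then show False using assms by (auto simp: null_sets_def)
  qed
  then have "measure (kibble_measure \<delta> c) {z. fst z \<in> {x<..y}} > 0"
      using measure_nonneg[of "kibble_measure \<delta> c"] by (simp add: less_le)
  then show ?thesis using eq by simp
qed

lemma single_tail_asymptotics:
  "((\<lambda>x. single_tail x / (x powr \<delta> * exp (- x))) \<longlongrightarrow> 1 / Gamma (\<delta> + 1)) at_top"
proof -
  define f where "f x a = indicator {0<..} a * ((1 + a / x) powr \<delta> * exp (- 1 * a) / Gamma (\<delta> + 1))" for x a :: real
  define e where "e u = indicator {0<..} u * (u powr (1 - 1) * exp (- 1 * u))" for u :: real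
  have scaled: "single_tail x / (x powr \<delta> * exp (- x)) = (\<integral>a. f x a \<partial>lborel)" if x: "x > 0" for x
  proof -
    let ?h = "\<lambda>u. indicator {x<..} u * (marginal_density u)"
    have "single_tail x = enn2real (\<integral>\<^sup>+u. ennreal (?h u) \<partial>lborel)"
      unfolding single_tail_def measure_def using emeasure_single_tail[of "{x<..}"] by simp
    also have "\<dots> = (\<integral>u. ?h u \<partial>lborel)"
      using Gamma_pos by (subst integral_eq_nn_integral) auto
    also have "\<dots> = \<bar>1\<bar> *\<^sub>R (\<integral>a. ?h (x + 1 * a) \<partial>lborel)" by (rule lborel_integral_real_affine) simp
    also have "\<dots> = (\<integral>a. (x powr \<delta> * exp (- x)) * f x a \<partial>lborel)"
    proof -
      have "?h (x + 1 * a) = (x powr \<delta> * exp (- x)) * f x a" for a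
      proof (cases "a > 0")
        case False then show ?thesis by (simp add: f_def)
      next
        case True
        have "x + a = x * (1 + a / x)" using x by (simp add: field_simps)
        then have "(x + a) powr \<delta> = x powr \<delta> * (1 + a / x) powr \<delta>" by (simp only: powr_mult)
        moreover have "exp (- (x + a)) = exp (- x) * exp (- a)" by (simp flip: exp_add)
        ultimately show ?thesis using True x by (simp add: f_def)
      qed
      then show ?thesis by (simp only: abs_one scaleR_one)
    qed
    also have "\<dots> = (x powr \<delta> * exp (- x)) * (\<integral>a. f x a \<partial>lborel)" by (rule integral_mult_right_zero)
    finally show ?thesis using x by simp
  qed
  have "((\<lambda>x. \<integral>a. f x a \<partial>lborel) \<longlongrightarrow> (\<integral>a. 1 / Gamma (\<delta> + 1) * e a \<partial>lborel)) at_top"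
  proof (rule integral_dominated_convergence_at_top[where
        w = "\<lambda>a. 1 / Gamma (\<delta> + 1) * (indicator {0<..} a * ((1 + a) powr (\<delta> + 1 - 1) * exp (- 1 * a)))"])
    show "(\<lambda>a. 1 / Gamma (\<delta> + 1) * e a) \<in> borel_measurable lborel" unfolding e_def by measurable
    show "f x \<in> borel_measurable lborel" for x unfolding f_def by measurable
    show "integrable lborel (\<lambda>a. 1 / Gamma (\<delta> + 1)
        * (indicator {0<..} a * ((1 + a) powr (\<delta> + 1 - 1) * exp (- 1 * a))))"
      by (intro integrable_mult_right integrable_shifted_powr_exp) (use \<delta> in auto)
    show "AE a in lborel. ((\<lambda>x. f x a) \<longlongrightarrow> 1 / Gamma (\<delta> + 1) * e a) at_top"
    proof (rule AE_I2)
      fix a :: real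
      show "((\<lambda>x. f x a) \<longlongrightarrow> 1 / Gamma (\<delta> + 1) * e a) at_top"
      proof (cases "a > 0")
        case False then show ?thesis by (simp add: f_def e_def)
      next
        case True
        have "((\<lambda>x. 1 + a / x) \<longlongrightarrow> 1) at_top" by real_asymp
        then have "((\<lambda>x. (1 + a / x) powr \<delta> * (exp (- a) / Gamma (\<delta> + 1)))
            \<longlongrightarrow> 1 powr \<delta> * (exp (- a) / Gamma (\<delta> + 1))) at_top"
          by (intro tendsto_mult tendsto_powr tendsto_const) auto
        then show ?thesis using True by (simp add: f_def e_def)
      qed
    qed
    show "\<forall>\<^sub>F x in at_top. AE a in lborel. norm (f x a)
        \<le> 1 / Gamma (\<delta> + 1) * (indicator {0<..} a * ((1 + a) powr (\<delta> + 1 - 1) * exp (- 1 * a)))"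
      using eventually_ge_at_top[of 1]
    proof eventually_elim
      case (elim x)
      show ?case
      proof (rule AE_I2)
        fix a :: real
        show "norm (f x a) \<le> 1 / Gamma (\<delta> + 1) * (indicator {0<..} a * ((1 + a) powr (\<delta> + 1 - 1) * exp (- 1 * a)))"
        proof (cases "a > 0")
          case False then show ?thesis by (simp add: f_def)
        next
          case True
          have "a / x \<le> a / 1" using True elim by (intro divide_left_mono) auto
          then have "(1 + a / x) powr \<delta> \<le> (1 + a) powr \<delta>"
            using True elim \<delta> by (intro powr_mono2) auto
          then show ?thesis using True Gamma_pos by (simp add: f_def abs_mult divide_right_mono)
        qed
      qed
    qed
  qed
  also have "(\<integral>a. 1 / Gamma (\<delta> + 1) * e a \<partial>lborel) = 1 / Gamma (\<delta> + 1)"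
  proof -
    have "(\<integral>a. e a \<partial>lborel) = Gamma 1 * 1 powr (- 1)"
      unfolding e_def by (rule integral_powr_exp) auto
    then show ?thesis by (simp only: integral_mult_right_zero) simp
  qed
  finally have lim: "((\<lambda>x. \<integral>a. f x a \<partial>lborel) \<longlongrightarrow> 1 / Gamma (\<delta> + 1)) at_top" .
  show ?thesis
    by (rule Lim_transform_eventually[OF lim])
      (use eventually_gt_at_top[of 0] in eventually_elim, rule scaled[symmetric])
qed

end

section \<open>The joint tail in terms of the single tail\<close>

context kibble begin

text \<open>Let \<open>r1\<close>, \<open>r2\<close> and \<open>r3\<close> be the quotients of the single tail, of its negative logarithm and of the
  joint tail by their asymptotic orders. In the ratio all powers of \<open>x\<close> and all exponentials cancel,
  so that it equals a product of powers of \<open>r1\<close>, \<open>r2\<close> and \<open>r3\<close>, up to a constant, and it is enough to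
  compare constants.\<close>

lemma joint_tail_single_tail_ratio:
  "((\<lambda>x. joint_tail x /
      (\<beta> powr (3 / 2) * Gamma (\<delta> + 1) powr ((1 - c) / (1 + c))
          / (2 * c powr (\<delta> + 1 / 2) * sqrt pi * (1 - c)\<^sup>2)
        * (- ln (single_tail x)) powr (\<delta> - 1 / 2 - 2 * \<delta> / (1 + c))
        * single_tail x powr (2 / (1 + c)))) \<longlongrightarrow> 1) at_top"
proof -
  define G where "G = Gamma (\<delta> + 1)"
  define \<rho> where "\<rho> = 2 / (1 + c)"
  define q where "q = \<delta> - 1 / 2 - 2 * \<delta> / (1 + c)"
  define A where "A = (1 + c)\<^sup>2 / (2 * c powr (\<delta> + 1 / 2) * sqrt \<beta> * G * sqrt pi)"
  define C where "C = \<beta> powr (3 / 2) * G powr ((1 - c) / (1 + c)) / (2 * c powr (\<delta> + 1 / 2) * sqrt pi * (1 - c)\<^sup>2)"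
  define r1 where "r1 x = single_tail x / (x powr \<delta> * exp (- x))" for x
  define r2 where "r2 x = - ln (single_tail x) / x" for x
  define r3 where "r3 x = joint_tail x / (x powr (\<delta> - 1 / 2) * exp (- 2 * x / (1 + c)))" for x
  have G: "G > 0" unfolding G_def by (rule Gamma_pos)
  have r1: "(r1 \<longlongrightarrow> 1 / G) at_top" unfolding r1_def G_def by (rule single_tail_asymptotics)
  have r3: "(r3 \<longlongrightarrow> A) at_top" unfolding r3_def A_def G_def by (rule joint_tail_asymptotics)
  have ev: "\<forall>\<^sub>F x in at_top. x > 0 \<and> r1 x > 0"
    using eventually_conj[OF eventually_gt_at_top[of 0] order_tendstoD(1)[OF r1, of 0]] G by simp
  have T: "single_tail x = r1 x * (x powr \<delta> * exp (- x))" if "x > 0" for x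
    using that by (simp add: r1_def)
  have J: "joint_tail x = r3 x * (x powr (\<delta> - 1 / 2) * exp (- 2 * x / (1 + c)))" if "x > 0" for x
    using that by (simp add: r3_def)
  have lnT: "r2 x = - ln (r1 x) * (1 / x) - \<delta> * (ln x / x) + 1" if "x > 0" "r1 x > 0" for x
    unfolding r2_def T[OF that(1)] using that by (simp add: ln_mult ln_powr field_simps)
  have r2: "(r2 \<longlongrightarrow> 1) at_top"
  proof -
    have "((\<lambda>x. - ln (r1 x) * (1 / x) - \<delta> * (ln x / x) + 1) \<longlongrightarrow> - ln (1 / G) * 0 - \<delta> * 0 + 1) at_top"
    proof (intro tendsto_intros r1)
      show "1 / G \<noteq> 0" using G by simp
      show "((\<lambda>x :: real. 1 / x) \<longlongrightarrow> 0) at_top" by real_asymp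
      show "((\<lambda>x :: real. ln x / x) \<longlongrightarrow> 0) at_top" by real_asymp
    qed
    then have "((\<lambda>x. - ln (r1 x) * (1 / x) - \<delta> * (ln x / x) + 1) \<longlongrightarrow> 1) at_top" by simp
    then show ?thesis
      by (rule Lim_transform_eventually) (use ev in eventually_elim, simp add: lnT)
  qed
  have "((\<lambda>x. r3 x / (C * r2 x powr q * r1 x powr \<rho>)) \<longlongrightarrow> A / (C * 1 powr q * (1 / G) powr \<rho>)) at_top"
    using G c \<beta> by (intro tendsto_intros r1 r2 r3) (auto simp: C_def)
  also have "A / (C * 1 powr q * (1 / G) powr \<rho>) = 1"
  proof -
    have e1: "G powr ((1 - c) / (1 + c)) * (1 / G) powr \<rho> = 1 / G"
    proof -
      have "(1 / G) powr \<rho> = G powr (- \<rho>)" using G by (simp add: powr_divide powr_minus_divide)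
      moreover have "(1 - c) / (1 + c) + - \<rho> = - 1"
        unfolding \<rho>_def minus_divide_left add_divide_distrib[symmetric] using c by (simp add: divide_eq_eq)
      ultimately show ?thesis using G by (simp only: powr_add[symmetric]) (simp add: powr_minus_divide)
    qed
    have e2: "\<beta> powr (3 / 2) = (1 - c)\<^sup>2 * (1 + c)\<^sup>2 / sqrt \<beta>"
    proof -
      have "\<beta> powr (3 / 2) * \<beta> powr (1 / 2) = \<beta>\<^sup>2"
        using \<beta> by (simp flip: powr_add)
      then have "\<beta> powr (3 / 2) * sqrt \<beta> = \<beta>\<^sup>2" using \<beta> by (simp add: powr_half_sqrt)
      also have "\<beta>\<^sup>2 = ((1 - c) * (1 + c))\<^sup>2" by (simp add: \<beta>_def power2_eq_square algebra_simps)
      finally show ?thesis using \<beta> by (simp add: power_mult_distrib eq_divide_eq)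
    qed
    have e3: "C * 1 powr q * (1 / G) powr \<rho>
        = \<beta> powr (3 / 2) * (G powr ((1 - c) / (1 + c)) * (1 / G) powr \<rho>) / (2 * c powr (\<delta> + 1 / 2) * sqrt pi
            * (1 - c)\<^sup>2)"
      by (simp add: C_def)
    have "(1 - c)\<^sup>2 \<noteq> 0" using c by simp
    then have "C * 1 powr q * (1 / G) powr \<rho> = A"
      unfolding e3 e1 e2 A_def by (simp add: mult_ac)
    moreover have "A \<noteq> 0" unfolding A_def using G \<beta> c by simp
    ultimately show ?thesis by simp
  qed
  finally have lim: "((\<lambda>x. r3 x / (C * r2 x powr q * r1 x powr \<rho>)) \<longlongrightarrow> 1) at_top" .
  have ev2: "\<forall>\<^sub>F x in at_top. r2 x > 0" using order_tendstoD(1)[OF r2, of 0] by simp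
  show ?thesis
    unfolding G_def[symmetric] C_def[symmetric] q_def[symmetric] \<rho>_def[symmetric]
  proof (rule Lim_transform_eventually[OF lim])
    show "\<forall>\<^sub>F x in at_top. r3 x / (C * r2 x powr q * r1 x powr \<rho>)
        = joint_tail x / (C * (- ln (single_tail x)) powr q * single_tail x powr \<rho>)"
      using ev ev2
    proof eventually_elim
      case (elim x)
      then have x: "x > 0" "r1 x > 0" "r2 x > 0" by auto
      have "- ln (single_tail x) = r2 x * x" using x by (simp add: r2_def)
      then have a: "(- ln (single_tail x)) powr q = r2 x powr q * x powr q" by (simp only: powr_mult)
      have b: "single_tail x powr \<rho> = r1 x powr \<rho> * (x powr (\<delta> * \<rho>) * exp (- 2 * x / (1 + c)))"
      proof -
        have "exp (- x) powr \<rho> = exp (- 2 * x / (1 + c))" by (simp add: exp_powr_real \<rho>_def)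
        then show ?thesis unfolding T[OF x(1)] by (simp only: powr_mult powr_powr)
      qed
      have "\<delta> - 1 / 2 = q + \<delta> * \<rho>" by (simp add: q_def \<rho>_def)
      then have e: "x powr (\<delta> - 1 / 2) = x powr q * x powr (\<delta> * \<rho>)" by (simp only: powr_add)
      show ?case unfolding J[OF x(1)] a b e using x by simp
    qed
  qed
qed

end

locale pearson_pair = pearson_trials + kibble "(real N - 3) / 2" c for c
begin

abbreviation "\<kappa> \<equiv> kibble_measure ((real N - 3) / 2) c"

text \<open>The limiting Laplace transform of the two statistics is that of the doubled coordinates of the Kibble
  distribution, because \<open>\<delta> + 1 = (N - 1) / 2\<close>.\<close>

lemma joint_tail_probability_tendsto:
  "((\<lambda>i. \<P>(\<omega> in M. pearson N p Y (fst i) \<omega> > x \<and> pearson N p Y (snd i) \<omega> > y))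
     \<longlongrightarrow> measure \<kappa> {z. fst z > x / 2 \<and> snd z > y / 2}) (sample_sizes (c\<^sup>2))"
proof -
  interpret K: prob_space \<kappa> by (rule prob_space_kibble)
  have [simp]: "space \<kappa> = UNIV" by (simp add: kibble_measure_def space_pair_measure)
  have "- real (N - 1) / 2 = - ((real N - 3) / 2 + 1)" using N_ge by (simp add: field_simps)
  then have exponent: "r powr (- real (N - 1) / 2) = r powr (- ((real N - 3) / 2 + 1))" for r by (simp only:)
  have "((\<lambda>i. \<P>(\<omega> in M. pearson N p Y (fst i) \<omega> > x \<and> pearson N p Y (snd i) \<omega> > y))
     \<longlongrightarrow> \<P>(z in \<kappa>. 2 * \<bar>fst z\<bar> > x \<and> 2 * \<bar>snd z\<bar> > y)) (sample_sizes (c\<^sup>2))"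
  proof (rule laplace_determines_joint_tail)
    show "prob_space M" by (rule prob_space_axioms)
    show "prob_space \<kappa>" by (rule prob_space_kibble)
    show "((\<lambda>i. expectation (\<lambda>\<omega>. exp (- real j * pearson N p Y (fst i) \<omega> - real l * pearson N p Y (snd i) \<omega>)))
        \<longlongrightarrow> (\<integral>z. exp (- real j * (2 * \<bar>fst z\<bar>) - real l * (2 * \<bar>snd z\<bar>)) \<partial>\<kappa>)) (sample_sizes (c\<^sup>2))" for j l
      unfolding laplace_kibble[OF of_nat_0_le_iff of_nat_0_le_iff] exponent[symmetric]
      by (rule tendsto_sample_sizesI) (simp only: fst_conv snd_conv, rule joint_laplace_tendsto; (assumption | rule c of_nat_0_le_iff))
    show "AE z in \<kappa>. 2 * \<bar>fst z\<bar> \<noteq> x"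
      using AE_kibble_pos AE_kibble_neq[of "x / 2" 0] by eventually_elim auto
    show "AE z in \<kappa>. 2 * \<bar>snd z\<bar> \<noteq> y"
      using AE_kibble_pos AE_kibble_neq[of 0 "y / 2"] by eventually_elim auto
  qed (auto simp: pearson_nonneg)
  also have "\<P>(z in \<kappa>. 2 * \<bar>fst z\<bar> > x \<and> 2 * \<bar>snd z\<bar> > y) = measure \<kappa> {z. fst z > x / 2 \<and> snd z > y / 2}"
  proof (rule K.finite_measure_eq_AE)
    show "AE z in \<kappa>. (z \<in> {z \<in> space \<kappa>. 2 * \<bar>fst z\<bar> > x \<and> 2 * \<bar>snd z\<bar> > y})
        = (z \<in> {z. fst z > x / 2 \<and> snd z > y / 2})"
      using AE_kibble_pos by eventually_elim auto
    show "{z \<in> space \<kappa>. 2 * \<bar>fst z\<bar> > x \<and> 2 * \<bar>snd z\<bar> > y} \<in> sets \<kappa>" by measurable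
    have "{z \<in> space \<kappa>. fst z > x / 2 \<and> snd z > y / 2} \<in> sets \<kappa>" by measurable
    then show "{z. fst z > x / 2 \<and> snd z > y / 2} \<in> sets \<kappa>" by simp
  qed
  finally show ?thesis .
qed

lemma limit_joint_tail_eq:
  "limit_joint_tail M N p Y c x y = measure \<kappa> {z. fst z > x / 2 \<and> snd z > y / 2}"
  unfolding limit_joint_tail_def case_prod_beta
  by (rule tendsto_Lim[OF sample_sizes_neq_bot joint_tail_probability_tendsto]) (rule c)

text \<open>A single tail is a joint tail with a negative second threshold, which is exceeded by every value of the
  statistic.\<close>

lemma limit_tail_eq: "limit_tail M N p Y x = single_tail (x / 2)"
proof -
  interpret K: prob_space \<kappa> by (rule prob_space_kibble)
  have "filterlim (\<lambda>i. (i, nat \<lceil>real i / c\<^sup>2\<rceil>)) (sample_sizes (c\<^sup>2)) sequentially"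
    by (rule filterlim_sample_sizes[OF filterlim_ident second_sample_size_for]) (rule c)+
  from filterlim_compose[OF joint_tail_probability_tendsto[of x "-1"] this]
  have "(\<lambda>n. \<P>(\<omega> in M. pearson N p Y n \<omega> > x)) \<longlonglongrightarrow> measure \<kappa> {z. fst z > x / 2 \<and> snd z > - 1 / 2}"
    using less_le_trans[OF _ pearson_nonneg, of "-1"] by simp
  moreover have "measure \<kappa> {z. fst z > x / 2 \<and> snd z > - 1 / 2} = measure \<kappa> {z. fst z > x / 2}"
  proof (rule K.finite_measure_eq_AE)
    show "AE z in \<kappa>. (z \<in> {z. fst z > x / 2 \<and> snd z > - 1 / 2}) = (z \<in> {z. fst z > x / 2})"
      using AE_kibble_pos by eventually_elim auto
    have "{z \<in> space \<kappa>. fst z > x / 2 \<and> snd z > - 1 / 2} \<in> sets \<kappa>" "{z \<in> space \<kappa>. fst z > x / 2} \<in> sets \<kappa>"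
        by measurable
    then show "{z. fst z > x / 2 \<and> snd z > - 1 / 2} \<in> sets \<kappa>" "{z. fst z > x / 2} \<in> sets \<kappa>"
      by (simp_all add: kibble_measure_def space_pair_measure)
  qed
  ultimately show ?thesis unfolding limit_tail_def single_tail_def by (simp only: limI)
qed

end

theorem corollary1:
  fixes M :: "'a measure" and N :: nat and p :: "nat \<Rightarrow> real"
    and Y :: "nat \<Rightarrow> 'a \<Rightarrow> nat" and c :: real
    and F :: "'b filter" and x\<^sub>1 x\<^sub>2 :: "'b \<Rightarrow> real"
  defines "\<alpha>\<^sub>1 \<equiv> \<lambda>t. limit_tail M N p Y (x\<^sub>1 t)"
    and "\<alpha>\<^sub>2 \<equiv> \<lambda>t. limit_tail M N p Y (x\<^sub>2 t)"
    and "\<alpha> \<equiv> \<lambda>t. limit_joint_tail M N p Y c (x\<^sub>1 t) (x\<^sub>2 t)"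
  assumes "N \<ge> 3" and "0 < c" and "c < 1"
    and "\<And>j. j \<in> {1..N} \<Longrightarrow> p j > 0" and "(\<Sum>j=1..N. p j) = 1"
    and "prob_space M"
    and "prob_space.indep_vars M (\<lambda>_. count_space UNIV) Y UNIV"
    and "\<And>i j. j \<in> {1..N} \<Longrightarrow> \<P>(\<omega> in M. Y i \<omega> = j) = p j"
    and "filterlim x\<^sub>1 at_top F" and "filterlim x\<^sub>2 at_top F"
    and "\<forall>\<^sub>F t in F. \<alpha>\<^sub>2 t = \<alpha>\<^sub>1 t"
  shows "((\<lambda>t. \<alpha> t /
            ((1 - c\<^sup>2) powr (3 / 2) * Gamma ((real N - 1) / 2) powr ((1 - c) / (1 + c))
              / (2 * c powr (real N / 2 - 1) * sqrt pi * (1 - c)\<^sup>2)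
             * (- ln (\<alpha>\<^sub>1 t)) powr (real N / 2 - (real N - 3) / (1 + c) - 2)
             * \<alpha>\<^sub>1 t powr (2 / (1 + c)))) \<longlongrightarrow> 1) F
         \<and> 2 / (1 + c) \<in> {1<..<2}"
proof
  show "2 / (1 + c) \<in> {1<..<2}" using assms(5,6) by (simp add: field_simps)
  interpret prob_space M by fact
  interpret pearson_pair M N p Y c
    using assms(4-8,10,11) by unfold_locales auto
  have \<alpha>\<^sub>1: "\<alpha>\<^sub>1 t = single_tail (x\<^sub>1 t / 2)" and \<alpha>\<^sub>2: "\<alpha>\<^sub>2 t = single_tail (x\<^sub>2 t / 2)" for t
    unfolding \<alpha>\<^sub>1_def \<alpha>\<^sub>2_def by (rule limit_tail_eq)+
  have \<alpha>_joint: "\<forall>\<^sub>F t in F. \<alpha> t = joint_tail (x\<^sub>1 t / 2)"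
  proof -
    have "\<forall>\<^sub>F t in F. x\<^sub>1 t > 0" "\<forall>\<^sub>F t in F. x\<^sub>2 t > 0"
      using assms(12,13) by (auto simp: filterlim_at_top_dense)
    then show ?thesis using assms(14)
    proof eventually_elim
      case (elim t)
      then have "single_tail (x\<^sub>1 t / 2) = single_tail (x\<^sub>2 t / 2)" by (simp add: \<alpha>\<^sub>1 \<alpha>\<^sub>2)
      then have "x\<^sub>1 t = x\<^sub>2 t"
        using single_tail_strict_antimono[of "x\<^sub>1 t / 2" "x\<^sub>2 t / 2"] single_tail_strict_antimono[of "x\<^sub>2 t / 2" "x\<^sub>1 t / 2"] elim
        by (cases "x\<^sub>1 t" "x\<^sub>2 t" rule: linorder_cases) auto
      then show ?case unfolding \<alpha>_def limit_joint_tail_eq joint_tail_def by simp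
    qed
  qed
  have half: "filterlim (\<lambda>t. x\<^sub>1 t / 2) at_top F"
    using filterlim_tendsto_pos_mult_at_top[OF tendsto_const _ assms(12), of "1 / 2"] by simp
  have params: "(real N - 3) / 2 + 1 = (real N - 1) / 2" "(real N - 3) / 2 + 1 / 2 = real N / 2 - 1"
    "(real N - 3) / 2 - 1 / 2 - 2 * ((real N - 3) / 2) / (1 + c) = real N / 2 - (real N - 3) / (1 + c) - 2"
    by (simp_all add: diff_divide_distrib)
  note lim = filterlim_compose[OF joint_tail_single_tail_ratio half, unfolded params \<beta>_def]
  show "((\<lambda>t. \<alpha> t /
            ((1 - c\<^sup>2) powr (3 / 2) * Gamma ((real N - 1) / 2) powr ((1 - c) / (1 + c))
              / (2 * c powr (real N / 2 - 1) * sqrt pi * (1 - c)\<^sup>2)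
             * (- ln (\<alpha>\<^sub>1 t)) powr (real N / 2 - (real N - 3) / (1 + c) - 2)
             * \<alpha>\<^sub>1 t powr (2 / (1 + c)))) \<longlongrightarrow> 1) F"
    by (rule Lim_transform_eventually[OF lim]) (use \<alpha>_joint in eventually_elim, simp only: \<alpha>\<^sub>1)
qed

end
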